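(* Let $n\in\{2,3\}$, $g,L>0$, $\rho_+>\rho_->0$, $\Omega=\mathbb{T}^{n-1}\times(-L,L)$ with $|\mathbb T|=1$, and let $F\in C^2([\rho_-,\rho_+])$ be uniformly convex with $F(\rho_\pm)=0$. Let $F_{1/3}(r)=-\frac13\frac{(\rho_+-r)(r-\rho_-)}{\rho_++\rho_--r}$. Let $T>0$ be such that $\max\{-F'(\rho_-),F'(\rho_+),-F_{1/3}'(\rho_-),F_{1/3}'(\rho_+)\}\frac{gT^2}{2}<L$. Let $z$ be a one-dimensional (potentially non-strict) subsolution whose density component is $\mu(y,t)=\bar\rho(y_n-\frac12gt^2,t)$, where $\bar\rho$ is the entropy solution of the Riemann problem $$\partial_t\bar\rho+gt\,\partial_{x_n}(F(\bar\rho))=0,\qquad\bar\rho(\cdot,0)=\rho_0,$$ and let $z_{1/3}$ be a one-dimensional non-strict subsolution whose density component is obtained in the same way with $F$ replaced by $F_{1/3}$. Denote by $E$ and $E_{1/3}$ the total energies induced by $z$ and $z_{1/3}$. Then for all $t\in[0,T)$, $$E(0)-E(t)\le E_{1/3}(0)-E_{1/3}(t),$$ i.e. among all such subsolutions the induced total energy dissipation is maximal for $F=F_{1/3}$.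
   Context: $\rho_0(x)=\rho_+$ for $x_n>0$ and $\rho_0(x)=\rho_-$ for $x_n<0$. Set $\mathscr D(t)=\Omega+\frac12gt^2e_n$, $\mathscr D=\{(y,t):t\in(0,T),\,y\in\mathscr D(t)\}$, $\overline{\mathscr D}^*=\bigcup_{t\in[0,T)}\overline{\mathscr D(t)}\times\{t\}$, $\partial_{rel}\mathscr D=\bigcup_{t\in(0,T)}\partial\mathscr D(t)\times\{t\}$, $\vec n$ the outer unit normal. $\mathcal S_0^{n\times n}$ is the space of symmetric traceless matrices, $Z=\mathbb R\times\mathbb R^n\times\mathbb R^n\times\mathbb R^n\times\mathcal S_0^{n\times n}\times\mathbb R\ni z=(\mu,w,m,h,\sigma,e)$, and $\lambda_{\max}$ is the largest eigenvalue. Linear system: $z\in L^\infty(\mathscr D;Z)$ with pressure $q\in L^\infty(\mathscr D)\cap L^1(\partial_{rel}\mathscr D)$ and dissipation measure $\nu\in(C_c^\infty(\overline{\mathscr D}^* ))^*$, $\nu[\varphi]\le0$ for $\varphi\ge0$, is a weak solution with initial data $(\rho_0,0,0)$ if for all $\Phi\in C_c^\infty(\overline{\mathscr D}^*;\mathbb R^n)$, $\Psi\in C_c^\infty(\overline{\mathscr D}^* )$: $\int_{\mathscr D}[m\cdot\partial_t\Phi+(\sigma+\frac2ne\,\mathrm{id}+q\,\mathrm{id}):\nabla\Phi]-\int_0^T\int_{\partial\mathscr D(t)}q\Phi\cdot\vec n=0$; $\int_{\mathscr D}(w-gte_n)\cdot\nabla\Psi=0$; $\int_{\mathscr D}[\mu\partial_t\Psi+m\cdot\nabla\Psi]+\int_\Omega\rho_0\Psi(\cdot,0)=0$;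 $\int_{\mathscr D}[e\partial_t\Psi+h\cdot\nabla\Psi]-\int_0^Tgt\int_{\partial\mathscr D(t)}q\Psi e_n\cdot\vec n=-\nu[\Psi]$. For $\mu\in(\rho_-,\rho_+)$ let $\tilde M(z)=\frac{\mu\rho_-\rho_+w\otimes w-\rho_-\rho_+(m\otimes w+w\otimes m)+(\rho_++\rho_--\mu)m\otimes m}{(\rho_+-\mu)(\mu-\rho_-)}-\sigma$ and $T_\pm(z)=\frac{\rho_\pm}2\frac{|m-\rho_\mp w|^2}{(\mu-\rho_\mp)^2}$. A subsolution (strict) is such a weak solution for which there are an open set $\mathscr U\subset\mathscr D$ (mixing zone) and $\varepsilon>0$ such that $z$ is continuous on $\mathscr U$, $q\in L^\infty(\mathscr U)\cap C^0(\mathscr U)$, $T_\pm(z)\in L^\infty(\mathscr U)$, on $\mathscr U$ there holds $\rho_-<\mu<\rho_+$ and (S) $\lambda_{\max}(\tilde M(z))+\varepsilon\big|h-(e+q)w-\frac{T_+(z)-T_-(z)}{\rho_+-\rho_-}(m-\mu w)\big|<\frac2ne$, and a.e. in $\mathscr D\setminus\mathscr U$: $m=\mu w$, $h=(e+q)w$, $\mu w\otimes w=\sigma+\frac2ne\,\mathrm{id}$, $\mu\in\{\rho_-,\rho_+\}$. It is one-dimensional if $z,q,\nu$ depend only on $(y_n,t)$, $w=gte_n$, $m_j=h_j=0$ for $j<n$, and $\sigma=\frac12\mathrm{diag}(-f,f)$ if $n=2$, $\sigma=\frac13\mathrm{diag}(-f,-f,2f)$ if $n=3$, where $f=\frac{\mu\rho_-\rho_+g^2t^2-2\rho_-\rho_+m_ngt+(\rho_++\rho_--\mu)m_n^2}{(\rho_+-\mu)(\mu-\rho_-)}$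 in $\mathscr U$ and $f=\mu g^2t^2$ where $\mu\in\{\rho_\pm\}$. A one-dimensional non-strict subsolution is defined in the same way except that (S) is replaced by: $e=\frac12f$ and $h=(e+q)w+\frac{T_+(z)-T_-(z)}{\rho_+-\rho_-}(m-\mu w)$. "Potentially non-strict" means strict or non-strict. The total energy induced by a subsolution is $E(t)=\int_{\mathscr D(t)}e-m_ngt+\mu gy_n\,dy$. *)

theory Defs
  imports "HOL-Analysis.Analysis"
begin

section \<open>Conventions\<close>

text \<open>
  The dimension is n = CARD('n) and \<^term>\<open>d :: 'n\<close> is the index of the vertical direction, so
  that the unit vector of gravity is \<^term>\<open>axis d 1 :: real^'n\<close>. The torus directions
  are the indices different from \<open>d\<close>: functions (sets) on the torus times a line are functions
  (sets) on the whole space that are 1-periodic in these directions, and integrals are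
  taken over one period. Space-time points are pairs \<open>(y, t)\<close>. Essentially bounded functions are
  represented by Borel functions.
\<close>

section \<open>Differentiability\<close>

text \<open>Derivative relative to a compact interval, hence one-sided at the end points.\<close>

definition deriv_on :: "real \<Rightarrow> real \<Rightarrow> (real \<Rightarrow> real) \<Rightarrow> real \<Rightarrow> real" where
  "deriv_on a b F r = vector_derivative F (at r within {a..b})"

definition C2_on :: "real \<Rightarrow> real \<Rightarrow> (real \<Rightarrow> real) \<Rightarrow> bool" where
  "C2_on a b F \<longleftrightarrow>
     F differentiable_on {a..b} \<and>
     deriv_on a b F differentiable_on {a..b} \<and>
     continuous_on {a..b} (deriv_on a b (deriv_on a b F))"

definition uniformly_convex_C2 :: "real \<Rightarrow> real \<Rightarrow> (real \<Rightarrow> real) \<Rightarrow> bool" where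
  "uniformly_convex_C2 a b F \<longleftrightarrow>
     C2_on a b F \<and> (\<exists>c>0. \<forall>r\<in>{a..b}. c \<le> deriv_on a b (deriv_on a b F) r)"

primrec Ck :: "nat \<Rightarrow> ('a::real_normed_vector \<Rightarrow> 'b::real_normed_vector) \<Rightarrow> bool" where
  "Ck 0 f \<longleftrightarrow> continuous_on UNIV f"
| "Ck (Suc k) f \<longleftrightarrow>
     (\<forall>x. f differentiable (at x)) \<and> (\<forall>v. Ck k (\<lambda>x. frechet_derivative f (at x) v))"

definition smooth :: "('a::real_normed_vector \<Rightarrow> 'b::real_normed_vector) \<Rightarrow> bool" where
  "smooth f \<longleftrightarrow> (\<forall>k. Ck k f)"

definition dt :: "('a::real_normed_vector \<times> real \<Rightarrow> 'b::real_normed_vector) \<Rightarrow> 'a \<times> real \<Rightarrow> 'b" where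
  "dt f p = frechet_derivative f (at p) (0, 1)"

definition dx :: "'n \<Rightarrow> ((real^'n) \<times> real \<Rightarrow> 'b::real_normed_vector) \<Rightarrow> (real^'n) \<times> real \<Rightarrow> 'b" where
  "dx j f p = frechet_derivative f (at p) (axis j 1, 0)"

definition grad :: "((real^'n) \<times> real \<Rightarrow> real) \<Rightarrow> (real^'n) \<times> real \<Rightarrow> real^'n" where
  "grad f p = (\<chi> j. dx j f p)"

definition jacobian :: "((real^'n) \<times> real \<Rightarrow> real^'n) \<Rightarrow> (real^'n) \<times> real \<Rightarrow> real^'n^'n" where
  "jacobian f p = (\<chi> i j. dx j f p $ i)"

section \<open>Linear algebra\<close>

definition outer_prod :: "real^'n \<Rightarrow> real^'n \<Rightarrow> real^'n^'n" where
  "outer_prod u v = (\<chi> i j. u $ i * v $ j)"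

definition frob :: "real^'n^'n \<Rightarrow> real^'n^'n \<Rightarrow> real" where
  "frob A B = (\<Sum>i\<in>UNIV. \<Sum>j\<in>UNIV. A $ i $ j * B $ i $ j)"

definition lambda_max :: "real^'n^'n \<Rightarrow> real" where
  "lambda_max A = Max {l. \<exists>v. v \<noteq> 0 \<and> A *v v = l *\<^sub>R v}"

section \<open>The moving domain\<close>

definition dom_at :: "real \<Rightarrow> real \<Rightarrow> 'n \<Rightarrow> real \<Rightarrow> (real^'n) set" where
  "dom_at g L d t = {y. - L < y $ d - g * t^2 / 2 \<and> y $ d - g * t^2 / 2 < L}"

definition dom :: "real \<Rightarrow> real \<Rightarrow> real \<Rightarrow> 'n \<Rightarrow> ((real^'n) \<times> real) set" where
  "dom g L T d = {(y, t). 0 < t \<and> t < T \<and> y \<in> dom_at g L d t}"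

definition dom_star :: "real \<Rightarrow> real \<Rightarrow> real \<Rightarrow> 'n \<Rightarrow> ((real^'n) \<times> real) set" where
  "dom_star g L T d = {(y, t). 0 \<le> t \<and> t < T \<and> y \<in> closure (dom_at g L d t)}"

definition hperiodic :: "'n \<Rightarrow> ((real^'n) \<times> real \<Rightarrow> 'b) \<Rightarrow> bool" where
  "hperiodic d f \<longleftrightarrow> (\<forall>j y t. j \<noteq> d \<longrightarrow> f (y + axis j 1, t) = f (y, t))"

definition cell :: "'n \<Rightarrow> (real^'n) set" where
  "cell d = {y. \<forall>j. j \<noteq> d \<longrightarrow> 0 \<le> y $ j \<and> y $ j < 1}"

definition int_dom ::
  "real \<Rightarrow> real \<Rightarrow> real \<Rightarrow> 'n \<Rightarrow> ((real^'n) \<times> real \<Rightarrow> real) \<Rightarrow> real" where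
  "int_dom g L T d f = (LINT p:(dom g L T d \<inter> cell d \<times> UNIV)|lborel. f p)"

definition int_dom_at :: "real \<Rightarrow> real \<Rightarrow> 'n \<Rightarrow> real \<Rightarrow> (real^'n \<Rightarrow> real) \<Rightarrow> real" where
  "int_dom_at g L d t f = (LINT y:(dom_at g L d t \<inter> cell d)|lborel. f y)"

definition at_height :: "'n \<Rightarrow> real \<Rightarrow> real^'n \<Rightarrow> real^'n" where
  "at_height d b y = (\<chi> i. if i = d then b else y $ i)"

definition unit_cube :: "(real^'n) set" where
  "unit_cube = {y. \<forall>j. 0 \<le> y $ j \<and> y $ j < 1}"

text \<open>
  Integral over the horizontal torus at height \<open>b\<close>. The dummy integration of the vertical
  coordinate over an interval of length one contributes the factor 1.
\<close>

definition int_height :: "'n \<Rightarrow> real \<Rightarrow> (real^'n \<Rightarrow> real) \<Rightarrow> real" where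
  "int_height d b f = (LINT y:unit_cube|lborel. f (at_height d b y))"

text \<open>
  Integral of the vertical component of \<open>f\<close> times the outer normal over the boundary at time \<open>t\<close>:
  the outer normal is \<open>\<plusminus>\<close> \<^term>\<open>axis d 1 :: real^'n\<close> at height \<open>\<plusminus>L + gt\<^sup>2/2\<close>.
\<close>

definition int_bdry_normal :: "real \<Rightarrow> real \<Rightarrow> 'n \<Rightarrow> real \<Rightarrow> (real^'n \<Rightarrow> real) \<Rightarrow> real" where
  "int_bdry_normal g L d t f =
     int_height d (L + g * t^2 / 2) f - int_height d (- L + g * t^2 / 2) f"

text \<open>
  Test functions: smooth up to the boundary and at time 0, without any vanishing condition
  there. The slices of \<^const>\<open>dom_star\<close> being compact modulo periods, compact support means
  vanishing near time \<open>T\<close>.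
\<close>

definition test_fun ::
  "real \<Rightarrow> real \<Rightarrow> real \<Rightarrow> 'n \<Rightarrow> ((real^'n) \<times> real \<Rightarrow> 'b::real_normed_vector) \<Rightarrow> bool" where
  "test_fun g L T d \<phi> \<longleftrightarrow>
     smooth \<phi> \<and> hperiodic d \<phi> \<and>
     (\<exists>\<tau><T. \<forall>(y, t)\<in>dom_star g L T d. \<tau> \<le> t \<longrightarrow> \<phi> (y, t) = 0)"

definition Linf :: "'a::euclidean_space set \<Rightarrow> ('a \<Rightarrow> 'b::real_normed_vector) \<Rightarrow> bool" where
  "Linf S f \<longleftrightarrow>
     set_borel_measurable lborel S f \<and> (\<exists>C. AE x in lborel. x \<in> S \<longrightarrow> norm (f x) \<le> C)"

section \<open>The linear system\<close>

text \<open>The components are \<open>(\<mu>, w, m, h, \<sigma>, e)\<close>.\<close>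

type_synonym 'n Z = "real \<times> (real^'n) \<times> (real^'n) \<times> (real^'n) \<times> (real^'n^'n) \<times> real"

definition z_mu :: "'n::finite Z \<Rightarrow> real" where "z_mu = (\<lambda>(\<mu>, w, m, h, \<sigma>, e). \<mu>)"
definition z_w :: "'n::finite Z \<Rightarrow> real^'n" where "z_w = (\<lambda>(\<mu>, w, m, h, \<sigma>, e). w)"
definition z_m :: "'n::finite Z \<Rightarrow> real^'n" where "z_m = (\<lambda>(\<mu>, w, m, h, \<sigma>, e). m)"
definition z_h :: "'n::finite Z \<Rightarrow> real^'n" where "z_h = (\<lambda>(\<mu>, w, m, h, \<sigma>, e). h)"
definition z_sigma :: "'n::finite Z \<Rightarrow> real^'n^'n" where "z_sigma = (\<lambda>(\<mu>, w, m, h, \<sigma>, e). \<sigma>)"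
definition z_e :: "'n::finite Z \<Rightarrow> real" where "z_e = (\<lambda>(\<mu>, w, m, h, \<sigma>, e). e)"

definition rho0 :: "real \<Rightarrow> real \<Rightarrow> real \<Rightarrow> real" where
  "rho0 \<rho>m \<rho>p s = (if 0 < s then \<rho>p else \<rho>m)"

text \<open>
  A linear functional that is nonpositive on nonnegative test functions is automatically
  continuous and depends only on the restriction of the test function to \<^const>\<open>dom_star\<close>.
\<close>

definition dissipation_measure ::
  "real \<Rightarrow> real \<Rightarrow> real \<Rightarrow> 'n \<Rightarrow> (((real^'n) \<times> real \<Rightarrow> real) \<Rightarrow> real) \<Rightarrow> bool" where
  "dissipation_measure g L T d \<nu> \<longleftrightarrow>
     (\<forall>\<phi> \<psi> a b. test_fun g L T d \<phi> \<and> test_fun g L T d \<psi> \<longrightarrow>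
        \<nu> (\<lambda>p. a * \<phi> p + b * \<psi> p) = a * \<nu> \<phi> + b * \<nu> \<psi>) \<and>
     (\<forall>\<phi>. test_fun g L T d \<phi> \<and> (\<forall>p\<in>dom_star g L T d. 0 \<le> \<phi> p) \<longrightarrow> \<nu> \<phi> \<le> 0)"

text \<open>
  The pressure \<open>q\<close> is given on the domain and, independently, on its lateral boundary.
\<close>

definition weak_solution ::
  "real \<Rightarrow> real \<Rightarrow> real \<Rightarrow> real \<Rightarrow> real \<Rightarrow> 'n::finite \<Rightarrow>
   ((real^'n) \<times> real \<Rightarrow> 'n Z) \<Rightarrow> ((real^'n) \<times> real \<Rightarrow> real) \<Rightarrow>
   (((real^'n) \<times> real \<Rightarrow> real) \<Rightarrow> real) \<Rightarrow> bool" where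
  "weak_solution g L T \<rho>m \<rho>p d z q \<nu> \<longleftrightarrow>
     Linf (dom g L T d) z \<and> hperiodic d z \<and>
     (AE p in lborel. p \<in> dom g L T d \<longrightarrow>
        transpose (z_sigma (z p)) = z_sigma (z p) \<and> trace (z_sigma (z p)) = 0) \<and>
     Linf (dom g L T d) q \<and> hperiodic d q \<and>
     (\<forall>b\<in>{L, - L}. set_integrable lborel (unit_cube \<times> {0<..<T})
        (\<lambda>(y, t). q (at_height d (b + g * t^2 / 2) y, t))) \<and>
     dissipation_measure g L T d \<nu> \<and>
     (\<forall>\<Phi> :: (real^'n) \<times> real \<Rightarrow> real^'n. test_fun g L T d \<Phi> \<longrightarrow>
        int_dom g L T d (\<lambda>p. z_m (z p) \<bullet> dt \<Phi> p +
          frob (z_sigma (z p) + (2 / real CARD('n) * z_e (z p)) *\<^sub>R mat 1 + q p *\<^sub>R mat 1)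
            (jacobian \<Phi> p))
        - (LINT t:{0<..<T}|lborel. int_bdry_normal g L d t (\<lambda>y. q (y, t) * \<Phi> (y, t) $ d)) = 0) \<and>
     (\<forall>\<Psi> :: (real^'n) \<times> real \<Rightarrow> real. test_fun g L T d \<Psi> \<longrightarrow>
        int_dom g L T d (\<lambda>(y, t). (z_w (z (y, t)) - (g * t) *\<^sub>R axis d 1) \<bullet> grad \<Psi> (y, t)) = 0 \<and>
        int_dom g L T d (\<lambda>p. z_mu (z p) * dt \<Psi> p + z_m (z p) \<bullet> grad \<Psi> p)
        + int_dom_at g L d 0 (\<lambda>y. rho0 \<rho>m \<rho>p (y $ d) * \<Psi> (y, 0)) = 0 \<and>
        int_dom g L T d (\<lambda>p. z_e (z p) * dt \<Psi> p + z_h (z p) \<bullet> grad \<Psi> p)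
        - (LINT t:{0<..<T}|lborel.
             g * t * int_bdry_normal g L d t (\<lambda>y. q (y, t) * \<Psi> (y, t))) = - \<nu> \<Psi>)"

section \<open>Subsolutions\<close>

definition M_tilde :: "real \<Rightarrow> real \<Rightarrow> 'n::finite Z \<Rightarrow> real^'n^'n" where
  "M_tilde \<rho>m \<rho>p = (\<lambda>(\<mu>, w, m, h, \<sigma>, e).
     (1 / ((\<rho>p - \<mu>) * (\<mu> - \<rho>m))) *\<^sub>R
       ((\<mu> * \<rho>m * \<rho>p) *\<^sub>R outer_prod w w
        - (\<rho>m * \<rho>p) *\<^sub>R (outer_prod m w + outer_prod w m)
        + (\<rho>p + \<rho>m - \<mu>) *\<^sub>R outer_prod m m)
     - \<sigma>)"

definition T_plus :: "real \<Rightarrow> real \<Rightarrow> 'n::finite Z \<Rightarrow> real" where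
  "T_plus \<rho>m \<rho>p = (\<lambda>(\<mu>, w, m, h, \<sigma>, e). \<rho>p / 2 * (norm (m - \<rho>m *\<^sub>R w))^2 / (\<mu> - \<rho>m)^2)"

definition T_minus :: "real \<Rightarrow> real \<Rightarrow> 'n::finite Z \<Rightarrow> real" where
  "T_minus \<rho>m \<rho>p = (\<lambda>(\<mu>, w, m, h, \<sigma>, e). \<rho>m / 2 * (norm (m - \<rho>p *\<^sub>R w))^2 / (\<mu> - \<rho>p)^2)"

definition h_relaxed :: "real \<Rightarrow> real \<Rightarrow> 'n::finite Z \<Rightarrow> real \<Rightarrow> real^'n" where
  "h_relaxed \<rho>m \<rho>p z q =
     (z_e z + q) *\<^sub>R z_w z
     + ((T_plus \<rho>m \<rho>p z - T_minus \<rho>m \<rho>p z) / (\<rho>p - \<rho>m)) *\<^sub>R (z_m z - z_mu z *\<^sub>R z_w z)"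

text \<open>Everything required of the mixing zone except the strict inequality (S) and its replacement.\<close>

definition mixing_zone ::
  "real \<Rightarrow> real \<Rightarrow> real \<Rightarrow> real \<Rightarrow> real \<Rightarrow> 'n::finite \<Rightarrow>
   ((real^'n) \<times> real \<Rightarrow> 'n Z) \<Rightarrow> ((real^'n) \<times> real \<Rightarrow> real) \<Rightarrow> ((real^'n) \<times> real) set \<Rightarrow> bool" where
  "mixing_zone g L T \<rho>m \<rho>p d z q U \<longleftrightarrow>
     open U \<and> U \<subseteq> dom g L T d \<and> hperiodic d (\<lambda>p. p \<in> U) \<and>
     continuous_on U z \<and> continuous_on U q \<and> Linf U q \<and>
     Linf U (\<lambda>p. T_plus \<rho>m \<rho>p (z p)) \<and> Linf U (\<lambda>p. T_minus \<rho>m \<rho>p (z p)) \<and>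
     (\<forall>p\<in>U. \<rho>m < z_mu (z p) \<and> z_mu (z p) < \<rho>p) \<and>
     (AE p in lborel. p \<in> dom g L T d - U \<longrightarrow>
        z_m (z p) = z_mu (z p) *\<^sub>R z_w (z p) \<and>
        z_h (z p) = (z_e (z p) + q p) *\<^sub>R z_w (z p) \<and>
        z_mu (z p) *\<^sub>R outer_prod (z_w (z p)) (z_w (z p)) =
          z_sigma (z p) + (2 / real CARD('n) * z_e (z p)) *\<^sub>R mat 1 \<and>
        z_mu (z p) \<in> {\<rho>m, \<rho>p})"

definition strict_subsolution ::
  "real \<Rightarrow> real \<Rightarrow> real \<Rightarrow> real \<Rightarrow> real \<Rightarrow> 'n::finite \<Rightarrow>
   ((real^'n) \<times> real \<Rightarrow> 'n Z) \<Rightarrow> ((real^'n) \<times> real \<Rightarrow> real) \<Rightarrow>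
   (((real^'n) \<times> real \<Rightarrow> real) \<Rightarrow> real) \<Rightarrow> bool" where
  "strict_subsolution g L T \<rho>m \<rho>p d z q \<nu> \<longleftrightarrow>
     weak_solution g L T \<rho>m \<rho>p d z q \<nu> \<and>
     (\<exists>U \<epsilon>. mixing_zone g L T \<rho>m \<rho>p d z q U \<and> 0 < \<epsilon> \<and>
        (\<forall>p\<in>U. lambda_max (M_tilde \<rho>m \<rho>p (z p))
                 + \<epsilon> * norm (z_h (z p) - h_relaxed \<rho>m \<rho>p (z p) (q p))
               < 2 / real CARD('n) * z_e (z p)))"

definition f_1d :: "real \<Rightarrow> real \<Rightarrow> real \<Rightarrow> 'n::finite \<Rightarrow> 'n Z \<Rightarrow> real \<Rightarrow> real" where
  "f_1d g \<rho>m \<rho>p d z t =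
     (let \<mu> = z_mu z; md = z_m z $ d in
      if \<mu> \<in> {\<rho>m, \<rho>p} then \<mu> * g^2 * t^2
      else (\<mu> * \<rho>m * \<rho>p * g^2 * t^2 - 2 * \<rho>m * \<rho>p * md * g * t + (\<rho>p + \<rho>m - \<mu>) * md^2)
           / ((\<rho>p - \<mu>) * (\<mu> - \<rho>m)))"

text \<open>\<open>diag (-f, f) / 2\<close> in dimension 2 and \<open>diag (-f, -f, 2 f) / 3\<close> in dimension 3.\<close>

definition sigma_1d :: "'n::finite \<Rightarrow> real \<Rightarrow> real^'n^'n" where
  "sigma_1d d f = (\<chi> i j.
     if i \<noteq> j then 0
     else if CARD('n) = 2 then (if i = d then f / 2 else - f / 2)
     else (if i = d then 2 * f / 3 else - f / 3))"

text \<open>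
  For \<open>q\<close> the dependence on \<open>(y $ d, t)\<close> is also required for the boundary values, and for
  \<open>\<nu>\<close> it means invariance under horizontal translations.
\<close>

definition one_dimensional ::
  "real \<Rightarrow> real \<Rightarrow> real \<Rightarrow> real \<Rightarrow> real \<Rightarrow> 'n::finite \<Rightarrow>
   ((real^'n) \<times> real \<Rightarrow> 'n Z) \<Rightarrow> ((real^'n) \<times> real \<Rightarrow> real) \<Rightarrow>
   (((real^'n) \<times> real \<Rightarrow> real) \<Rightarrow> real) \<Rightarrow> bool" where
  "one_dimensional g L T \<rho>m \<rho>p d z q \<nu> \<longleftrightarrow>
     (\<exists>z1 :: real \<times> real \<Rightarrow> 'n Z. AE (y, t) in lborel. (y, t) \<in> dom g L T d \<longrightarrow>
        z (y, t) = z1 (y $ d, t)) \<and>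
     (\<exists>q1 :: real \<times> real \<Rightarrow> real.
        (AE (y, t) in lborel. (y, t) \<in> dom g L T d \<longrightarrow> q (y, t) = q1 (y $ d, t)) \<and>
        (\<forall>b\<in>{L, - L}. AE (y, t) in lborel. y \<in> unit_cube \<and> 0 < t \<and> t < T \<longrightarrow>
           q (at_height d (b + g * t^2 / 2) y, t) = q1 (b + g * t^2 / 2, t))) \<and>
     (\<forall>\<phi> j s. test_fun g L T d \<phi> \<and> j \<noteq> d \<longrightarrow>
        \<nu> (\<lambda>(y, t). \<phi> (y + s *\<^sub>R axis j 1, t)) = \<nu> \<phi>) \<and>
     (AE (y, t) in lborel. (y, t) \<in> dom g L T d \<longrightarrow>
        z_w (z (y, t)) = (g * t) *\<^sub>R axis d 1 \<and>
        (\<forall>j. j \<noteq> d \<longrightarrow> z_m (z (y, t)) $ j = 0 \<and> z_h (z (y, t)) $ j = 0) \<and>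
        z_sigma (z (y, t)) = sigma_1d d (f_1d g \<rho>m \<rho>p d (z (y, t)) t))"

definition strict_subsolution_1d ::
  "real \<Rightarrow> real \<Rightarrow> real \<Rightarrow> real \<Rightarrow> real \<Rightarrow> 'n::finite \<Rightarrow>
   ((real^'n) \<times> real \<Rightarrow> 'n Z) \<Rightarrow> ((real^'n) \<times> real \<Rightarrow> real) \<Rightarrow>
   (((real^'n) \<times> real \<Rightarrow> real) \<Rightarrow> real) \<Rightarrow> bool" where
  "strict_subsolution_1d g L T \<rho>m \<rho>p d z q \<nu> \<longleftrightarrow>
     strict_subsolution g L T \<rho>m \<rho>p d z q \<nu> \<and> one_dimensional g L T \<rho>m \<rho>p d z q \<nu>"

definition nonstrict_subsolution_1d ::
  "real \<Rightarrow> real \<Rightarrow> real \<Rightarrow> real \<Rightarrow> real \<Rightarrow> 'n::finite \<Rightarrow>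
   ((real^'n) \<times> real \<Rightarrow> 'n Z) \<Rightarrow> ((real^'n) \<times> real \<Rightarrow> real) \<Rightarrow>
   (((real^'n) \<times> real \<Rightarrow> real) \<Rightarrow> real) \<Rightarrow> bool" where
  "nonstrict_subsolution_1d g L T \<rho>m \<rho>p d z q \<nu> \<longleftrightarrow>
     weak_solution g L T \<rho>m \<rho>p d z q \<nu> \<and> one_dimensional g L T \<rho>m \<rho>p d z q \<nu> \<and>
     (\<exists>U. mixing_zone g L T \<rho>m \<rho>p d z q U \<and>
        (\<forall>(y, t)\<in>U. z_e (z (y, t)) = f_1d g \<rho>m \<rho>p d (z (y, t)) t / 2 \<and>
                     z_h (z (y, t)) = h_relaxed \<rho>m \<rho>p (z (y, t)) (q (y, t))))"

section \<open>The total energy\<close>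

definition energy_slice ::
  "real \<Rightarrow> real \<Rightarrow> 'n::finite \<Rightarrow> ((real^'n) \<times> real \<Rightarrow> 'n Z) \<Rightarrow> real \<Rightarrow> real" where
  "energy_slice g L d z t = int_dom_at g L d t
     (\<lambda>y. z_e (z (y, t)) - z_m (z (y, t)) $ d * g * t + z_mu (z (y, t)) * g * y $ d)"

text \<open>
  Since \<open>z\<close> is only an equivalence class on the open time interval, its slice integrals are
  determined only for almost every time, and not at time 0. The energy is the representative given
  by right-sided time averages: it does not depend on the choice of \<open>z\<close> in its class, agrees with
  \<^const>\<open>energy_slice\<close> for almost every time (Lebesgue), and at every time at which the latter
  is right-continuous. For weak solutions the limit exists at every time, because by the
  equations and \<open>\<nu> \<le> 0\<close> the slice energy is almost everywhere equal to a nonincreasing function.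
  For the one-dimensional subsolutions the value at time 0 is the energy of the initial data
  \<open>(\<rho>\<^sub>0, 0, 0)\<close>, i.e. the integral of \<open>\<rho>\<^sub>0 g y\<^sub>n\<close> over \<open>\<Omega>\<close>.
\<close>

definition total_energy ::
  "real \<Rightarrow> real \<Rightarrow> 'n::finite \<Rightarrow> ((real^'n) \<times> real \<Rightarrow> 'n Z) \<Rightarrow> real \<Rightarrow> real" where
  "total_energy g L d z t =
     Lim (at_right 0) (\<lambda>\<delta>. (LINT s:{t<..<t + \<delta>}|lborel. energy_slice g L d z s) / \<delta>)"

section \<open>The Riemann problem\<close>

definition line_test_fun :: "real \<Rightarrow> (real \<times> real \<Rightarrow> real) \<Rightarrow> bool" where
  "line_test_fun T \<phi> \<longleftrightarrow>
     smooth \<phi> \<and>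
     (\<exists>R. \<exists>\<tau><T. \<forall>x t. 0 \<le> t \<and> t < T \<and> (\<tau> \<le> t \<or> R < \<bar>x\<bar>) \<longrightarrow> \<phi> (x, t) = 0)"

text \<open>
  Entropy solutions in the sense of entropy/entropy-flux pairs \<open>(\<eta>, Q)\<close>, \<open>Q' = \<eta>' F'\<close>; the entropies
  \<open>\<eta>(r) = \<plusminus>r\<close> contain the weak form of the conservation law. Values are restricted to
  \<open>[\<rho>m, \<rho>p]\<close>, the domain of the flux \<open>F\<close>; this is imposed on a representative everywhere, so that
  the compositions with \<open>\<eta>\<close> and \<open>Q\<close> are measurable.
\<close>

definition entropy_solution ::
  "real \<Rightarrow> real \<Rightarrow> real \<Rightarrow> real \<Rightarrow> (real \<Rightarrow> real) \<Rightarrow> (real \<times> real \<Rightarrow> real) \<Rightarrow> bool" where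
  "entropy_solution g T \<rho>m \<rho>p F \<rho> \<longleftrightarrow>
     set_borel_measurable lborel (UNIV \<times> {0<..<T}) \<rho> \<and>
     (\<forall>x. \<forall>t\<in>{0<..<T}. \<rho> (x, t) \<in> {\<rho>m..\<rho>p}) \<and>
     (\<forall>\<eta> Q \<phi>. C2_on \<rho>m \<rho>p \<eta> \<and> convex_on {\<rho>m..\<rho>p} \<eta> \<and>
        (\<forall>r\<in>{\<rho>m..\<rho>p}.
           (Q has_real_derivative deriv_on \<rho>m \<rho>p \<eta> r * deriv_on \<rho>m \<rho>p F r)
             (at r within {\<rho>m..\<rho>p})) \<and>
        line_test_fun T \<phi> \<and> (\<forall>x. \<forall>t\<in>{0..<T}. 0 \<le> \<phi> (x, t)) \<longrightarrow>
        0 \<le> (LINT (x, t):UNIV \<times> {0<..<T}|lborel.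
               \<eta> (\<rho> (x, t)) * frechet_derivative \<phi> (at (x, t)) (0, 1)
               + g * t * Q (\<rho> (x, t)) * frechet_derivative \<phi> (at (x, t)) (1, 0))
             + (LINT x|lborel. \<eta> (rho0 \<rho>m \<rho>p x) * \<phi> (x, 0)))"

definition density_from ::
  "real \<Rightarrow> real \<Rightarrow> real \<Rightarrow> 'n::finite \<Rightarrow> ((real^'n) \<times> real \<Rightarrow> 'n Z) \<Rightarrow> (real \<times> real \<Rightarrow> real) \<Rightarrow> bool" where
  "density_from g L T d z \<rho> \<longleftrightarrow>
     (AE (y, t) in lborel. (y, t) \<in> dom g L T d \<longrightarrow>
        z_mu (z (y, t)) = \<rho> (y $ d - g * t^2 / 2, t))"

definition F_third :: "real \<Rightarrow> real \<Rightarrow> real \<Rightarrow> real" where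
  "F_third \<rho>m \<rho>p r = - (1 / 3) * ((\<rho>p - r) * (r - \<rho>m)) / (\<rho>p + \<rho>m - r)"

end

theory Submission
  imports Defs "HOL-Real_Asymp.Real_Asymp"
begin

text \<open>
  In the moving frame \<open>x = y\<^sub>d - \<tau>\<close>, \<open>\<tau> = g t\<^sup>2 / 2\<close>, both sides of the inequality can be computed.

  The flux is convex and the initial density jumps up from \<open>\<rho>m\<close> to \<open>\<rho>p\<close>, so the entropy solution is the
  rarefaction fan \<open>\<rho> = R (x / \<tau>)\<close> with \<open>R\<close> the inverse of \<open>F'\<close>. Uniqueness is a maximum principle along
  characteristics: for each level \<open>k\<close> the cubic entropy \<open>max 0 (r - k) ^ 3\<close>, tested on the region \<open>x < F' k * \<tau>\<close>
  behind the characteristic of \<open>k\<close>, gives \<open>\<rho> \<le> k\<close> there, and symmetrically \<open>\<rho> \<ge> k\<close> ahead of it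
  (\<open>entropy_solution_one_sided\<close>, \<open>entropy_solution_eq_fan\<close>). Conservation of mass, with no mass
  flux through the top and the bottom, then forces \<open>m\<^sub>d = g t (\<rho> + F \<rho>)\<close> (\<open>defect_zero\<close>).

  Given \<open>\<rho>\<close> and \<open>m\<close>, the hull inequality says \<open>e \<ge> f / 2\<close>, with equality in the non-strict case. Let
  \<open>a r = (\<rho>p + \<rho>m - r) / ((\<rho>p - r) * (r - \<rho>m))\<close>. Inserting \<open>m\<^sub>d\<close> gives
  \<open>f / 2 - m\<^sub>d g t + \<rho> g y\<^sub>d = (g t)\<^sup>2 / 2 * a \<rho> * (F \<rho>)\<^sup>2 + \<rho> g x\<close>, and the substitution \<open>x = \<tau> * F' r\<close> turns the
  integral over the strip into \<open>E t \<ge> E\<^sub>0 + g\<^sup>3 t\<^sup>4 / 8 * J F\<close>, where \<open>E\<^sub>0\<close> is the energy of the initial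
  data and \<open>J F\<close> is the integral of \<open>2 a F\<^sup>2 F'' - F'\<^sup>2\<close> over \<open>{\<rho>m..\<rho>p}\<close> (\<open>dissipation_le\<close>; below, \<open>a\<close> is called
  \<open>weight\<close> and \<open>J F\<close> is \<open>energy_coeff\<close>); equality holds for
  non-strict subsolutions (\<open>dissipation_eq\<close>). The inequality \<open>E 0 \<le> E\<^sub>0\<close>, and the very existence
  of the limits of right-sided averages defining the total energy, come from the energy inequality: tested with
  differences of slopes of a convex ramp it says that these averages do not increase with their length.

  It remains to see \<open>J F \<ge> J F\<^sub>1\<^sub>/\<^sub>3\<close>. Let \<open>b = 1 / a\<close> and \<open>u = - F / b\<close>, so that \<open>F\<^sub>1\<^sub>/\<^sub>3\<close> is the
  case \<open>u = 1 / 3\<close>. After an integration by parts the integrand is \<open>F'' (2 a F\<^sup>2 + F)\<close>, and it is bounded below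
  pointwise by \<open>b b'' / 27\<close> plus the exact derivative of \<open>\<kappa> u * b\<^sup>2 * u'\<close>, where \<open>\<kappa> u = (1 - 2 u) u\<close> for
  \<open>u \<ge> 1 / 4\<close> and \<open>\<kappa> u = 1 / 8\<close> otherwise. The exact derivative integrates to zero and for \<open>u = 1 / 3\<close> the bound is
  attained (\<open>calibration_pointwise\<close>, \<open>energy_coeff_lower_bound\<close>, \<open>energy_coeff_F_third\<close>). Convexity of \<open>F\<close> enters
  where \<open>u < 1 / 4\<close>.
\<close>

section \<open>Smooth functions and smooth steps\<close>

text \<open>
  The recursive definition of \<^const>\<open>Ck\<close> passes to directional derivatives, so closure of the class
  under a construction needs its derivative to be expressible by the same constructions; for a product and a
  composition this is the product rule and the chain rule.
\<close>
lemma CkI: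
  assumes "\<And>x. (f has_derivative f' x) (at x)" "\<And>v. Ck k (\<lambda>x. f' x v)"
  shows "Ck (Suc k) f"
proof -
  have "frechet_derivative f (at x) = f' x" for x
    using assms(1)[of x] by (rule frechet_derivative_at[symmetric])
  then show ?thesis
    using assms by (auto simp: differentiable_def)
qed

lemma Ck_Suc_has_derivative:
  assumes "Ck (Suc k) f"
  shows "(f has_derivative frechet_derivative f (at x)) (at x)"
  using assms frechet_derivative_works by auto

lemma Ck_Suc_imp_Ck: "Ck (Suc k) f \<Longrightarrow> Ck k f"
proof (induction k arbitrary: f)
  case 0
  then show ?case
    by (simp add: continuous_at_imp_continuous_on differentiable_imp_continuous_within)
next
  case (Suc k)
  then show ?case by (subst Ck.simps, subst (asm) Ck.simps) blast
qed

lemma Ck_const: "Ck k (\<lambda>x. c)"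
proof (induction k arbitrary: c)
  case 0
  then show ?case by simp
next
  case (Suc k)
  then show ?case by (intro CkI[where f' = "\<lambda>x v. 0"]) auto
qed

lemma Ck_linear: "bounded_linear f \<Longrightarrow> Ck k f"
proof (cases k)
  case 0
  moreover assume "bounded_linear f"
  ultimately show ?thesis by (simp add: linear_continuous_on)
next
  case (Suc k)
  assume "bounded_linear f"
  then show ?thesis unfolding Suc
    by (intro CkI[where f' = "\<lambda>x. f"] bounded_linear_imp_has_derivative Ck_const)
qed

lemma Ck_add: "Ck k f \<Longrightarrow> Ck k g \<Longrightarrow> Ck k (\<lambda>x. f x + g x)"
proof (induction k arbitrary: f g)
  case 0
  then show ?case by (simp add: continuous_on_add)
next
  case (Suc k)
  show ?case
    by (rule CkI[where f' = "\<lambda>x v. frechet_derivative f (at x) v + frechet_derivative g (at x) v"],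
      intro has_derivative_add Ck_Suc_has_derivative[OF Suc.prems(1)]
        Ck_Suc_has_derivative[OF Suc.prems(2)])
     (use Suc in auto)
qed

lemma Ck_scaleR:
  fixes f :: "'a::real_normed_vector \<Rightarrow> real" and g :: "'a \<Rightarrow> 'b::real_normed_vector"
  shows "Ck k f \<Longrightarrow> Ck k g \<Longrightarrow> Ck k (\<lambda>x. f x *\<^sub>R g x)"
proof (induction k arbitrary: f g)
  case 0
  then show ?case by (simp add: continuous_on_scaleR)
next
  case (Suc k)
  note prems = Suc.prems
  show ?case
  proof (rule CkI[where f' = "\<lambda>x v. f x *\<^sub>R frechet_derivative g (at x) v + frechet_derivative f (at x) v *\<^sub>R g x"])
    show "((\<lambda>x. f x *\<^sub>R g x) has_derivative (\<lambda>v. f x *\<^sub>R frechet_derivative g (at x) v + frechet_derivative f (at x) v *\<^sub>R g x)) (at x)" for x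
      by (intro has_derivative_scaleR Ck_Suc_has_derivative[OF prems(1)] Ck_Suc_has_derivative[OF prems(2)])
    show "Ck k (\<lambda>x. f x *\<^sub>R frechet_derivative g (at x) v + frechet_derivative f (at x) v *\<^sub>R g x)" for v
      using prems by (intro Ck_add Suc.IH) (auto intro: Ck_Suc_imp_Ck simp del: Ck.simps(2) simp: Ck.simps(2)[of k f] Ck.simps(2)[of k g])
  qed
qed

lemma Ck_mult:
  fixes f g :: "'a::real_normed_vector \<Rightarrow> real"
  shows "Ck k f \<Longrightarrow> Ck k g \<Longrightarrow> Ck k (\<lambda>x. f x * g x)"
  using Ck_scaleR[of k f g] by simp

lemma Ck_compose:
  fixes f :: "real \<Rightarrow> real" and g :: "'a::real_normed_vector \<Rightarrow> real"
  shows "Ck k f \<Longrightarrow> Ck k g \<Longrightarrow> Ck k (\<lambda>x. f (g x))"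
proof (induction k arbitrary: f g)
  case 0
  then show ?case by (simp add: continuous_on_compose2[of UNIV f UNIV g])
next
  case (Suc k)
  note prems = Suc.prems
  let ?f' = "\<lambda>y. frechet_derivative f (at y) 1"
  show ?case
  proof (rule CkI[where f' = "\<lambda>x v. ?f' (g x) * frechet_derivative g (at x) v"])
    fix x
    have "frechet_derivative f (at (g x)) u = ?f' (g x) * u" for u
      using linear_scale[OF linear_frechet_derivative, of f "at (g x)" u 1] prems(1)
      by (simp add: mult.commute)
    then have *: "(\<lambda>v. frechet_derivative f (at (g x)) (frechet_derivative g (at x) v)) =
        (\<lambda>v. ?f' (g x) * frechet_derivative g (at x) v)"
      by (intro ext)
    show "((\<lambda>x. f (g x)) has_derivative (\<lambda>v. ?f' (g x) * frechet_derivative g (at x) v)) (at x)"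
      by (rule has_derivative_eq_rhs[OF has_derivative_compose[OF Ck_Suc_has_derivative[OF prems(2), of x]
            Ck_Suc_has_derivative[OF prems(1), of "g x"]] *])
  next
    fix v
    have *: "Ck k ?f'" "Ck k (\<lambda>x. frechet_derivative g (at x) v)"
      using prems by simp_all
    show "Ck k (\<lambda>x. ?f' (g x) * frechet_derivative g (at x) v)"
      by (rule Ck_mult[OF Suc.IH[OF *(1) Ck_Suc_imp_Ck[OF prems(2)]] *(2)])
  qed
qed

lemma smooth_const: "smooth (\<lambda>x. c)"
  by (simp add: smooth_def Ck_const)

lemma smooth_linear: "bounded_linear f \<Longrightarrow> smooth f"
  by (simp add: smooth_def Ck_linear)

lemma smooth_add: "smooth f \<Longrightarrow> smooth g \<Longrightarrow> smooth (\<lambda>x. f x + g x)"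
  by (simp add: smooth_def Ck_add)

lemma smooth_scaleR:
  fixes f :: "'a::real_normed_vector \<Rightarrow> real"
  shows "smooth f \<Longrightarrow> smooth g \<Longrightarrow> smooth (\<lambda>x. f x *\<^sub>R g x)"
  by (simp add: smooth_def Ck_scaleR)

lemma smooth_mult:
  fixes f :: "'a::real_normed_vector \<Rightarrow> real"
  shows "smooth f \<Longrightarrow> smooth g \<Longrightarrow> smooth (\<lambda>x. f x * g x)"
  by (simp add: smooth_def Ck_mult)

lemma smooth_power:
  fixes f :: "'a::real_normed_vector \<Rightarrow> real"
  shows "smooth f \<Longrightarrow> smooth (\<lambda>x. f x ^ k)"
  by (induction k) (auto intro: smooth_mult smooth_const)

lemma smooth_uminus:
  fixes f :: "'a::real_normed_vector \<Rightarrow> real"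
  shows "smooth f \<Longrightarrow> smooth (\<lambda>x. - f x)"
  using smooth_mult[OF smooth_const[of "-1"], of f] by simp

lemma smooth_diff:
  fixes f :: "'a::real_normed_vector \<Rightarrow> real"
  shows "smooth f \<Longrightarrow> smooth g \<Longrightarrow> smooth (\<lambda>x. f x - g x)"
  using smooth_add[OF _ smooth_uminus, of f g] by simp

lemma smooth_compose:
  fixes f :: "real \<Rightarrow> real" and g :: "'a::real_normed_vector \<Rightarrow> real"
  shows "smooth f \<Longrightarrow> smooth g \<Longrightarrow> smooth (\<lambda>x. f (g x))"
  by (simp add: smooth_def Ck_compose)

lemma smooth_deriv:
  fixes f :: "real \<Rightarrow> real"
  assumes "smooth f" "\<And>x. (f has_real_derivative f' x) (at x)"
  shows "smooth f'"
proof -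
  have "frechet_derivative f (at x) = (*) (f' x)" for x
    using assms(2)[of x] unfolding has_field_derivative_def by (rule frechet_derivative_at[symmetric])
  moreover have "Ck k (\<lambda>x. frechet_derivative f (at x) 1)" for k
    using assms(1) unfolding smooth_def by (metis Ck.simps(2))
  ultimately show ?thesis by (simp add: smooth_def)
qed

lemma smooth_fst: "smooth (fst :: 'a::real_normed_vector \<times> 'b::real_normed_vector \<Rightarrow> 'a)"
  by (intro smooth_linear bounded_linear_fst)

lemma smooth_snd: "smooth (snd :: 'a::real_normed_vector \<times> 'b::real_normed_vector \<Rightarrow> 'b)"
  by (intro smooth_linear bounded_linear_snd)

lemma smooth_fst_nth: "smooth (\<lambda>p::(real^'n) \<times> real. fst p $ d)"
  by (intro smooth_linear bounded_linear_compose[OF bounded_linear_vec_nth bounded_linear_fst])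

lemmas smooth_intros = smooth_const smooth_add smooth_scaleR smooth_mult smooth_power smooth_uminus smooth_diff
  smooth_fst smooth_snd smooth_fst_nth

text \<open>
  \<open>exp (- 1 / y) / y ^ j\<close>, extended by zero: the family is closed under differentiation up to linear combinations,
  which makes smoothness an induction over all \<open>j\<close> at once.
\<close>
definition flat_exp :: "nat \<Rightarrow> real \<Rightarrow> real" where
  "flat_exp j y = (if y \<le> 0 then 0 else exp (- 1 / y) / y ^ j)"

lemma flat_exp_tendsto_0: "(flat_exp j \<longlongrightarrow> 0) (at 0)"
proof -
  have "((\<lambda>y::real. exp (- 1 / y) / y ^ j) \<longlongrightarrow> 0) (at_right 0)"
  proof -
    have "((\<lambda>u::real. u ^ j / exp u) \<longlongrightarrow> 0) at_top"
      by (rule tendsto_power_div_exp_0)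
    then have "((\<lambda>y::real. inverse y ^ j / exp (inverse y)) \<longlongrightarrow> 0) (at_right 0)"
      by (rule filterlim_compose[OF _ filterlim_inverse_at_top_right])
    moreover have "inverse y ^ j / exp (inverse y) = exp (- 1 / y) / y ^ j" for y :: real
      by (simp add: exp_minus field_class.field_divide_inverse power_inverse mult.commute)
    ultimately show ?thesis by simp
  qed
  then have "(flat_exp j \<longlongrightarrow> 0) (at_right 0)"
    by (rule Lim_transform_eventually) (auto simp: eventually_at_filter flat_exp_def)
  moreover have "(flat_exp j \<longlongrightarrow> 0) (at_left 0)"
    by (rule Lim_transform_eventually[OF tendsto_const]) (auto simp: eventually_at_filter flat_exp_def)
  ultimately show ?thesis by (simp add: filterlim_split_at)
qed

lemma flat_exp_has_real_derivative:
  "(flat_exp j has_real_derivative flat_exp (j + 2) y + (- real j) * flat_exp (j + 1) y) (at y)"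
proof -
  consider "y < 0" | "y = 0" | "y > 0" by linarith
  then show ?thesis
  proof cases
    case 1
    have "((\<lambda>y. 0) has_real_derivative 0) (at y)" by simp
    then have "(flat_exp j has_real_derivative 0) (at y)"
      by (rule has_field_derivative_transform_within_open[where S="{..<0}"]) (use 1 in \<open>auto simp: flat_exp_def\<close>)
    with 1 show ?thesis by (simp add: flat_exp_def)
  next
    case 2
    have "((\<lambda>h. (flat_exp j (0 + h) - flat_exp j 0) / h) \<longlongrightarrow> 0) (at 0)"
      by (rule Lim_transform_eventually[OF flat_exp_tendsto_0[of "j + 1"]])
         (auto simp: eventually_at_filter flat_exp_def)
    then have "(flat_exp j has_real_derivative 0) (at 0)" by (simp add: DERIV_def)
    with 2 show ?thesis by (simp add: flat_exp_def)
  next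
    case 3
    have "((\<lambda>y. exp (- 1 / y) / y ^ j) has_real_derivative
       (exp (- 1 / y) * (1 / y ^ 2) * y ^ j - exp (- 1 / y) * (real j * y ^ (j - 1))) / (y ^ j) ^ 2) (at y)"
      using 3 by (auto intro!: derivative_eq_intros simp: power2_eq_square)
    moreover have "(exp (- 1 / y) * (1 / y ^ 2) * y ^ j - exp (- 1 / y) * (real j * y ^ (j - 1))) / (y ^ j) ^ 2
       = exp (- 1 / y) / y ^ (j + 2) + (- real j) * (exp (- 1 / y) / y ^ (j + 1))"
      using 3 by (cases j) (auto simp: field_simps power2_eq_square)
    ultimately have "((\<lambda>y. exp (- 1 / y) / y ^ j) has_real_derivative
       flat_exp (j + 2) y + (- real j) * flat_exp (j + 1) y) (at y)" using 3 by (simp add: flat_exp_def)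
    then show ?thesis
      by (rule has_field_derivative_transform_within_open[where S="{0<..}"]) (use 3 in \<open>auto simp: flat_exp_def\<close>)
  qed
qed

lemma smooth_flat_exp: "smooth (flat_exp j)"
proof -
  have "Ck k (flat_exp j)" for k
  proof (induction k arbitrary: j)
    case 0
    then show ?case
      by (simp add: DERIV_continuous_on[OF flat_exp_has_real_derivative])
  next
    case (Suc k)
    show ?case
    proof (rule CkI)
      show "(flat_exp j has_derivative (\<lambda>v. (flat_exp (j + 2) y + (- real j) * flat_exp (j + 1) y) * v)) (at y)" for y
        using flat_exp_has_real_derivative[of j y] unfolding has_field_derivative_def .
      show "Ck k (\<lambda>y. (flat_exp (j + 2) y + (- real j) * flat_exp (j + 1) y) * v)" for v
        by (intro Ck_mult Ck_add Ck_const Suc.IH)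
    qed
  qed
  then show ?thesis by (simp add: smooth_def)
qed

text \<open>
  A convex smooth ramp \<open>y * exp (- 1 / y)\<close> and its derivative. Their dilations \<open>sramp (n * y) / n\<close> and
  \<open>sstep (n * y)\<close> converge everywhere to the positive part and to the indicator of \<open>0 < y\<close>, the
  second one boundedly. All test functions below are built from these two.
\<close>
definition sramp :: "real \<Rightarrow> real" where
  "sramp y = y * flat_exp 0 y"

definition sstep :: "real \<Rightarrow> real" where
  "sstep y = flat_exp 0 y + flat_exp 1 y"

lemma sramp_has_real_derivative: "(sramp has_real_derivative sstep y) (at y)"
proof -
  have "(sramp has_real_derivative (1 * flat_exp 0 y + (flat_exp (0 + 2) y + (- real 0) * flat_exp (0 + 1) y) * y)) (at y)"
    unfolding sramp_def by (rule DERIV_mult[OF DERIV_ident flat_exp_has_real_derivative])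
  moreover have "1 * flat_exp 0 y + (flat_exp (0 + 2) y + (- real 0) * flat_exp (0 + 1) y) * y = sstep y"
    by (auto simp: sstep_def flat_exp_def power2_eq_square)
  ultimately show ?thesis by simp
qed

lemma smooth_sramp: "smooth sramp"
  unfolding sramp_def by (intro smooth_mult smooth_flat_exp smooth_linear bounded_linear_ident)

lemma smooth_sstep: "smooth sstep"
  unfolding sstep_def by (intro smooth_add smooth_flat_exp)

lemma sramp_nonpos [simp]: "y \<le> 0 \<Longrightarrow> sramp y = 0"
  by (simp add: sramp_def flat_exp_def)

lemma sstep_nonpos [simp]: "y \<le> 0 \<Longrightarrow> sstep y = 0"
  by (simp add: sstep_def flat_exp_def)

lemma sramp_nonneg: "0 \<le> sramp y"
  by (simp add: sramp_def flat_exp_def)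

lemma sramp_pos: "0 < y \<Longrightarrow> 0 < sramp y"
  by (simp add: sramp_def flat_exp_def)

lemma sstep_nonneg: "0 \<le> sstep y"
  by (simp add: sstep_def flat_exp_def)

lemma sstep_pos: "0 < y \<Longrightarrow> 0 < sstep y"
  by (simp add: sstep_def flat_exp_def add_pos_pos)

lemma sstep_le_1: "sstep y \<le> 1"
proof (cases "y \<le> 0")
  case False
  then have "1 + 1 / y \<le> exp (1 / y)" by (intro exp_ge_add_one_self)
  then have "exp (- 1 / y) * (1 + 1 / y) \<le> exp (- 1 / y) * exp (1 / y)" by (intro mult_left_mono) auto
  also have "\<dots> = 1" by (simp add: mult_exp_exp)
  finally show ?thesis using False by (simp add: sstep_def flat_exp_def algebra_simps)
qed simp

lemma sstep_has_real_derivative: "(sstep has_real_derivative flat_exp 3 y) (at y)"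
proof -
  have "((\<lambda>y. flat_exp 0 y + flat_exp 1 y) has_real_derivative
    (flat_exp (0 + 2) y + (- real 0) * flat_exp (0 + 1) y) + (flat_exp (1 + 2) y + (- real 1) * flat_exp (1 + 1) y)) (at y)"
    by (rule DERIV_add[OF flat_exp_has_real_derivative flat_exp_has_real_derivative])
  then show ?thesis by (simp add: sstep_def[abs_def] numeral_eq_Suc)
qed

lemma sstep_mono: "x \<le> y \<Longrightarrow> sstep x \<le> sstep y"
  by (rule DERIV_nonneg_imp_nondecreasing)
     (auto intro!: sstep_has_real_derivative exI simp: flat_exp_def)

lemma sstep_tendsto_1: "(\<lambda>n. sstep (real n * y)) \<longlonglongrightarrow> (if 0 < y then 1 else 0)"
proof (cases "0 < y")
  case True
  then have "(\<lambda>n. exp (- 1 / (real n * y)) * (1 + 1 / (real n * y))) \<longlonglongrightarrow> 1" by real_asymp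
  then have "(\<lambda>n. sstep (real n * y)) \<longlonglongrightarrow> 1"
    by (rule Lim_transform_eventually)
       (use True in \<open>auto intro!: eventually_sequentiallyI[of 1] simp: sstep_def flat_exp_def algebra_simps mult_le_0_iff\<close>)
  with True show ?thesis by simp
next
  case False
  then show ?thesis by (simp add: mult_nonneg_nonpos)
qed

lemma sramp_tendsto: "(\<lambda>n. sramp (real n * y) / real n) \<longlonglongrightarrow> max 0 y"
proof (cases "0 < y")
  case True
  then have "(\<lambda>n. y * exp (- 1 / (real n * y))) \<longlonglongrightarrow> y" by real_asymp
  then have "(\<lambda>n. sramp (real n * y) / real n) \<longlonglongrightarrow> y"
    by (rule Lim_transform_eventually)
       (use True in \<open>auto intro!: eventually_sequentiallyI[of 1] simp: sramp_def flat_exp_def algebra_simps mult_le_0_iff\<close>)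
  with True show ?thesis by simp
next
  case False
  then show ?thesis by (simp add: mult_nonneg_nonpos)
qed

text \<open>
  Convexity of the ramp. It makes differences of difference quotients admissible as nonnegative test
  functions in the energy inequality.
\<close>
lemma sramp_slope_mono:
  assumes "0 < d1" "d1 \<le> d2"
  shows "(sramp (y + d1) - sramp y) / d1 \<le> (sramp (y + d2) - sramp y) / d2"
proof -
  have cv: "convex_on UNIV sramp"
    by (rule convex_on_realI[of UNIV sramp sstep]) (auto intro: sramp_has_real_derivative sstep_mono)
  show ?thesis
  proof (cases "d1 = d2")
    case False
    then have "(sramp y - sramp (y + d1)) / (y - (y + d1)) \<le> (sramp y - sramp (y + d2)) / (y - (y + d2))"
      using assms by (intro convex_on_slope_le(1)[OF cv]) auto
    then show ?thesis using assms by (simp add: field_simps)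
  qed simp
qed

lemma continuous_on_smooth:
  assumes "smooth f"
  shows "continuous_on S f"
proof -
  have "Ck 0 f" using assms unfolding smooth_def by (rule spec)
  then have "continuous_on UNIV f" by simp
  then show ?thesis by (rule continuous_on_subset) simp
qed

section \<open>The extremal property of the flux\<close>
lemma max_0_power_has_real_derivative:
  "((\<lambda>x::real. max 0 x ^ Suc (Suc k)) has_real_derivative real (Suc (Suc k)) * max 0 x ^ Suc k) (at x)"
proof -
  consider "x < 0" | "x = 0" | "x > 0" by linarith
  then show ?thesis
  proof cases
    case 1
    have "((\<lambda>x::real. 0) has_real_derivative 0) (at x)" by simp
    then have "((\<lambda>x::real. max 0 x ^ Suc (Suc k)) has_real_derivative 0) (at x)"
      by (rule has_field_derivative_transform_within_open[where S="{..<0}"]) (use 1 in \<open>auto simp: max_def\<close>)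
    with 1 show ?thesis by (simp add: max_def)
  next
    case 2
    have "((\<lambda>h::real. max 0 h ^ Suc k) \<longlongrightarrow> max 0 0 ^ Suc k) (at 0)"
      by (intro tendsto_intros)
    then have "((\<lambda>h::real. max 0 h ^ Suc k) \<longlongrightarrow> 0) (at 0)"
      by simp
    then have "((\<lambda>h::real. (max 0 (0 + h) ^ Suc (Suc k) - max 0 0 ^ Suc (Suc k)) / h) \<longlongrightarrow> 0) (at 0)"
      by (rule Lim_transform_eventually) (auto simp: eventually_at_filter max_def)
    then show ?thesis using 2 by (simp add: DERIV_def)
  next
    case 3
    have "((\<lambda>x::real. x ^ Suc (Suc k)) has_real_derivative real (Suc (Suc k)) * x ^ Suc k) (at x)"
      using DERIV_pow[of "Suc (Suc k)" x] by simp
    then have "((\<lambda>x::real. max 0 x ^ Suc (Suc k)) has_real_derivative real (Suc (Suc k)) * x ^ Suc k) (at x)"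
      by (rule has_field_derivative_transform_within_open[where S="{0<..}"]) (use 3 in \<open>auto simp: max_def\<close>)
    with 3 show ?thesis by (simp add: max_def)
  qed
qed

text \<open>
  The weight of the kinetic energy is singular at the pure densities, where the flux vanishes. This
  lemma absorbs the singularity: a bounded factor may be discontinuous at the ends if the other one vanishes there.
\<close>
lemma continuous_on_mult_vanishing_ends:
  fixes f h :: "real \<Rightarrow> real"
  assumes f: "continuous_on {a..b} f" "f a = 0" "f b = 0"
    and h: "continuous_on {a<..<b} h" "\<And>x. x \<in> {a..b} \<Longrightarrow> \<bar>h x\<bar> \<le> C"
  shows "continuous_on {a..b} (\<lambda>x. f x * h x)"
proof (rule continuous_on_eq_continuous_within[THEN iffD2, rule_format])
  fix x assume x: "x \<in> {a..b}"
  show "continuous (at x within {a..b}) (\<lambda>x. f x * h x)"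
  proof (cases "x \<in> {a<..<b}")
    case True
    then have "isCont h x"
      using continuous_on_eq_continuous_at[OF open_greaterThanLessThan, THEN iffD1, OF h(1)] by blast
    moreover have "continuous (at x within {a..b}) f"
      using continuous_on_eq_continuous_within[THEN iffD1, OF f(1)] x by blast
    ultimately show ?thesis
      using continuous_at_imp_continuous_at_within continuous_mult by blast
  next
    case False
    with x have "x = a \<or> x = b" by auto
    then have fx: "f x = 0" using f(2,3) by auto
    have "(f \<longlongrightarrow> 0) (at x within {a..b})"
      using f(1)[unfolded continuous_on_def, rule_format, OF x] fx by simp
    then have 1: "((\<lambda>y. C * \<bar>f y\<bar>) \<longlongrightarrow> 0) (at x within {a..b})"
      by (intro tendsto_mult_right_zero tendsto_rabs_zero)
    have "((\<lambda>y. f y * h y) \<longlongrightarrow> 0) (at x within {a..b})"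
    proof (rule Lim_null_comparison[OF _ 1])
      show "\<forall>\<^sub>F y in at x within {a..b}. norm (f y * h y) \<le> C * \<bar>f y\<bar>"
        unfolding eventually_at_filter
        by (intro always_eventually) (use h(2) in \<open>auto simp: abs_mult mult.commute[of _ "\<bar>f _\<bar>"] intro!: mult_left_mono\<close>)
    qed
    then show ?thesis by (simp add: continuous_within fx)
  qed
qed

locale densities =
  fixes \<rho>m \<rho>p :: real
  assumes rho: "0 < \<rho>m" "\<rho>m < \<rho>p"
begin

text \<open>
  With momentum \<open>c * (r + F r)\<close> and velocity \<open>c\<close> the mixture carries the energy
  \<open>c\<^sup>2 / 2 * weight r * (F r)\<^sup>2\<close>, once potential energy is measured with the height in the moving frame. At the pure densities the value is \<open>0\<close>
  by the convention on division, which is also the value needed for \<open>weight r * (F r)\<^sup>2\<close>.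
\<close>
definition weight :: "real \<Rightarrow> real" where
  "weight r = (\<rho>p + \<rho>m - r) / ((\<rho>p - r) * (r - \<rho>m))"

text \<open>The reciprocal of the weight, up to the factor \<open>- 1 / 3\<close> the extremal flux, and its first two derivatives.\<close>
definition inv_weight :: "real \<Rightarrow> real" where
  "inv_weight r = (\<rho>p - r) * (r - \<rho>m) / (\<rho>p + \<rho>m - r)"

definition inv_weight1 :: "real \<Rightarrow> real" where
  "inv_weight1 r = 1 - \<rho>p * \<rho>m / (\<rho>p + \<rho>m - r)^2"

definition inv_weight2 :: "real \<Rightarrow> real" where
  "inv_weight2 r = - 2 * \<rho>p * \<rho>m / (\<rho>p + \<rho>m - r)^3"

lemma inv_weight_alt: "r \<in> {\<rho>m..\<rho>p} \<Longrightarrow> inv_weight r = r - \<rho>p * \<rho>m / (\<rho>p + \<rho>m - r)"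
  using rho unfolding inv_weight_def by (simp add: field_simps)

lemma inv_weight_deriv:
  assumes "r \<in> {\<rho>m..\<rho>p}"
  shows "(inv_weight has_real_derivative inv_weight1 r) (at r within {\<rho>m..\<rho>p})"
proof -
  have "((\<lambda>r. r - \<rho>p * \<rho>m / (\<rho>p + \<rho>m - r)) has_real_derivative inv_weight1 r) (at r within {\<rho>m..\<rho>p})"
    unfolding inv_weight1_def using rho assms
    by (auto intro!: derivative_eq_intros simp: power2_eq_square)
  then show ?thesis
    by (rule has_field_derivative_transform_within[where d=1]) (use assms inv_weight_alt in auto)
qed

lemma inv_weight1_deriv:
  assumes "r \<in> {\<rho>m..\<rho>p}"
  shows "(inv_weight1 has_real_derivative inv_weight2 r) (at r within {\<rho>m..\<rho>p})"
proof -
  have s: "\<rho>p + \<rho>m - r \<noteq> 0" using rho assms by auto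
  have e: "2 * y / (y^2 * y^2) = 2 / y^3" if "y \<noteq> 0" for y :: real
    using that by (simp add: field_simps power2_eq_square power3_eq_cube)
  have "((\<lambda>r. 1 - \<rho>p * \<rho>m / (\<rho>p + \<rho>m - r)^2) has_real_derivative
      - (\<rho>p * \<rho>m * (2 * (\<rho>p + \<rho>m - r) / ((\<rho>p + \<rho>m - r)^2 * (\<rho>p + \<rho>m - r)^2)))) (at r within {\<rho>m..\<rho>p})"
    using s by (auto intro!: derivative_eq_intros simp: minus_divide_left simp flip: mult_minus_right right_diff_distrib)
  then show ?thesis unfolding inv_weight1_def[abs_def] inv_weight2_def e[OF s] by (simp add: mult_ac)
qed

lemma inv_weight2_neg: "r \<in> {\<rho>m..\<rho>p} \<Longrightarrow> inv_weight2 r < 0"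
  using rho unfolding inv_weight2_def by (auto intro!: divide_neg_pos simp: mult_neg_pos)

lemma inv_weight2_cont: "continuous_on {\<rho>m..\<rho>p} inv_weight2"
  unfolding inv_weight2_def using rho by (auto intro!: continuous_intros)

lemma inv_weight_ends [simp]: "inv_weight \<rho>m = 0" "inv_weight \<rho>p = 0"
  by (auto simp: inv_weight_def)

lemma inv_weight_pos: "r \<in> {\<rho>m<..<\<rho>p} \<Longrightarrow> 0 < inv_weight r"
  using rho by (auto simp: inv_weight_def)

lemma weight_eq_inverse: "r \<in> {\<rho>m<..<\<rho>p} \<Longrightarrow> weight r = 1 / inv_weight r"
  using rho by (auto simp: inv_weight_def weight_def)

lemma inv_weight_cont: "continuous_on {\<rho>m..\<rho>p} inv_weight" and inv_weight1_cont: "continuous_on {\<rho>m..\<rho>p} inv_weight1"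
  by (auto intro!: DERIV_continuous_on inv_weight_deriv inv_weight1_deriv)

end

text \<open>
  Derivatives are relative to the closed interval, in agreement with \<^const>\<open>deriv_on\<close>; carrying
  them as parameters allows explicit formulas for the extremal flux.
\<close>
locale convex_flux = densities +
  fixes F F1 F2 :: "real \<Rightarrow> real"
  assumes F1: "\<And>r. r \<in> {\<rho>m..\<rho>p} \<Longrightarrow> (F has_real_derivative F1 r) (at r within {\<rho>m..\<rho>p})"
    and F2: "\<And>r. r \<in> {\<rho>m..\<rho>p} \<Longrightarrow> (F1 has_real_derivative F2 r) (at r within {\<rho>m..\<rho>p})"
    and F2_cont: "continuous_on {\<rho>m..\<rho>p} F2"
    and F2_pos: "\<And>r. r \<in> {\<rho>m..\<rho>p} \<Longrightarrow> 0 < F2 r"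
    and F_ends [simp]: "F \<rho>m = 0" "F \<rho>p = 0"
begin

lemma F_cont: "continuous_on {\<rho>m..\<rho>p} F" and F1_cont: "continuous_on {\<rho>m..\<rho>p} F1"
  by (auto intro!: DERIV_continuous_on F1 F2)

lemma F1_bound: obtains C where "0 < C" "\<And>r. r \<in> {\<rho>m..\<rho>p} \<Longrightarrow> \<bar>F1 r\<bar> \<le> C"
proof -
  have "bounded (F1 ` {\<rho>m..\<rho>p})"
    by (intro compact_imp_bounded compact_continuous_image F1_cont) auto
  then obtain C where "0 < C" "\<forall>y\<in>F1 ` {\<rho>m..\<rho>p}. norm y \<le> C" unfolding bounded_pos by blast
  then show ?thesis by (intro that[of C]) auto
qed

text \<open>
  Near each end \<open>F\<close> vanishes linearly and so does the inverse weight; the half of the interval containing \<open>r\<close>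
  decides which of the two Lipschitz bounds for \<open>F\<close> is used.
\<close>
lemma weight_F_bound: obtains K where "\<And>r. r \<in> {\<rho>m..\<rho>p} \<Longrightarrow> \<bar>weight r * F r\<bar> \<le> K"
proof -
  obtain C where C: "0 < C" "\<And>r. r \<in> {\<rho>m..\<rho>p} \<Longrightarrow> \<bar>F1 r\<bar> \<le> C" using F1_bound by blast
  have lip: "\<bar>F r - F r'\<bar> \<le> C * \<bar>r - r'\<bar>" if "r \<in> {\<rho>m..\<rho>p}" "r' \<in> {\<rho>m..\<rho>p}" for r r'
    using field_differentiable_bound[of "{\<rho>m..\<rho>p}" F F1 C r' r] F1 C that by (auto simp: abs_minus_commute)
  define D where "D = (\<rho>p - \<rho>m) / 2"
  have D: "0 < D" using rho by (simp add: D_def)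
  have "\<bar>weight r * F r\<bar> \<le> \<rho>p * C / D" if r: "r \<in> {\<rho>m..\<rho>p}" for r
  proof (cases "r \<in> {\<rho>m<..<\<rho>p}")
    case False
    with r have "F r = 0" using F_ends by (metis atLeastAtMost_iff greaterThanLessThan_iff less_eq_real_def)
    then show ?thesis using C D rho by simp
  next
    case True
    have l: "\<bar>F r\<bar> \<le> C * (r - \<rho>m)" "\<bar>F r\<bar> \<le> C * (\<rho>p - r)"
      using lip[of r \<rho>m] lip[of r \<rho>p] r rho by auto
    have "D * \<bar>F r\<bar> \<le> C * ((\<rho>p - r) * (r - \<rho>m))"
    proof (cases "r \<le> (\<rho>m + \<rho>p) / 2")
      case True
      then have "D \<le> \<rho>p - r" by (simp add: D_def field_simps)
      then have "D * \<bar>F r\<bar> \<le> (\<rho>p - r) * (C * (r - \<rho>m))" using l(1) D r by (intro mult_mono) auto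
      then show ?thesis by (simp add: algebra_simps)
    next
      case False
      then have "D \<le> r - \<rho>m" by (simp add: D_def field_simps)
      then have "D * \<bar>F r\<bar> \<le> (r - \<rho>m) * (C * (\<rho>p - r))" using l(2) D r by (intro mult_mono) auto
      then show ?thesis by (simp add: algebra_simps)
    qed
    moreover have P: "0 < (\<rho>p - r) * (r - \<rho>m)" using True by auto
    ultimately have "\<bar>F r\<bar> / ((\<rho>p - r) * (r - \<rho>m)) \<le> C / D" using D by (simp add: field_simps)
    moreover have "\<bar>\<rho>p + \<rho>m - r\<bar> \<le> \<rho>p" using r rho by auto
    ultimately have "\<bar>\<rho>p + \<rho>m - r\<bar> * (\<bar>F r\<bar> / ((\<rho>p - r) * (r - \<rho>m))) \<le> \<rho>p * (C / D)"
      using P rho by (intro mult_mono) auto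
    then show ?thesis using P abs_of_pos[OF P] by (simp add: weight_def abs_mult)
  qed
  then show ?thesis using that by blast
qed

lemma weight_cont: "continuous_on {\<rho>m<..<\<rho>p} weight"
  unfolding weight_def by (auto intro!: continuous_intros)

lemma weight_F_sq_cont: "continuous_on {\<rho>m..\<rho>p} (\<lambda>r. weight r * (F r)^2)"
proof -
  obtain K where K: "\<And>r. r \<in> {\<rho>m..\<rho>p} \<Longrightarrow> \<bar>weight r * F r\<bar> \<le> K" using weight_F_bound by blast
  have "continuous_on {\<rho>m..\<rho>p} (\<lambda>r. F r * (weight r * F r))"
    by (rule continuous_on_mult_vanishing_ends[OF F_cont _ _ _ K])
       (auto intro!: continuous_intros weight_cont continuous_on_subset[OF F_cont])
  then show ?thesis by (simp add: power2_eq_square mult_ac)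
qed

text \<open>
  The functional \<open>J F\<close>: the energy of the rarefaction fan of \<open>F\<close> at time \<open>t\<close> differs from the initial
  energy by \<open>g\<^sup>3 t\<^sup>4 / 8\<close> times this number. The first integral is the kinetic part, the second
  one the gain of potential energy.
\<close>
definition energy_coeff :: real where
  "energy_coeff = 2 * integral {\<rho>m..\<rho>p} (\<lambda>r. weight r * (F r)^2 * F2 r) - integral {\<rho>m..\<rho>p} (\<lambda>r. (F1 r)^2)"

lemma energy_coeff_integrable:
  "(\<lambda>r. weight r * (F r)^2 * F2 r) integrable_on {\<rho>m..\<rho>p}"
  "(\<lambda>r. (F1 r)^2) integrable_on {\<rho>m..\<rho>p}"
  "(\<lambda>r. F r * F2 r) integrable_on {\<rho>m..\<rho>p}"
  by (auto intro!: integrable_continuous_interval continuous_intros weight_F_sq_cont F1_cont F2_cont F_cont)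

lemma F_deriv_at: "r \<in> {\<rho>m<..<\<rho>p} \<Longrightarrow> (F has_real_derivative F1 r) (at r)"
  using F1[of r] at_within_Icc_at[of \<rho>m r \<rho>p] by auto

lemma F1_deriv_at: "r \<in> {\<rho>m<..<\<rho>p} \<Longrightarrow> (F1 has_real_derivative F2 r) (at r)"
  using F2[of r] at_within_Icc_at[of \<rho>m r \<rho>p] by auto

text \<open>The function \<open>F * F1\<close> vanishes at both ends.\<close>
lemma energy_coeff_by_parts: "energy_coeff = integral {\<rho>m..\<rho>p} (\<lambda>r. F2 r * (2 * weight r * (F r)^2 + F r))"
proof -
  have "((\<lambda>r. F1 r * F1 r + F2 r * F r) has_integral (F \<rho>p * F1 \<rho>p - F \<rho>m * F1 \<rho>m)) {\<rho>m..\<rho>p}"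
    using rho DERIV_mult[OF F1 F2]
    by (intro fundamental_theorem_of_calculus) (auto simp: has_real_derivative_iff_has_vector_derivative)
  then have "((\<lambda>r. (F1 r)^2 + F r * F2 r) has_integral 0) {\<rho>m..\<rho>p}"
    by (simp add: power2_eq_square mult.commute)
  then have "integral {\<rho>m..\<rho>p} (\<lambda>r. (F1 r)^2 + F r * F2 r) = 0" by (rule integral_unique)
  then have 1: "- integral {\<rho>m..\<rho>p} (\<lambda>r. (F1 r)^2) = integral {\<rho>m..\<rho>p} (\<lambda>r. F r * F2 r)"
    by (subst (asm) integral_add) (use energy_coeff_integrable in auto)
  have "integral {\<rho>m..\<rho>p} (\<lambda>r. F2 r * (2 * weight r * (F r)^2 + F r))
      = integral {\<rho>m..\<rho>p} (\<lambda>r. 2 * (weight r * (F r)^2 * F2 r) + F r * F2 r)"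
    by (simp add: algebra_simps)
  also have "\<dots> = 2 * integral {\<rho>m..\<rho>p} (\<lambda>r. weight r * (F r)^2 * F2 r) + integral {\<rho>m..\<rho>p} (\<lambda>r. F r * F2 r)"
    by (subst integral_add) (use energy_coeff_integrable in auto)
  finally show ?thesis using 1 by (simp add: energy_coeff_def)
qed

text \<open>
  The algebraic core, for fixed \<open>r\<close>: \<open>b\<close> is the inverse weight, \<open>b2\<close> and \<open>f2\<close> stand for \<open>b''\<close> and \<open>F''\<close>,
  \<open>F = - b * u\<close> and \<open>D = F' b - F b'\<close>; \<open>k\<close> is \<open>(1 - 2 u) u\<close> for \<open>u \<ge> 1 / 4\<close>, continued by its maximum \<open>1 / 8\<close>.
  Where \<open>u \<ge> 1 / 4\<close> the terms with \<open>f2\<close> cancel; where \<open>u \<le> 1 / 4\<close> they combine to \<open>2 b f2 (u - 1 / 4)\<^sup>2\<close>.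
  The square of \<open>D\<close> is dropped. The remaining factor \<open>k * u\<close> has its maximum \<open>1 / 27\<close> at \<open>u = 1 / 3\<close>, and \<open>b * b2 \<le> 0\<close>.
\<close>
lemma calibration_pointwise:
  fixes u b b2 f2 D :: real
  assumes "0 < b" "b2 \<le> 0" "0 \<le> f2"
  defines "k \<equiv> 1 / 8 - 2 * (max 0 (u - 1 / 4))^2"
  shows "b * b2 / 27 \<le> f2 * b * (2 * u^2 - u) + 4 * max 0 (u - 1 / 4) * D^2 / b^2 + k * (f2 * b + b * u * b2)"
proof -
  have a: "0 \<le> 2 * u^2 - u + k"
  proof -
    have "2 * u^2 - u + k = 2 * ((u - 1 / 4)^2 - (max 0 (u - 1 / 4))^2)"
      by (simp add: k_def power2_eq_square algebra_simps)
    moreover have "(max 0 (u - 1 / 4))^2 \<le> (u - 1 / 4)^2" by (auto simp: max_def)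
    ultimately show ?thesis by simp
  qed
  have b: "k * u \<le> 1 / 27"
  proof (cases "u \<le> 1 / 4")
    case True
    then have "max 0 (u - 1 / 4) = 0" by simp
    then show ?thesis using True by (simp add: k_def)
  next
    case False
    then have "k * u = u^2 - 2 * u^3"
      by (simp add: k_def max_def power2_eq_square power3_eq_cube algebra_simps)
    moreover have "0 \<le> (u - 1 / 3)^2 * (2 * u + 1 / 3)" using False by (intro mult_nonneg_nonneg) auto
    moreover have "(u - 1 / 3)^2 * (2 * u + 1 / 3) = 2 * u^3 - u^2 + 1 / 27"
      by (simp add: power2_eq_square power3_eq_cube algebra_simps)
    ultimately show ?thesis by simp
  qed
  have "b * b2 / 27 \<le> k * u * (b * b2)"
    using mult_right_mono_neg[OF b, of "b * b2"] assms by (simp add: mult_nonneg_nonpos)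
  moreover have "0 \<le> f2 * b * (2 * u^2 - u + k)" using assms a by (intro mult_nonneg_nonneg) auto
  moreover have "0 \<le> 4 * max 0 (u - 1 / 4) * D^2 / b^2" by simp
  moreover have "f2 * b * (2 * u^2 - u) + k * (f2 * b + b * u * b2) = f2 * b * (2 * u^2 - u + k) + k * u * (b * b2)"
    by (simp add: algebra_simps)
  ultimately show ?thesis by linarith
qed

text \<open>
  Subtracting the exact derivative of \<open>S = k * b\<^sup>2 * u' = - k * D\<close> leaves the integral unchanged, because \<open>D\<close>
  vanishes at the ends and \<open>k\<close> is bounded; afterwards the comparison is pointwise. The function \<open>k\<close> of \<open>u\<close> is
  continuously differentiable, so \<open>S\<close> is differentiable also where \<open>u\<close> crosses \<open>1 / 4\<close>.
\<close>
lemma energy_coeff_lower_bound: "integral {\<rho>m..\<rho>p} (\<lambda>r. inv_weight r * inv_weight2 r / 27) \<le> energy_coeff"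
proof -
  define u where "u r = - (weight r * F r)" for r
  define k where "k r = 1 / 8 - 2 * (max 0 (u r - 1 / 4))^2" for r
  define D where "D r = F1 r * inv_weight r - F r * inv_weight1 r" for r
  define S where "S r = - (D r) * k r" for r
  define S' where "S' r = 4 * - max 0 (u r - 1 / 4) * (D r)^2 / (inv_weight r)^2 - k r * (F2 r * inv_weight r - F r * inv_weight2 r)" for r
  obtain K where K: "\<And>r. r \<in> {\<rho>m..\<rho>p} \<Longrightarrow> \<bar>weight r * F r\<bar> \<le> K" using weight_F_bound by blast
  have "continuous_on {\<rho>m..\<rho>p} S"
    unfolding S_def
  proof (rule continuous_on_mult_vanishing_ends)
    show "continuous_on {\<rho>m..\<rho>p} (\<lambda>r. - D r)"
      unfolding D_def by (intro continuous_intros F_cont F1_cont inv_weight_cont inv_weight1_cont)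
    show "continuous_on {\<rho>m<..<\<rho>p} k"
      unfolding k_def u_def by (intro continuous_intros weight_cont continuous_on_subset[OF F_cont]) auto
    show "\<bar>k r\<bar> \<le> 1 / 8 + 2 * (K + 1)^2" if "r \<in> {\<rho>m..\<rho>p}" for r
    proof -
      have "max 0 (u r - 1 / 4) \<le> K + 1" "0 \<le> K"
        using K[OF that] by (auto simp: u_def)
      then have "(max 0 (u r - 1 / 4))^2 \<le> (K + 1)^2" by (intro power_mono) auto
      then show ?thesis unfolding k_def by (simp add: abs_if)
    qed
  qed (auto simp: D_def)
  moreover have "(S has_real_derivative S' r) (at r)" if r: "r \<in> {\<rho>m<..<\<rho>p}" for r
  proof -
    have b: "0 < inv_weight r" using inv_weight_pos r .
    have mb: "(inv_weight has_real_derivative inv_weight1 r) (at r)" "(inv_weight1 has_real_derivative inv_weight2 r) (at r)"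
      using inv_weight_deriv[of r] inv_weight1_deriv[of r] at_within_Icc_at[of \<rho>m r \<rho>p] r by auto
    have "((\<lambda>r. - (F r / inv_weight r)) has_real_derivative - (D r / (inv_weight r)^2)) (at r)"
      using b F_deriv_at[OF r] mb
      by (auto intro!: derivative_eq_intros simp: D_def power2_eq_square)
    then have u': "(u has_real_derivative - (D r / (inv_weight r)^2)) (at r)"
      by (rule has_field_derivative_transform_within_open[where S="{\<rho>m<..<\<rho>p}"]) (use r weight_eq_inverse in \<open>auto simp: u_def\<close>)
    have m': "((\<lambda>x::real. max 0 x ^ 2) has_real_derivative 2 * max 0 x) (at x)" for x
      using max_0_power_has_real_derivative[of 0 x] by (simp add: numeral_2_eq_2)
    have k': "(k has_real_derivative 4 * max 0 (u r - 1 / 4) * (D r / (inv_weight r)^2)) (at r)"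
      unfolding k_def
      by (rule derivative_eq_intros DERIV_chain2[OF m'] u' refl)+ simp
    have D': "(D has_real_derivative (F2 r * inv_weight r - F r * inv_weight2 r)) (at r)"
      unfolding D_def using F_deriv_at[OF r] F1_deriv_at[OF r] mb
      by (auto intro!: derivative_eq_intros)
    show ?thesis
      unfolding S_def[abs_def]
      by (rule derivative_eq_intros k' D' refl)+ (simp add: S'_def power2_eq_square algebra_simps)
  qed
  ultimately have "(S' has_integral (S \<rho>p - S \<rho>m)) {\<rho>m..\<rho>p}"
    using rho by (intro fundamental_theorem_of_calculus_interior) (auto simp: has_real_derivative_iff_has_vector_derivative)
  then have S': "(S' has_integral 0) {\<rho>m..\<rho>p}"
    by (simp add: S_def D_def)
  have "((\<lambda>r. F2 r * (2 * weight r * (F r)^2 + F r)) has_integral energy_coeff) {\<rho>m..\<rho>p}"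
  proof -
    have "continuous_on {\<rho>m..\<rho>p} (\<lambda>r. F2 r * (2 * (weight r * (F r)^2) + F r))"
      by (intro continuous_intros F2_cont weight_F_sq_cont F_cont)
    then show ?thesis unfolding energy_coeff_by_parts by (intro integrable_integral integrable_continuous_interval) (simp add: mult.assoc)
  qed
  from has_integral_diff[OF this S']
  have 1: "((\<lambda>r. F2 r * (2 * weight r * (F r)^2 + F r) - S' r) has_integral energy_coeff) {\<rho>m<..<\<rho>p}"
    by (simp add: has_integral_Icc_iff_Ioo)
  have "((\<lambda>r. inv_weight r * inv_weight2 r / 27) has_integral (integral {\<rho>m..\<rho>p} (\<lambda>r. inv_weight r * inv_weight2 r / 27))) {\<rho>m..\<rho>p}"
    by (intro integrable_integral integrable_continuous_interval continuous_intros inv_weight_cont inv_weight2_cont) auto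
  then have 2: "((\<lambda>r. inv_weight r * inv_weight2 r / 27) has_integral (integral {\<rho>m..\<rho>p} (\<lambda>r. inv_weight r * inv_weight2 r / 27))) {\<rho>m<..<\<rho>p}"
    by (simp add: has_integral_Icc_iff_Ioo)
  show ?thesis
  proof (rule has_integral_le[OF 2 1])
    fix r assume r: "r \<in> {\<rho>m<..<\<rho>p}"
    have b: "0 < inv_weight r" using inv_weight_pos r .
    have F: "F r = - (inv_weight r * u r)" using b weight_eq_inverse[OF r] by (simp add: u_def)
    have m: "weight r * (F r)^2 = inv_weight r * (u r)^2"
      using b unfolding F weight_eq_inverse[OF r] by (simp add: power2_eq_square)
    have "inv_weight r * inv_weight2 r / 27 \<le> F2 r * inv_weight r * (2 * (u r)^2 - u r)
        + 4 * max 0 (u r - 1 / 4) * (D r)^2 / (inv_weight r)^2 + k r * (F2 r * inv_weight r + inv_weight r * u r * inv_weight2 r)"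
      unfolding k_def using calibration_pointwise[of "inv_weight r" "inv_weight2 r" "F2 r" "u r" "D r"] b inv_weight2_neg[of r] F2_pos[of r] r
      by auto
    also have "\<dots> = F2 r * (2 * (weight r * (F r)^2) + F r) - S' r"
      unfolding m S'_def by (simp add: F algebra_simps)
    finally show "inv_weight r * inv_weight2 r / 27 \<le> F2 r * (2 * weight r * (F r)^2 + F r) - S' r"
      by (simp add: mult.assoc)
  qed
qed

end

context densities begin

lemma F_third_eq_inv_weight: "F_third \<rho>m \<rho>p = (\<lambda>r. - (1 / 3) * inv_weight r)"
  by (auto simp: F_third_def inv_weight_def)

lemma convex_flux_F_third: "convex_flux \<rho>m \<rho>p (F_third \<rho>m \<rho>p) (\<lambda>r. - (1 / 3) * inv_weight1 r) (\<lambda>r. - (1 / 3) * inv_weight2 r)"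
proof
  show "(F_third \<rho>m \<rho>p has_real_derivative - (1 / 3) * inv_weight1 r) (at r within {\<rho>m..\<rho>p})" if "r \<in> {\<rho>m..\<rho>p}" for r
    unfolding F_third_eq_inv_weight by (intro DERIV_cmult inv_weight_deriv that)
  show "((\<lambda>r. - (1 / 3) * inv_weight1 r) has_real_derivative - (1 / 3) * inv_weight2 r) (at r within {\<rho>m..\<rho>p})" if "r \<in> {\<rho>m..\<rho>p}" for r
    by (intro DERIV_cmult inv_weight1_deriv that)
  show "continuous_on {\<rho>m..\<rho>p} (\<lambda>r. - (1 / 3) * inv_weight2 r)"
    by (intro continuous_intros inv_weight2_cont)
qed (use inv_weight2_neg in \<open>auto simp: F_third_eq_inv_weight\<close>)

lemma energy_coeff_F_third:
  "convex_flux.energy_coeff \<rho>m \<rho>p (F_third \<rho>m \<rho>p) (\<lambda>r. - (1 / 3) * inv_weight1 r) (\<lambda>r. - (1 / 3) * inv_weight2 r)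
     = integral {\<rho>m..\<rho>p} (\<lambda>r. inv_weight r * inv_weight2 r / 27)"
proof -
  interpret T: convex_flux \<rho>m \<rho>p "F_third \<rho>m \<rho>p" "\<lambda>r. - (1 / 3) * inv_weight1 r" "\<lambda>r. - (1 / 3) * inv_weight2 r"
    by (rule convex_flux_F_third)
  have "- (1 / 3) * inv_weight2 r * (2 * weight r * (F_third \<rho>m \<rho>p r)\<^sup>2 + F_third \<rho>m \<rho>p r) = inv_weight r * inv_weight2 r / 27"
    if "r \<in> {\<rho>m..\<rho>p}" for r
  proof (cases "r \<in> {\<rho>m<..<\<rho>p}")
    case True
    then show ?thesis using inv_weight_pos[OF True] weight_eq_inverse[OF True]
      by (simp add: F_third_eq_inv_weight power2_eq_square field_simps)
  next
    case False
    with that have "inv_weight r = 0"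
      by (metis atLeastAtMost_iff greaterThanLessThan_iff less_eq_real_def inv_weight_ends)
    then show ?thesis by (simp add: F_third_eq_inv_weight)
  qed
  then show ?thesis unfolding T.energy_coeff_by_parts by (intro integral_cong)
qed

end

lemma (in convex_flux) energy_coeff_F_third_le:
  "convex_flux.energy_coeff \<rho>m \<rho>p (F_third \<rho>m \<rho>p) (\<lambda>r. - (1 / 3) * inv_weight1 r) (\<lambda>r. - (1 / 3) * inv_weight2 r) \<le> energy_coeff"
  using energy_coeff_lower_bound energy_coeff_F_third by simp

section \<open>Entropy solutions are rarefaction fans\<close>
lemma deriv_on_eq:
  assumes "a < b" "r \<in> {a..b}" "(f has_real_derivative D) (at r within {a..b})"
  shows "deriv_on a b f r = D"
  unfolding deriv_on_def
  using assms vector_derivative_within_cbox[of a b r f D]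
  by (simp add: has_real_derivative_iff_has_vector_derivative)

lemma deriv_on_works:
  assumes "a < b" "r \<in> {a..b}" "f differentiable_on {a..b}"
  shows "(f has_real_derivative deriv_on a b f r) (at r within {a..b})"
proof -
  obtain D where "(f has_real_derivative D) (at r within {a..b})"
    using assms unfolding differentiable_on_def real_differentiable_def by blast
  then show ?thesis using deriv_on_eq[OF assms(1,2)] by simp
qed

lemma C2_onI:
  assumes "a < b" "\<And>r. r \<in> {a..b} \<Longrightarrow> (f has_real_derivative f1 r) (at r within {a..b})"
    "\<And>r. r \<in> {a..b} \<Longrightarrow> (f1 has_real_derivative f2 r) (at r within {a..b})"
    "continuous_on {a..b} f2"
  shows "C2_on a b f"
proof -
  have 1: "deriv_on a b f r = f1 r" if "r \<in> {a..b}" for r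
    using deriv_on_eq assms that by blast
  have d: "(deriv_on a b f has_real_derivative f2 r) (at r within {a..b})" if "r \<in> {a..b}" for r
    by (rule has_field_derivative_transform_within[OF assms(3)[OF that] zero_less_one that]) (simp add: 1)
  have 2: "deriv_on a b (deriv_on a b f) r = f2 r" if "r \<in> {a..b}" for r
    using deriv_on_eq assms(1) d that by blast
  have "continuous_on {a..b} (deriv_on a b (deriv_on a b f))"
    by (subst continuous_on_cong[OF refl 2]) (use assms in auto)
  moreover have "f differentiable_on {a..b}" "deriv_on a b f differentiable_on {a..b}"
    unfolding differentiable_on_def real_differentiable_def using assms(2) d by blast+
  ultimately show ?thesis by (simp add: C2_on_def)
qed

lemma convex_flux_deriv_on:
  assumes "0 < \<rho>m" "\<rho>m < \<rho>p" "uniformly_convex_C2 \<rho>m \<rho>p F" "F \<rho>m = 0" "F \<rho>p = 0"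
  shows "convex_flux \<rho>m \<rho>p F (deriv_on \<rho>m \<rho>p F) (deriv_on \<rho>m \<rho>p (deriv_on \<rho>m \<rho>p F))"
proof
  show "(F has_real_derivative deriv_on \<rho>m \<rho>p F r) (at r within {\<rho>m..\<rho>p})" if "r \<in> {\<rho>m..\<rho>p}" for r
    using assms that by (intro deriv_on_works) (auto simp: uniformly_convex_C2_def C2_on_def)
  show "(deriv_on \<rho>m \<rho>p F has_real_derivative deriv_on \<rho>m \<rho>p (deriv_on \<rho>m \<rho>p F) r) (at r within {\<rho>m..\<rho>p})" if "r \<in> {\<rho>m..\<rho>p}" for r
    using assms that by (intro deriv_on_works) (auto simp: uniformly_convex_C2_def C2_on_def)
  show "0 < deriv_on \<rho>m \<rho>p (deriv_on \<rho>m \<rho>p F) r" if "r \<in> {\<rho>m..\<rho>p}" for r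
    using assms that unfolding uniformly_convex_C2_def by (meson less_le_trans)
qed (use assms in \<open>auto simp: uniformly_convex_C2_def C2_on_def\<close>)

lemma continuous_on_sramp [continuous_intros]: "continuous_on S f \<Longrightarrow> continuous_on S (\<lambda>x. sramp (f x))"
  by (rule continuous_on_compose2[OF continuous_on_smooth[OF smooth_sramp, of UNIV]]) auto

lemma continuous_on_sstep [continuous_intros]: "continuous_on S f \<Longrightarrow> continuous_on S (\<lambda>x. sstep (f x))"
  by (rule continuous_on_compose2[OF continuous_on_smooth[OF smooth_sstep, of UNIV]]) auto

lemma sramp_has_derivative [derivative_intros]:
  "(f has_derivative f') (at x within S) \<Longrightarrow> ((\<lambda>x. sramp (f x)) has_derivative (\<lambda>h. f' h * sstep (f x))) (at x within S)"
  using has_derivative_compose[of f f' x S sramp "\<lambda>h. h * sstep (f x)"] sramp_has_real_derivative[of "f x"]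
  by (simp add: has_field_derivative_def mult_commute_abs)

lemma entropy_solution_range:
  assumes "entropy_solution g T \<rho>m \<rho>p F \<rho>" "t \<in> {0<..<T}"
  shows "\<rho> (x, t) \<in> {\<rho>m..\<rho>p}"
proof -
  have "\<forall>x. \<forall>t\<in>{0<..<T}. \<rho> (x, t) \<in> {\<rho>m..\<rho>p}"
    using assms(1) unfolding entropy_solution_def by (elim conjE)
  then show ?thesis using assms(2) by blast
qed

lemma entropy_solution_ineq:
  assumes sol: "entropy_solution g T \<rho>m \<rho>p F \<rho>"
    and "C2_on \<rho>m \<rho>p \<eta>" "convex_on {\<rho>m..\<rho>p} \<eta>"
    and "\<And>r. r \<in> {\<rho>m..\<rho>p} \<Longrightarrow>
      (Q has_real_derivative deriv_on \<rho>m \<rho>p \<eta> r * deriv_on \<rho>m \<rho>p F r) (at r within {\<rho>m..\<rho>p})"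
    and "line_test_fun T \<phi>" "\<And>p. 0 \<le> \<phi> p"
  shows "0 \<le> (LINT (x, t):UNIV \<times> {0<..<T}|lborel.
               \<eta> (\<rho> (x, t)) * frechet_derivative \<phi> (at (x, t)) (0, 1)
               + g * t * Q (\<rho> (x, t)) * frechet_derivative \<phi> (at (x, t)) (1, 0))
             + (LINT x|lborel. \<eta> (rho0 \<rho>m \<rho>p x) * \<phi> (x, 0))"
proof -
  have "C2_on \<rho>m \<rho>p \<eta> \<and> convex_on {\<rho>m..\<rho>p} \<eta> \<and>
        (\<forall>r\<in>{\<rho>m..\<rho>p}.
           (Q has_real_derivative deriv_on \<rho>m \<rho>p \<eta> r * deriv_on \<rho>m \<rho>p F r)
             (at r within {\<rho>m..\<rho>p})) \<and>
        line_test_fun T \<phi> \<and> (\<forall>x. \<forall>t\<in>{0..<T}. 0 \<le> \<phi> (x, t))"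
    using assms(2-) by blast
  then show ?thesis
    by (rule conjunct2[OF conjunct2[OF sol[unfolded entropy_solution_def]], THEN spec, THEN spec, THEN spec, THEN mp])
qed

text \<open>
  The test function is a product of three ramps, positive exactly in the part of
  \<open>t < \<tau>\<close> on one side of the line \<open>x = c g t\<^sup>2 / 2\<close> and inside a backward cone with speed \<open>M\<close>. Differentiating any one of the
  factors produces a nonpositive term: the moving line because of the sign of \<open>c \<eta> - Q\<close>, the cone because
  \<open>\<bar>Q\<bar> \<le> M \<eta>\<close>, the time cut-off because \<open>\<eta> \<ge> 0\<close>. The entropy inequality therefore forces all three terms to
  vanish, the last one giving \<open>\<eta> = 0\<close>. The parameter \<open>\<epsilon>\<close> is \<open>1\<close> to the left of the line and \<open>- 1\<close> to its right.
\<close>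
lemma entropy_vanishes_in_cone:
  fixes \<eta> Q :: "real \<Rightarrow> real"
  assumes sol: "entropy_solution g T \<rho>m \<rho>p F \<rho>" and g: "0 < g" and T: "\<tau> < T"
    and \<eta>: "C2_on \<rho>m \<rho>p \<eta>" "convex_on {\<rho>m..\<rho>p} \<eta>"
    and Q: "\<And>r. r \<in> {\<rho>m..\<rho>p} \<Longrightarrow> (Q has_real_derivative deriv_on \<rho>m \<rho>p \<eta> r * deriv_on \<rho>m \<rho>p F r) (at r within {\<rho>m..\<rho>p})"
    and pos: "\<And>r. r \<in> {\<rho>m..\<rho>p} \<Longrightarrow> 0 \<le> \<eta> r"
    and M: "\<And>r. r \<in> {\<rho>m..\<rho>p} \<Longrightarrow> \<bar>Q r\<bar> \<le> M * \<eta> r"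
    and e: "\<bar>\<epsilon>\<bar> = 1"
    and c: "\<And>r. r \<in> {\<rho>m..\<rho>p} \<Longrightarrow> \<epsilon> * (c * \<eta> r - Q r) \<le> 0"
    and init: "\<And>x. \<epsilon> * x < 0 \<Longrightarrow> \<eta> (rho0 \<rho>m \<rho>p x) = 0"
  shows "AE p in lborel. 0 < snd p \<and> snd p < \<tau> \<and> 0 < \<epsilon> * (c * (g * (snd p)^2 / 2) - fst p) \<and>
      0 < \<epsilon> * fst p - M * (g * (snd p)^2 / 2) + R \<longrightarrow> \<eta> (\<rho> p) = 0"
proof -
  define a where "a p = \<epsilon> * (c * (g * (snd p)^2 / 2) - fst p)" for p :: "real \<times> real"
  define b where "b p = \<epsilon> * fst p - M * (g * (snd p)^2 / 2) + R" for p :: "real \<times> real"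
  define \<phi> where "\<phi> p = sramp (a p) * sramp (b p) * sramp (\<tau> - snd p)" for p
  define \<phi>t where "\<phi>t p = sstep (a p) * (\<epsilon> * c * g * snd p) * sramp (b p) * sramp (\<tau> - snd p)
     + sramp (a p) * (sstep (b p) * (- M * g * snd p)) * sramp (\<tau> - snd p)
     - sramp (a p) * sramp (b p) * sstep (\<tau> - snd p)" for p
  define \<phi>x where "\<phi>x p = - \<epsilon> * sstep (a p) * sramp (b p) * sramp (\<tau> - snd p)
     + sramp (a p) * (\<epsilon> * sstep (b p)) * sramp (\<tau> - snd p)" for p
  define \<Sigma> where "\<Sigma> = (UNIV :: real set) \<times> {0<..<T}"
  define w where "w p = indicator \<Sigma> p * (\<eta> (\<rho> p) * \<phi>t p + g * snd p * Q (\<rho> p) * \<phi>x p)" for p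
  have range: "\<rho> p \<in> {\<rho>m..\<rho>p}" if "p \<in> \<Sigma>" for p
    using entropy_solution_range[OF sol] that unfolding \<Sigma>_def by (cases p) simp
  have smooth: "smooth \<phi>"
  proof -
    have "a = (\<lambda>p. (\<epsilon> * c * g / 2) * (snd p)^2 - \<epsilon> * fst p)" "b = (\<lambda>p. \<epsilon> * fst p - (M * g / 2) * (snd p)^2 + R)"
      by (auto simp: a_def b_def algebra_simps)
    then have "smooth a" "smooth b"
      by (auto intro!: smooth_intros simp only:)
    then show ?thesis
      unfolding \<phi>_def by (intro smooth_intros smooth_compose[OF smooth_sramp])
  qed
  have deriv: "(\<phi> has_derivative (\<lambda>h. fst h * \<phi>x p + snd h * \<phi>t p)) (at p)" for p
  proof -
    have da: "(a has_derivative (\<lambda>h. \<epsilon> * (c * g * snd p * snd h - fst h))) (at p)"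
      unfolding a_def by (auto intro!: derivative_eq_intros simp: algebra_simps)
    have db: "(b has_derivative (\<lambda>h. \<epsilon> * fst h - M * g * snd p * snd h)) (at p)"
      unfolding b_def by (auto intro!: derivative_eq_intros simp: algebra_simps)
    have dc: "((\<lambda>p::real \<times> real. \<tau> - snd p) has_derivative (\<lambda>h. - snd h)) (at p)"
      by (auto intro!: derivative_eq_intros)
    show ?thesis unfolding \<phi>_def
      by (rule has_derivative_eq_rhs[OF has_derivative_mult[OF has_derivative_mult[OF
            sramp_has_derivative[OF da] sramp_has_derivative[OF db]] sramp_has_derivative[OF dc]]])
         (auto simp: fun_eq_iff \<phi>x_def \<phi>t_def algebra_simps)
  qed
  have fd: "frechet_derivative \<phi> (at p) = (\<lambda>h. fst h * \<phi>x p + snd h * \<phi>t p)" for p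
    by (rule frechet_derivative_at[symmetric]) (rule deriv)
  define R' where "R' = \<bar>R\<bar> + \<bar>M\<bar> * (g * T^2 / 2) + \<bar>c\<bar> * (g * T^2 / 2)"
  have supp: "\<bar>x\<bar> \<le> R'" if "0 < a (x, t)" "0 < b (x, t)" "0 \<le> t" "t < T" for x t
  proof -
    have tt: "0 \<le> g * t^2 / 2" "g * t^2 / 2 \<le> g * T^2 / 2"
      using that g by (auto intro!: divide_right_mono mult_left_mono power_mono)
    have "\<epsilon> * x < \<epsilon> * c * (g * t^2 / 2)" using that by (simp add: a_def algebra_simps)
    also have "\<dots> \<le> \<bar>\<epsilon> * c\<bar> * (g * T^2 / 2)"
      by (rule order_trans[OF mult_right_mono[OF abs_ge_self tt(1)] mult_left_mono[OF tt(2)]]) auto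
    finally have 1: "\<epsilon> * x < \<bar>c\<bar> * (g * T^2 / 2)" using e by (simp add: abs_mult)
    have "- (\<epsilon> * x) < R - M * (g * t^2 / 2)" using that by (simp add: b_def)
    also have "\<dots> \<le> \<bar>R\<bar> + \<bar>M\<bar> * (g * t^2 / 2)"
      using mult_right_mono[OF abs_ge_minus_self[of M] tt(1)] by simp
    also have "\<dots> \<le> \<bar>R\<bar> + \<bar>M\<bar> * (g * T^2 / 2)" using tt by (intro add_left_mono mult_left_mono) auto
    finally have 2: "- (\<epsilon> * x) < \<bar>R\<bar> + \<bar>M\<bar> * (g * T^2 / 2)" .
    have "\<bar>x\<bar> = \<bar>\<epsilon> * x\<bar>" using e by (simp add: abs_mult)
    moreover have "0 \<le> \<bar>M\<bar> * (g * T^2 / 2)" "0 \<le> \<bar>c\<bar> * (g * T^2 / 2)" using g by auto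
    ultimately show ?thesis using 1 2 by (simp add: R'_def abs_if split: if_splits)
  qed
  have test: "line_test_fun T \<phi>"
  proof -
    have "\<phi> (x, t) = 0" if *: "0 \<le> t \<and> t < T \<and> (\<tau> \<le> t \<or> R' < \<bar>x\<bar>)" for x t
    proof (cases "0 < a (x, t) \<and> 0 < b (x, t)")
      case True
      then have "\<tau> \<le> t" using supp[of x t] * by auto
      then show ?thesis by (simp add: \<phi>_def)
    next
      case False
      then show ?thesis by (auto simp: \<phi>_def not_less)
    qed
    then show ?thesis unfolding line_test_fun_def using smooth T by blast
  qed
  have "0 \<le> (LINT (x, t):UNIV \<times> {0<..<T}|lborel.
               \<eta> (\<rho> (x, t)) * frechet_derivative \<phi> (at (x, t)) (0, 1)
               + g * t * Q (\<rho> (x, t)) * frechet_derivative \<phi> (at (x, t)) (1, 0))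
             + (LINT x|lborel. \<eta> (rho0 \<rho>m \<rho>p x) * \<phi> (x, 0))"
    by (rule entropy_solution_ineq[OF sol \<eta> Q test]) (auto simp: \<phi>_def sramp_nonneg)
  moreover have "\<eta> (rho0 \<rho>m \<rho>p x) * \<phi> (x, 0) = 0" for x
  proof (cases "\<epsilon> * x < 0")
    case True
    then show ?thesis using init by simp
  next
    case False
    then show ?thesis by (simp add: \<phi>_def a_def)
  qed
  moreover have "(LINT (x, t):UNIV \<times> {0<..<T}|lborel.
               \<eta> (\<rho> (x, t)) * frechet_derivative \<phi> (at (x, t)) (0, 1)
               + g * t * Q (\<rho> (x, t)) * frechet_derivative \<phi> (at (x, t)) (1, 0)) = (LINT p|lborel. w p)"
    unfolding set_lebesgue_integral_def w_def \<Sigma>_def fd by (intro Bochner_Integration.integral_cong) auto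
  ultimately have int: "0 \<le> (LINT p|lborel. w p)" by simp
  \<comment> \<open>Sorted by the factor of the product that is differentiated, each group is nonnegative inside the bracket.\<close>
  have w_eq: "w p = - indicator \<Sigma> p * (
      - (g * snd p * sstep (a p) * sramp (b p) * sramp (\<tau> - snd p)) * (\<epsilon> * (c * \<eta> (\<rho> p) - Q (\<rho> p)))
      + sramp (a p) * sstep (b p) * sramp (\<tau> - snd p) * (g * snd p) * (M * \<eta> (\<rho> p) - \<epsilon> * Q (\<rho> p))
      + sramp (a p) * sramp (b p) * sstep (\<tau> - snd p) * \<eta> (\<rho> p))" for p
    by (simp add: w_def \<phi>t_def \<phi>x_def algebra_simps)
  have terms: "0 \<le> - (g * snd p * sstep (a p) * sramp (b p) * sramp (\<tau> - snd p)) * (\<epsilon> * (c * \<eta> (\<rho> p) - Q (\<rho> p)))"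
    "0 \<le> sramp (a p) * sstep (b p) * sramp (\<tau> - snd p) * (g * snd p) * (M * \<eta> (\<rho> p) - \<epsilon> * Q (\<rho> p))"
    "0 \<le> sramp (a p) * sramp (b p) * sstep (\<tau> - snd p) * \<eta> (\<rho> p)" if "p \<in> \<Sigma>" for p
  proof -
    have t: "0 < snd p" using that by (auto simp: \<Sigma>_def)
    show "0 \<le> - (g * snd p * sstep (a p) * sramp (b p) * sramp (\<tau> - snd p)) * (\<epsilon> * (c * \<eta> (\<rho> p) - Q (\<rho> p)))"
      using c[OF range[OF that]] g t
      by (intro mult_nonpos_nonpos) (auto intro!: mult_nonneg_nonneg sramp_nonneg sstep_nonneg)
    have "\<epsilon> * Q (\<rho> p) \<le> \<bar>\<epsilon> * Q (\<rho> p)\<bar>" by simp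
    also have "\<dots> \<le> M * \<eta> (\<rho> p)" using M[OF range[OF that]] e by (simp add: abs_mult)
    finally show "0 \<le> sramp (a p) * sstep (b p) * sramp (\<tau> - snd p) * (g * snd p) * (M * \<eta> (\<rho> p) - \<epsilon> * Q (\<rho> p))"
      using g t by (intro mult_nonneg_nonneg sramp_nonneg sstep_nonneg) auto
    show "0 \<le> sramp (a p) * sramp (b p) * sstep (\<tau> - snd p) * \<eta> (\<rho> p)"
      using pos[OF range[OF that]] by (intro mult_nonneg_nonneg sramp_nonneg sstep_nonneg) auto
  qed
  have w_le: "w p \<le> 0" for p
    unfolding w_eq using terms[of p] by (auto simp: indicator_def)
  \<comment> \<open>Clamping to \<open>{\<rho>m..\<rho>p}\<close> makes the composition with functions given only on this interval measurable.\<close>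
  define cl where "cl r = max \<rho>m (min \<rho>p r)" for r :: real
  define r1 where "r1 p = cl (indicator \<Sigma> p * \<rho> p)" for p
  have ne: "\<rho>m \<le> \<rho>p" if "p \<in> \<Sigma>" for p using range[OF that] by auto
  have wint: "integrable lborel w"
  proof (cases "\<Sigma> = {}")
    case True
    then have "w = (\<lambda>p. 0)" by (simp add: w_def fun_eq_iff)
    then show ?thesis by simp
  next
    case False
    then have mp: "\<rho>m \<le> \<rho>p" using ne by auto
    have cl_in: "cl r \<in> {\<rho>m..\<rho>p}" for r using mp by (auto simp: cl_def)
    have cl_cont: "continuous_on UNIV cl" unfolding cl_def by (intro continuous_intros)
    have \<eta>_cont: "continuous_on {\<rho>m..\<rho>p} \<eta>"
      using \<eta>(1) by (auto simp: C2_on_def differentiable_imp_continuous_on)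
    have Q_cont: "continuous_on {\<rho>m..\<rho>p} Q"
      by (rule DERIV_continuous_on[OF Q])
    have cm: "(\<lambda>r. f (cl r)) \<in> borel_measurable borel" if "continuous_on {\<rho>m..\<rho>p} f" for f :: "real \<Rightarrow> real"
      by (rule borel_measurable_continuous_onI[OF continuous_on_compose2[OF that cl_cont]]) (use cl_in in auto)
    have rm: "(\<lambda>p. indicator \<Sigma> p * \<rho> p) \<in> borel_measurable lborel"
      using sol unfolding entropy_solution_def set_borel_measurable_def \<Sigma>_def by (elim conjE) simp
    have m1: "(\<lambda>p. \<eta> (r1 p)) \<in> borel_measurable lborel" "(\<lambda>p. Q (r1 p)) \<in> borel_measurable lborel"
      unfolding r1_def using measurable_compose[OF rm cm[OF \<eta>_cont]] measurable_compose[OF rm cm[OF Q_cont]] by auto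
    define v where "v p = \<eta> (r1 p) * \<phi>t p + g * snd p * Q (r1 p) * \<phi>x p" for p
    have cont: "continuous_on UNIV \<phi>t" "continuous_on UNIV \<phi>x"
      unfolding \<phi>t_def \<phi>x_def a_def b_def by (auto intro!: continuous_intros)
    have \<Sigma>m: "\<Sigma> \<in> sets lborel" unfolding \<Sigma>_def by (simp add: borel_open open_Times)
    define K where "K = cbox (- R', 0) (R', T)"
    have vm: "(\<lambda>p. indicator \<Sigma> p * v p) \<in> borel_measurable lborel"
      unfolding v_def using m1 cont[THEN borel_measurable_continuous_onI] \<Sigma>m
      by (intro borel_measurable_times borel_measurable_add borel_measurable_indicator)
         (auto intro!: borel_measurable_continuous_onI continuous_intros)
    have bdd: "\<exists>B. \<forall>x\<in>S. \<bar>f x\<bar> \<le> B" if "continuous_on S f" "compact S" for f :: "'z::metric_space \<Rightarrow> real" and S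
      using compact_imp_bounded[OF compact_continuous_image[OF that]] unfolding bounded_iff by simp
    obtain B1 where B1: "\<And>r. r \<in> {\<rho>m..\<rho>p} \<Longrightarrow> \<bar>\<eta> r\<bar> \<le> B1"
      using bdd[OF \<eta>_cont compact_Icc] by blast
    obtain B2 where B2: "\<And>r. r \<in> {\<rho>m..\<rho>p} \<Longrightarrow> \<bar>Q r\<bar> \<le> B2"
      using bdd[OF Q_cont compact_Icc] by blast
    have K: "compact K" by (simp add: K_def)
    obtain B3 where B3: "\<And>p. p \<in> K \<Longrightarrow> \<bar>\<phi>t p\<bar> \<le> B3"
      using bdd[OF continuous_on_subset[OF cont(1) subset_UNIV] K] by blast
    have "continuous_on K (\<lambda>p. g * snd p * \<phi>x p)"
      by (intro continuous_on_mult continuous_on_const continuous_on_snd continuous_on_id continuous_on_subset[OF cont(2) subset_UNIV])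
    then obtain B4 where B4: "\<And>p. p \<in> K \<Longrightarrow> \<bar>g * snd p * \<phi>x p\<bar> \<le> B4"
      using bdd[OF _ K] by blast
    have vb: "\<bar>indicator \<Sigma> p * v p\<bar> \<le> B1 * B3 + B2 * B4" if "p \<in> K" for p
    proof -
      have "\<bar>indicator \<Sigma> p * v p\<bar> \<le> \<bar>v p\<bar>" by (simp add: indicator_def)
      also have "\<dots> \<le> \<bar>\<eta> (r1 p)\<bar> * \<bar>\<phi>t p\<bar> + \<bar>Q (r1 p)\<bar> * \<bar>g * snd p * \<phi>x p\<bar>"
        unfolding v_def by (rule order_trans[OF abs_triangle_ineq]) (simp add: abs_mult mult_ac)
      also have "\<dots> \<le> B1 * B3 + B2 * B4"
        using B1[of "r1 p"] B2[of "r1 p"] B3[OF that] B4[OF that] cl_in unfolding r1_def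
        by (intro add_mono mult_mono) (auto intro: order_trans[OF abs_ge_zero])
      finally show ?thesis .
    qed
    have "integrable lborel (\<lambda>p. indicator K p *\<^sub>R (indicator \<Sigma> p * v p))"
      by (rule integrableI_bounded_set_indicator[where B="B1 * B3 + B2 * B4"])
         (use vm vb emeasure_lborel_cbox_finite[of "(- R', 0)" "(R', T)"] in \<open>auto simp: K_def\<close>)
    moreover have "indicator K p *\<^sub>R (indicator \<Sigma> p * v p) = w p" for p
    proof (cases "p \<in> \<Sigma>")
      case True
      then have r1: "r1 p = \<rho> p" using range[OF True] by (auto simp: r1_def cl_def)
      show ?thesis
      proof (cases "p \<in> K")
        case True
        then show ?thesis by (simp add: w_def v_def r1)
      next
        case False
        obtain x t where p: "p = (x, t)" by (cases p)
        have "\<not> (0 < a p \<and> 0 < b p)"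
          using supp[of x t] False True unfolding p K_def \<Sigma>_def by (auto simp: cbox_Pair_iff)
        then have "\<phi>t p = 0" "\<phi>x p = 0" by (auto simp: \<phi>t_def \<phi>x_def not_less)
        then show ?thesis using False by (simp add: w_def)
      qed
    qed (simp add: w_def)
    ultimately show ?thesis by simp
  qed
  have "integral\<^sup>L lborel (\<lambda>p. - w p) = 0"
    using int w_le Bochner_Integration.integral_nonneg[of lborel "\<lambda>p. - w p"] by simp
  then have "AE p in lborel. - w p = 0"
    using integral_nonneg_eq_0_iff_AE[of lborel "\<lambda>p. - w p"] wint w_le by auto
  then show ?thesis
  proof eventually_elim
    case (elim p)
    show ?case
    proof (intro impI)
      assume *: "0 < snd p \<and> snd p < \<tau> \<and> 0 < \<epsilon> * (c * (g * (snd p)^2 / 2) - fst p) \<and>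
        0 < \<epsilon> * fst p - M * (g * (snd p)^2 / 2) + R"
      then have pS: "p \<in> \<Sigma>" using T by (cases p) (auto simp: \<Sigma>_def)
      have "sramp (a p) * sramp (b p) * sstep (\<tau> - snd p) * \<eta> (\<rho> p) = 0"
      proof -
        have gen: "0 \<le> u \<Longrightarrow> 0 \<le> v \<Longrightarrow> 0 \<le> x \<Longrightarrow> u + v + x = 0 \<Longrightarrow> x = 0" for u v x :: real by linarith
        have "- (g * snd p * sstep (a p) * sramp (b p) * sramp (\<tau> - snd p)) * (\<epsilon> * (c * \<eta> (\<rho> p) - Q (\<rho> p)))
            + sramp (a p) * sstep (b p) * sramp (\<tau> - snd p) * (g * snd p) * (M * \<eta> (\<rho> p) - \<epsilon> * Q (\<rho> p))
            + sramp (a p) * sramp (b p) * sstep (\<tau> - snd p) * \<eta> (\<rho> p) = 0"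
          using elim pS unfolding w_eq by (simp only: indicator_simps) simp
        then show ?thesis by (rule gen[OF terms[OF pS]])
      qed
      moreover have "0 < sramp (a p)" "0 < sramp (b p)" "0 < sstep (\<tau> - snd p)"
        using * by (auto simp: a_def b_def intro!: sramp_pos sstep_pos)
      ultimately show "\<eta> (\<rho> p) = 0" by simp
    qed
  qed
qed

lemma entropy_vanishes_in_sector:
  fixes \<eta> Q :: "real \<Rightarrow> real"
  assumes sol: "entropy_solution g T \<rho>m \<rho>p F \<rho>" and g: "0 < g"
    and \<eta>: "C2_on \<rho>m \<rho>p \<eta>" "convex_on {\<rho>m..\<rho>p} \<eta>"
    and Q: "\<And>r. r \<in> {\<rho>m..\<rho>p} \<Longrightarrow> (Q has_real_derivative deriv_on \<rho>m \<rho>p \<eta> r * deriv_on \<rho>m \<rho>p F r) (at r within {\<rho>m..\<rho>p})"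
    and pos: "\<And>r. r \<in> {\<rho>m..\<rho>p} \<Longrightarrow> 0 \<le> \<eta> r"
    and M: "\<And>r. r \<in> {\<rho>m..\<rho>p} \<Longrightarrow> \<bar>Q r\<bar> \<le> M * \<eta> r"
    and e: "\<bar>\<epsilon>\<bar> = 1"
    and c: "\<And>r. r \<in> {\<rho>m..\<rho>p} \<Longrightarrow> \<epsilon> * (c * \<eta> r - Q r) \<le> 0"
    and init: "\<And>x. \<epsilon> * x < 0 \<Longrightarrow> \<eta> (rho0 \<rho>m \<rho>p x) = 0"
  shows "AE p in lborel. snd p \<in> {0<..<T} \<and> 0 < \<epsilon> * (c * (g * (snd p)^2 / 2) - fst p) \<longrightarrow> \<eta> (\<rho> p) = 0"
proof -
  have "AE p in lborel. \<forall>n::nat. 0 < snd p \<and> snd p < T - 1 / real (Suc n) \<and> 0 < \<epsilon> * (c * (g * (snd p)^2 / 2) - fst p) \<and>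
      0 < \<epsilon> * fst p - M * (g * (snd p)^2 / 2) + real n \<longrightarrow> \<eta> (\<rho> p) = 0"
    unfolding AE_all_countable
    by (intro allI entropy_vanishes_in_cone[OF sol g _ \<eta> Q pos M e c init]) auto
  then show ?thesis
  proof eventually_elim
    case (elim p)
    show ?case
    proof (intro impI)
      assume *: "snd p \<in> {0<..<T} \<and> 0 < \<epsilon> * (c * (g * (snd p)^2 / 2) - fst p)"
      obtain n1 where n1: "inverse (real (Suc n1)) < T - snd p"
        using reals_Archimedean[of "T - snd p"] * by auto
      obtain n2 :: nat where n2: "M * (g * (snd p)^2 / 2) - \<epsilon> * fst p < real n2"
        using reals_Archimedean2 by blast
      define n where "n = max n1 n2"
      have "1 / real (Suc n) \<le> inverse (real (Suc n1))"
        by (simp add: n_def inverse_eq_divide frac_le)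
      then have "snd p < T - 1 / real (Suc n)" using n1 by linarith
      moreover have "0 < \<epsilon> * fst p - M * (g * (snd p)^2 / 2) + real n"
        using n2 by (simp add: n_def)
      ultimately show "\<eta> (\<rho> p) = 0" using elim * by auto
    qed
  qed
qed

context convex_flux begin

lemma F1_strict_mono: "r \<in> {\<rho>m..\<rho>p} \<Longrightarrow> s \<in> {\<rho>m..\<rho>p} \<Longrightarrow> r < s \<Longrightarrow> F1 r < F1 s"
proof -
  assume *: "r \<in> {\<rho>m..\<rho>p}" "s \<in> {\<rho>m..\<rho>p}" "r < s"
  have "(F1 has_real_derivative F2 x) (at x)" if "r < x" "x < s" for x
    using F1_deriv_at[of x] * that by auto
  moreover have "continuous_on {r..s} F1" by (rule continuous_on_subset[OF F1_cont]) (use * in auto)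
  moreover have "0 < F2 x" if "r < x" "x < s" for x using F2_pos[of x] * that by auto
  ultimately show "F1 r < F1 s"
    by (intro DERIV_pos_imp_increasing_open[OF *(3)]) blast+
qed

lemma F1_mono: "r \<in> {\<rho>m..\<rho>p} \<Longrightarrow> s \<in> {\<rho>m..\<rho>p} \<Longrightarrow> r \<le> s \<Longrightarrow> F1 r \<le> F1 s"
  using F1_strict_mono[of r s] by (cases "r = s") auto

lemma deriv_on_F: "r \<in> {\<rho>m..\<rho>p} \<Longrightarrow> deriv_on \<rho>m \<rho>p F r = F1 r"
  using deriv_on_eq rho F1 by blast

text \<open>
  The cubic entropy \<open>max 0 (\<epsilon> * (r - k)) ^ 3\<close> is \<open>C\<^sup>2\<close> and vanishes on one side of \<open>k\<close>. With \<open>Q k = 0\<close>, every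
  combination \<open>G = x * \<eta> + y * Q\<close> has \<open>G k = 0\<close> and \<open>G' = \<eta>' * (x + y * F')\<close>, so by the mean value theorem
  its sign is that of \<open>x + y * F'\<close> on the relevant side of \<open>k\<close>. This yields both the speed bound on \<open>Q\<close> and,
  \<open>F'\<close> being increasing, the sign required at the characteristic \<open>x = F1 k * g t\<^sup>2 / 2\<close>.
\<close>
lemma entropy_solution_one_sided:
  assumes sol: "entropy_solution g T \<rho>m \<rho>p F \<rho>" and g: "0 < g" and k: "k \<in> {\<rho>m..\<rho>p}"
    and e: "\<epsilon> = 1 \<or> \<epsilon> = - 1"
  shows "AE p in lborel. snd p \<in> {0<..<T} \<and> 0 < \<epsilon> * (F1 k * (g * (snd p)^2 / 2) - fst p) \<longrightarrow> \<epsilon> * (\<rho> p - k) \<le> 0"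
proof -
  obtain C where C: "0 < C" "\<And>r. r \<in> {\<rho>m..\<rho>p} \<Longrightarrow> \<bar>F1 r\<bar> \<le> C" using F1_bound by blast
  define \<eta> where "\<eta> r = max 0 (\<epsilon> * (r - k)) ^ 3" for r :: real
  define \<eta>1 where "\<eta>1 r = 3 * \<epsilon> * max 0 (\<epsilon> * (r - k)) ^ 2" for r :: real
  define \<eta>2 where "\<eta>2 r = 6 * max 0 (\<epsilon> * (r - k))" for r :: real
  define Q where "Q r = integral {\<rho>m..r} (\<lambda>s. \<eta>1 s * F1 s) - integral {\<rho>m..k} (\<lambda>s. \<eta>1 s * F1 s)" for r
  have ee: "\<epsilon> * (\<epsilon> * x) = x" for x using e by auto
  have lin: "((\<lambda>r. \<epsilon> * (r - k)) has_real_derivative \<epsilon>) (at r)" for r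
    by (auto intro!: derivative_eq_intros)
  have d3: "((\<lambda>x::real. max 0 x ^ 3) has_real_derivative 3 * max 0 x ^ 2) (at x)" for x
    using max_0_power_has_real_derivative[of 1 x] by (simp add: numeral_eq_Suc)
  have d2: "((\<lambda>x::real. max 0 x ^ 2) has_real_derivative 2 * max 0 x) (at x)" for x
    using max_0_power_has_real_derivative[of 0 x] by (simp add: numeral_eq_Suc)
  have \<eta>1: "(\<eta> has_real_derivative \<eta>1 r) (at r)" for r
    using DERIV_chain2[OF d3 lin, of r] by (simp add: \<eta>_def[abs_def] \<eta>1_def mult_ac)
  have \<eta>2: "(\<eta>1 has_real_derivative \<eta>2 r) (at r)" for r
    using DERIV_cmult[OF DERIV_chain2[OF d2 lin], of "3 * \<epsilon>" r]
    by (simp add: \<eta>1_def[abs_def] \<eta>2_def mult_ac ee)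
  have \<eta>1_cont: "continuous_on S \<eta>1" for S unfolding \<eta>1_def by (intro continuous_intros)
  have C2: "C2_on \<rho>m \<rho>p \<eta>"
  proof (rule C2_onI[OF rho(2) DERIV_subset[OF \<eta>1] DERIV_subset[OF \<eta>2]])
    show "continuous_on {\<rho>m..\<rho>p} \<eta>2" unfolding \<eta>2_def by (intro continuous_intros)
  qed auto
  have "convex_on UNIV \<eta>"
  proof (rule convex_on_realI[OF _ \<eta>1])
    show "\<eta>1 x \<le> \<eta>1 y" if "x \<le> y" for x y
      by (rule DERIV_nonneg_imp_nondecreasing[OF that]) (auto intro!: exI \<eta>2 simp: \<eta>2_def)
  qed auto
  then have cvx: "convex_on {\<rho>m..\<rho>p} \<eta>" by (rule convex_on_subset) auto
  have \<eta>Fcont: "continuous_on {\<rho>m..\<rho>p} (\<lambda>s. \<eta>1 s * F1 s)"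
    by (intro continuous_intros \<eta>1_cont F1_cont)
  have Q': "(Q has_real_derivative \<eta>1 r * F1 r) (at r within {\<rho>m..\<rho>p})" if "r \<in> {\<rho>m..\<rho>p}" for r
    unfolding Q_def[abs_def]
    using DERIV_diff[OF integral_has_real_derivative[OF \<eta>Fcont that] DERIV_const] by simp
  have sgn: "0 \<le> x * \<eta> r + y * Q r"
    if r: "r \<in> {\<rho>m..\<rho>p}" and xy: "\<And>s. s \<in> {\<rho>m..\<rho>p} \<Longrightarrow> 0 \<le> \<epsilon> * (s - k) \<Longrightarrow> 0 \<le> x + y * F1 s" for x y r
  proof -
    define G where "G r = x * \<eta> r + y * Q r" for r
    have G': "(G has_real_derivative \<eta>1 s * (x + y * F1 s)) (at s within {\<rho>m..\<rho>p})" if "s \<in> {\<rho>m..\<rho>p}" for s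
      using DERIV_add[OF DERIV_cmult[OF DERIV_subset[OF \<eta>1], of _ x] DERIV_cmult[OF Q'[OF that], of y]]
      by (simp add: G_def[abs_def] algebra_simps)
    have Gk: "G k = 0" by (simp add: G_def \<eta>_def Q_def)
    have "\<exists>s\<in>{\<rho>m..\<rho>p}. G r = (r - k) * (\<eta>1 s * (x + y * F1 s)) \<and> (s - k) * (s - r) \<le> 0"
    proof (cases "r = k")
      case False
      \<comment> \<open>the mean value theorem between \<open>k\<close> and \<open>r\<close>, in either order\<close>
      define lo hi where "lo = min r k" and "hi = max r k"
      have lh: "lo < hi" "{lo..hi} \<subseteq> {\<rho>m..\<rho>p}" using False r k by (auto simp: lo_def hi_def)
      have "continuous_on {lo..hi} G"
        by (rule continuous_on_subset[OF DERIV_continuous_on[OF G'] lh(2)])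
      moreover have "(G has_real_derivative \<eta>1 s * (x + y * F1 s)) (at s)" if "lo < s" "s < hi" for s
        using G'[of s] at_within_Icc_at[of \<rho>m s \<rho>p] lh that by force
      ultimately obtain s where s: "lo < s" "s < hi" "G hi - G lo = (hi - lo) * (\<eta>1 s * (x + y * F1 s))"
        using MVT[OF lh(1), of G] by (metis DERIV_unique real_differentiable_def)
      then have "G r = (r - k) * (\<eta>1 s * (x + y * F1 s))"
        using Gk by (auto simp: lo_def hi_def min_def max_def algebra_simps split: if_splits)
      moreover have "(s - k) * (s - r) \<le> 0"
        using s(1,2) by (auto simp: lo_def hi_def min_def max_def mult_le_0_iff split: if_splits)
      ultimately show ?thesis using s lh by force
    qed (use r Gk in \<open>auto intro!: bexI[of _ k]\<close>)
    then obtain s where s: "s \<in> {\<rho>m..\<rho>p}" "G r = (r - k) * (\<eta>1 s * (x + y * F1 s))" "(s - k) * (s - r) \<le> 0" by blast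
    show ?thesis
    proof (cases "0 < \<epsilon> * (s - k)")
      case True
      then have "0 \<le> \<epsilon> * (r - k)" using s(3) e by (auto simp: mult_le_0_iff)
      moreover have "0 \<le> x + y * F1 s" using xy[OF s(1)] True by simp
      moreover have "G r = 3 * (\<epsilon> * (r - k)) * max 0 (\<epsilon> * (s - k)) ^ 2 * (x + y * F1 s)"
        unfolding s(2) \<eta>1_def by (simp add: mult_ac)
      ultimately show ?thesis unfolding G_def[symmetric] by simp
    next
      case False
      then have "G r = 0" unfolding s(2) by (simp add: \<eta>1_def max_def)
      then show ?thesis by (simp add: G_def)
    qed
  qed
  have "AE p in lborel. snd p \<in> {0<..<T} \<and> 0 < \<epsilon> * (F1 k * (g * (snd p)^2 / 2) - fst p) \<longrightarrow> \<eta> (\<rho> p) = 0"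
  proof (rule entropy_vanishes_in_sector[OF sol g C2 cvx, where M = C and Q = Q])
    show "(Q has_real_derivative deriv_on \<rho>m \<rho>p \<eta> r * deriv_on \<rho>m \<rho>p F r) (at r within {\<rho>m..\<rho>p})" if "r \<in> {\<rho>m..\<rho>p}" for r
      using Q'[OF that] deriv_on_eq[OF rho(2) that DERIV_subset[OF \<eta>1]] by (simp add: deriv_on_F[OF that])
    show "\<bar>Q r\<bar> \<le> C * \<eta> r" if "r \<in> {\<rho>m..\<rho>p}" for r
    proof -
      have f: "0 \<le> C + 1 * F1 s" "0 \<le> C + (- 1) * F1 s" if "s \<in> {\<rho>m..\<rho>p}" for s
        using C(2)[OF that] by auto
      have "0 \<le> C * \<eta> r + 1 * Q r" by (rule sgn[OF that]) (erule f(1))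
      moreover have "0 \<le> C * \<eta> r + (- 1) * Q r" by (rule sgn[OF that]) (erule f(2))
      ultimately show ?thesis by simp
    qed
    show "\<epsilon> * (F1 k * \<eta> r - Q r) \<le> 0" if "r \<in> {\<rho>m..\<rho>p}" for r
    proof -
      have "0 \<le> - \<epsilon> * F1 k + \<epsilon> * F1 s" if "s \<in> {\<rho>m..\<rho>p}" "0 \<le> \<epsilon> * (s - k)" for s
        using e F1_mono[OF k that(1)] F1_mono[OF that(1) k] that(2) by auto
      from sgn[OF that this] show ?thesis by (simp add: algebra_simps)
    qed
    show "\<eta> (rho0 \<rho>m \<rho>p x) = 0" if "\<epsilon> * x < 0" for x
      using that k e by (auto simp: rho0_def \<eta>_def)
  qed (use e in \<open>auto simp: \<eta>_def\<close>)
  then show ?thesis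
    by eventually_elim (auto simp: \<eta>_def max_def split: if_splits)
qed

end

context convex_flux begin

text \<open>The inverse of \<open>F1\<close>, continued by the end values.\<close>
definition fan :: "real \<Rightarrow> real" where
  "fan \<xi> = the_inv_into {\<rho>m..\<rho>p} F1 (max (F1 \<rho>m) (min (F1 \<rho>p) \<xi>))"

lemma F1_inj: "inj_on F1 {\<rho>m..\<rho>p}"
  by (rule strict_mono_on_imp_inj_on) (auto simp: strict_mono_on_def intro: F1_strict_mono)

lemma F1_image: "F1 ` {\<rho>m..\<rho>p} = {F1 \<rho>m..F1 \<rho>p}"
proof
  show "F1 ` {\<rho>m..\<rho>p} \<subseteq> {F1 \<rho>m..F1 \<rho>p}" using F1_mono rho by auto
  show "{F1 \<rho>m..F1 \<rho>p} \<subseteq> F1 ` {\<rho>m..\<rho>p}"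
  proof
    fix y assume "y \<in> {F1 \<rho>m..F1 \<rho>p}"
    then obtain x where "\<rho>m \<le> x" "x \<le> \<rho>p" "F1 x = y"
      using IVT'[OF _ _ _ F1_cont, of y] rho by auto
    then show "y \<in> F1 ` {\<rho>m..\<rho>p}" by auto
  qed
qed

lemma F1_le: "F1 \<rho>m \<le> F1 \<rho>p" using F1_mono rho by auto

lemma clamp_in: "max (F1 \<rho>m) (min (F1 \<rho>p) \<xi>) \<in> F1 ` {\<rho>m..\<rho>p}"
  using F1_le unfolding F1_image by auto

lemma fan_in: "fan \<xi> \<in> {\<rho>m..\<rho>p}"
  unfolding fan_def by (rule the_inv_into_into[OF F1_inj clamp_in order_refl])

lemma F1_fan: "F1 (fan \<xi>) = max (F1 \<rho>m) (min (F1 \<rho>p) \<xi>)"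
  unfolding fan_def by (rule f_the_inv_into_f[OF F1_inj clamp_in])

lemma fan_unique:
  assumes "r \<in> {\<rho>m..\<rho>p}" "F1 r = max (F1 \<rho>m) (min (F1 \<rho>p) \<xi>)"
  shows "fan \<xi> = r"
  unfolding fan_def assms(2)[symmetric] by (rule the_inv_into_f_f[OF F1_inj assms(1)])

lemma fan_F1: "k \<in> {\<rho>m..\<rho>p} \<Longrightarrow> fan (F1 k) = k"
  using F1_mono[of \<rho>m k] F1_mono[of k \<rho>p] rho by (intro fan_unique) auto

lemma fan_left: "\<xi> \<le> F1 \<rho>m \<Longrightarrow> fan \<xi> = \<rho>m"
  using rho F1_le by (intro fan_unique) auto

lemma fan_right: "F1 \<rho>p \<le> \<xi> \<Longrightarrow> fan \<xi> = \<rho>p"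
  using rho F1_le by (intro fan_unique) auto

lemma fan_cont: "continuous_on UNIV fan"
proof -
  have "continuous_on (F1 ` {\<rho>m..\<rho>p}) (the_inv_into {\<rho>m..\<rho>p} F1)"
    by (rule continuous_on_inv[OF F1_cont]) (auto intro: the_inv_into_f_f[OF F1_inj])
  then show ?thesis
    unfolding fan_def
    by (rule continuous_on_compose2) (use clamp_in in \<open>auto intro!: continuous_intros\<close>)
qed

text \<open>The restriction to rational levels keeps the number of null sets countable in the almost everywhere application.\<close>
lemma fan_eqI:
  assumes r: "r \<in> {\<rho>m..\<rho>p}"
    and le: "\<And>k. k \<in> \<rat> \<Longrightarrow> k \<in> {\<rho>m..\<rho>p} \<Longrightarrow> \<xi> < F1 k \<Longrightarrow> r \<le> k"
    and ge: "\<And>k. k \<in> \<rat> \<Longrightarrow> k \<in> {\<rho>m..\<rho>p} \<Longrightarrow> F1 k < \<xi> \<Longrightarrow> k \<le> r"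
  shows "r = fan \<xi>"
proof (rule antisym)
  show "r \<le> fan \<xi>"
  proof (rule ccontr)
    assume "\<not> r \<le> fan \<xi>"
    then obtain k where k: "k \<in> \<rat>" "fan \<xi> < k" "k < r"
      using Rats_dense_in_real[of "fan \<xi>" r] by auto
    then have kI: "k \<in> {\<rho>m..\<rho>p}" using r fan_in[of \<xi>] by auto
    have "F1 (fan \<xi>) < F1 k" using F1_strict_mono[OF fan_in kI k(2)] .
    moreover have "F1 k \<le> F1 \<rho>p" using F1_mono kI rho by auto
    ultimately have "\<xi> < F1 k" unfolding F1_fan by auto
    then show False using le[OF k(1) kI] k by auto
  qed
  show "fan \<xi> \<le> r"
  proof (rule ccontr)
    assume "\<not> fan \<xi> \<le> r"
    then obtain k where k: "k \<in> \<rat>" "k < fan \<xi>" "r < k"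
      using Rats_dense_in_real[of r "fan \<xi>"] by auto
    then have kI: "k \<in> {\<rho>m..\<rho>p}" using r fan_in[of \<xi>] by auto
    have "F1 k < F1 (fan \<xi>)" using F1_strict_mono[OF kI fan_in k(2)] .
    moreover have "F1 \<rho>m \<le> F1 k" using F1_mono kI rho by auto
    ultimately have "F1 k < \<xi>" unfolding F1_fan by auto
    then show False using ge[OF k(1) kI] k by auto
  qed
qed

lemma entropy_solution_eq_fan:
  assumes sol: "entropy_solution g T \<rho>m \<rho>p F \<rho>" and g: "0 < g"
  shows "AE p in lborel. snd p \<in> {0<..<T} \<longrightarrow> \<rho> p = fan (fst p / (g * (snd p)^2 / 2))"
proof -
  have c: "countable (\<rat> \<inter> {\<rho>m..\<rho>p})" by (intro countable_Int1 countable_rat)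
  have "AE p in lborel. \<forall>k\<in>\<rat> \<inter> {\<rho>m..\<rho>p}. snd p \<in> {0<..<T} \<and> fst p < F1 k * (g * (snd p)^2 / 2) \<longrightarrow> \<rho> p \<le> k"
    unfolding AE_ball_countable[OF c] using entropy_solution_one_sided[OF sol g, of _ 1] by auto
  moreover have "AE p in lborel. \<forall>k\<in>\<rat> \<inter> {\<rho>m..\<rho>p}. snd p \<in> {0<..<T} \<and> F1 k * (g * (snd p)^2 / 2) < fst p \<longrightarrow> k \<le> \<rho> p"
    unfolding AE_ball_countable[OF c] using entropy_solution_one_sided[OF sol g, of _ "- 1"] by auto
  ultimately show ?thesis
  proof eventually_elim
    case (elim p)
    show ?case
    proof
      assume t: "snd p \<in> {0<..<T}"
      then have \<tau>: "0 < g * (snd p)^2 / 2" using g by auto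
      show "\<rho> p = fan (fst p / (g * (snd p)^2 / 2))"
      proof (rule fan_eqI)
        show "\<rho> p \<in> {\<rho>m..\<rho>p}" using entropy_solution_range[OF sol t, of "fst p"] by simp
        show "\<rho> p \<le> k" if "k \<in> \<rat>" "k \<in> {\<rho>m..\<rho>p}" "fst p / (g * (snd p)^2 / 2) < F1 k" for k
          using elim(1) that t pos_divide_less_eq[OF \<tau>] by blast
        show "k \<le> \<rho> p" if "k \<in> \<rat>" "k \<in> {\<rho>m..\<rho>p}" "F1 k < fst p / (g * (snd p)^2 / 2)" for k
          using elim(2) that t pos_less_divide_eq[OF \<tau>] by blast
      qed
    qed
  qed
qed

end

section \<open>Integrals of a rarefaction fan\<close>

context convex_flux begin

text \<open>Inside the fan substitute \<open>x = \<tau> * F1 k\<close>, where the density is \<open>k\<close>; outside it is constant.\<close>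
lemma fan_integral:
  assumes \<tau>: "0 < \<tau>" and L: "- L \<le> \<tau> * F1 \<rho>m" "\<tau> * F1 \<rho>p \<le> L"
    and c: "continuous_on {\<rho>m..\<rho>p} c" and a: "continuous_on UNIV a"
  shows "((\<lambda>x. c (fan (x / \<tau>)) * a x) has_integral
    (c \<rho>m * integral {- L..\<tau> * F1 \<rho>m} a + integral {\<rho>m..\<rho>p} (\<lambda>k. \<tau> * (F2 k * (c k * a (\<tau> * F1 k))))
     + c \<rho>p * integral {\<tau> * F1 \<rho>p..L} a)) {- L..L}"
proof -
  let ?G = "\<lambda>x. c (fan (x / \<tau>)) * a x"
  have acont: "continuous_on S a" for S using a continuous_on_subset by blast
  have Gcont: "continuous_on S ?G" for S
    using \<tau> fan_in
    by (intro continuous_on_mult acont continuous_on_compose2[OF c] continuous_on_compose2[OF fan_cont])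
       (auto intro!: continuous_intros)
  have le: "\<tau> * F1 \<rho>m \<le> \<tau> * F1 \<rho>p" using F1_le \<tau> by simp
  have 1: "(?G has_integral c \<rho>m * integral {- L..\<tau> * F1 \<rho>m} a) {- L..\<tau> * F1 \<rho>m}"
  proof (rule has_integral_eq[rotated])
    show "((\<lambda>x. c \<rho>m * a x) has_integral c \<rho>m * integral {- L..\<tau> * F1 \<rho>m} a) {- L..\<tau> * F1 \<rho>m}"
      by (intro has_integral_mult_right integrable_integral integrable_continuous_interval acont)
    show "c \<rho>m * a x = ?G x" if "x \<in> {- L..\<tau> * F1 \<rho>m}" for x
      using that \<tau> by (subst fan_left) (auto simp: field_simps)
  qed
  have 3: "(?G has_integral c \<rho>p * integral {\<tau> * F1 \<rho>p..L} a) {\<tau> * F1 \<rho>p..L}"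
  proof (rule has_integral_eq[rotated])
    show "((\<lambda>x. c \<rho>p * a x) has_integral c \<rho>p * integral {\<tau> * F1 \<rho>p..L} a) {\<tau> * F1 \<rho>p..L}"
      by (intro has_integral_mult_right integrable_integral integrable_continuous_interval acont)
    show "c \<rho>p * a x = ?G x" if "x \<in> {\<tau> * F1 \<rho>p..L}" for x
      using that \<tau> by (subst fan_right) (auto simp: field_simps)
  qed
  have "((\<lambda>k. (\<tau> * F2 k) *\<^sub>R ?G (\<tau> * F1 k)) has_integral integral {\<tau> * F1 \<rho>m..\<tau> * F1 \<rho>p} ?G) {\<rho>m..\<rho>p}"
  proof (rule has_integral_substitution[where c = "\<tau> * F1 \<rho>m" and d = "\<tau> * F1 \<rho>p"])
    show "(\<lambda>k. \<tau> * F1 k) ` {\<rho>m..\<rho>p} \<subseteq> {\<tau> * F1 \<rho>m..\<tau> * F1 \<rho>p}"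
      using \<tau> F1_mono rho by auto
    show "((\<lambda>k. \<tau> * F1 k) has_real_derivative \<tau> * F2 k) (at k within {\<rho>m..\<rho>p})" if "k \<in> {\<rho>m..\<rho>p}" for k
      by (intro DERIV_cmult F2 that)
  qed (use rho le Gcont in auto)
  then have "integral {\<tau> * F1 \<rho>m..\<tau> * F1 \<rho>p} ?G = integral {\<rho>m..\<rho>p} (\<lambda>k. (\<tau> * F2 k) *\<^sub>R ?G (\<tau> * F1 k))"
    by (rule integral_unique[symmetric])
  also have "\<dots> = integral {\<rho>m..\<rho>p} (\<lambda>k. \<tau> * (F2 k * (c k * a (\<tau> * F1 k))))"
    by (rule integral_cong) (use \<tau> fan_F1 in auto)
  finally have 2: "(?G has_integral integral {\<rho>m..\<rho>p} (\<lambda>k. \<tau> * (F2 k * (c k * a (\<tau> * F1 k))))) {\<tau> * F1 \<rho>m..\<tau> * F1 \<rho>p}"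
    using integrable_integral[OF integrable_continuous_interval[OF Gcont]] by metis
  show ?thesis
    by (rule has_integral_combine[OF _ L(2) has_integral_combine[OF L(1) le 1 2] 3]) (use L le in auto)
qed

lemma fan_integral_parts:
  assumes \<tau>: "0 < \<tau>" and L: "- L \<le> \<tau> * F1 \<rho>m" "\<tau> * F1 \<rho>p \<le> L"
    and c: "\<And>r. r \<in> {\<rho>m..\<rho>p} \<Longrightarrow> (c has_real_derivative c1 r) (at r within {\<rho>m..\<rho>p})" "continuous_on {\<rho>m..\<rho>p} c1"
    and A: "\<And>x. (A has_real_derivative a x) (at x)" and a: "continuous_on UNIV a"
  shows "((\<lambda>x. c (fan (x / \<tau>)) * a x) has_integral
    (c \<rho>p * A L - c \<rho>m * A (- L) - integral {\<rho>m..\<rho>p} (\<lambda>k. c1 k * A (\<tau> * F1 k)))) {- L..L}"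
proof -
  have c_cont: "continuous_on {\<rho>m..\<rho>p} c" by (rule DERIV_continuous_on[OF c(1)])
  have A_cont: "continuous_on UNIV A" by (rule DERIV_continuous_on) (rule A)
  have AF: "continuous_on {\<rho>m..\<rho>p} (\<lambda>k. A (\<tau> * F1 k))" and aF: "continuous_on {\<rho>m..\<rho>p} (\<lambda>k. a (\<tau> * F1 k))"
    by (intro continuous_on_compose2[OF A_cont] continuous_on_compose2[OF a] continuous_intros F1_cont; simp)+
  have ia: "integral {x..y} a = A y - A x" if "x \<le> y" for x y
    using that by (intro integral_unique fundamental_theorem_of_calculus)
      (auto simp flip: has_real_derivative_iff_has_vector_derivative intro: DERIV_subset[OF A])
  have "((\<lambda>k. c1 k * A (\<tau> * F1 k) + (a (\<tau> * F1 k) * (\<tau> * F2 k)) * c k) has_integral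
      (c \<rho>p * A (\<tau> * F1 \<rho>p) - c \<rho>m * A (\<tau> * F1 \<rho>m))) {\<rho>m..\<rho>p}"
  proof (rule fundamental_theorem_of_calculus)
    fix k assume k: "k \<in> {\<rho>m..\<rho>p}"
    have "((\<lambda>k. A (\<tau> * F1 k)) has_real_derivative a (\<tau> * F1 k) * (\<tau> * F2 k)) (at k within {\<rho>m..\<rho>p})"
      by (rule DERIV_chain2[OF A DERIV_cmult[OF F2[OF k]]])
    from DERIV_mult[OF c(1)[OF k] this]
    show "((\<lambda>k. c k * A (\<tau> * F1 k)) has_vector_derivative c1 k * A (\<tau> * F1 k) + a (\<tau> * F1 k) * (\<tau> * F2 k) * c k) (at k within {\<rho>m..\<rho>p})"
      by (simp add: has_real_derivative_iff_has_vector_derivative)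
  qed (use rho in simp)
  then have "integral {\<rho>m..\<rho>p} (\<lambda>k. c1 k * A (\<tau> * F1 k) + (a (\<tau> * F1 k) * (\<tau> * F2 k)) * c k)
      = c \<rho>p * A (\<tau> * F1 \<rho>p) - c \<rho>m * A (\<tau> * F1 \<rho>m)"
    by (rule integral_unique)
  also have "integral {\<rho>m..\<rho>p} (\<lambda>k. c1 k * A (\<tau> * F1 k) + (a (\<tau> * F1 k) * (\<tau> * F2 k)) * c k)
     = integral {\<rho>m..\<rho>p} (\<lambda>k. c1 k * A (\<tau> * F1 k)) + integral {\<rho>m..\<rho>p} (\<lambda>k. (a (\<tau> * F1 k) * (\<tau> * F2 k)) * c k)"
    by (intro integral_add integrable_continuous_interval continuous_intros AF aF F2_cont c c_cont)
  also have "(\<lambda>k. (a (\<tau> * F1 k) * (\<tau> * F2 k)) * c k) = (\<lambda>k. \<tau> * (F2 k * (c k * a (\<tau> * F1 k))))"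
    by (auto simp: mult_ac)
  finally have *: "integral {\<rho>m..\<rho>p} (\<lambda>k. \<tau> * (F2 k * (c k * a (\<tau> * F1 k)))) =
     c \<rho>p * A (\<tau> * F1 \<rho>p) - c \<rho>m * A (\<tau> * F1 \<rho>m) - integral {\<rho>m..\<rho>p} (\<lambda>k. c1 k * A (\<tau> * F1 k))" by linarith
  show ?thesis
    by (rule has_integral_eq_rhs[OF fan_integral[OF \<tau> L c_cont a]])
       (simp only: * ia[OF L(1)] ia[OF L(2)] right_diff_distrib)
qed

text \<open>
  The integral of \<open>fan (x / \<tau>) * a x\<close> over \<open>{- L..L}\<close> for \<open>A\<close> an antiderivative of \<open>a\<close>. This form makes sense for
  \<open>\<tau> = 0\<close>, where it is the moment of the initial data, and it can be differentiated in \<open>\<tau>\<close>.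
\<close>
definition fan_moment :: "real \<Rightarrow> (real \<Rightarrow> real) \<Rightarrow> real \<Rightarrow> real" where
  "fan_moment L A \<tau> = \<rho>p * A L - \<rho>m * A (- L) - integral {\<rho>m..\<rho>p} (\<lambda>k. A (\<tau> * F1 k))"

lemma fan_moment_0: "fan_moment L A 0 = \<rho>p * A L - \<rho>m * A (- L) - (\<rho>p - \<rho>m) * A 0"
  using rho by (simp add: fan_moment_def)

lemma fan_has_moment:
  assumes "0 < \<tau>" "- L \<le> \<tau> * F1 \<rho>m" "\<tau> * F1 \<rho>p \<le> L"
    and "\<And>x. (A has_real_derivative a x) (at x)" "continuous_on UNIV a"
  shows "((\<lambda>x. fan (x / \<tau>) * a x) has_integral fan_moment L A \<tau>) {- L..L}"
  using fan_integral_parts[where c = "\<lambda>k. k" and ?c1.0 = "\<lambda>k. 1", OF assms(1-3) _ _ assms(4,5)]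
  by (simp add: fan_moment_def)

lemma fan_moment_deriv:
  assumes A: "\<And>x. (A has_real_derivative a x) (at x)" "continuous_on UNIV a"
  shows "((\<lambda>t. fan_moment L A (g * t^2 / 2)) has_real_derivative
     (- integral {\<rho>m..\<rho>p} (\<lambda>k. a (g * t^2 / 2 * F1 k) * (g * t * F1 k)))) (at t)"
proof -
  have A_cont: "continuous_on UNIV A" by (rule DERIV_continuous_on) (rule A)
  have "((\<lambda>t. integral (cbox \<rho>m \<rho>p) (\<lambda>k. A (g * t^2 / 2 * F1 k))) has_field_derivative
     integral (cbox \<rho>m \<rho>p) (\<lambda>k. a (g * t^2 / 2 * F1 k) * (g * t * F1 k))) (at t within UNIV)"
  proof (rule leibniz_rule_field_derivative[where U = UNIV])
    show "((\<lambda>t. A (g * t^2 / 2 * F1 k)) has_real_derivative a (g * t^2 / 2 * F1 k) * (g * t * F1 k)) (at t within UNIV)" for t k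
      by (rule DERIV_chain2[OF A(1)]) (auto intro!: derivative_eq_intros)
    show "(\<lambda>k. A (g * t^2 / 2 * F1 k)) integrable_on cbox \<rho>m \<rho>p" for t
      by (rule integrable_continuous)
         (auto intro!: continuous_on_compose2[OF A_cont] continuous_intros F1_cont)
    have F1s: "continuous_on (UNIV \<times> {\<rho>m..\<rho>p}) (\<lambda>p::real \<times> real. F1 (snd p))"
      by (rule continuous_on_compose2[OF F1_cont]) (auto intro!: continuous_intros)
    show "continuous_on (UNIV \<times> cbox \<rho>m \<rho>p) (\<lambda>(t, k). a (g * t^2 / 2 * F1 k) * (g * t * F1 k))"
      unfolding case_prod_beta
      by (intro continuous_on_mult continuous_on_compose2[OF A(2)])
         (auto intro!: continuous_intros F1s)
  qed auto
  then show ?thesis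
    unfolding fan_moment_def by (auto intro!: derivative_eq_intros)
qed

lemma fan_inside_strip:
  assumes \<tau>: "0 \<le> \<tau>" "\<tau> \<le> \<tau>'" and L: "- L \<le> \<tau>' * F1 \<rho>m" "\<tau>' * F1 \<rho>p \<le> L" "0 < L"
  shows "- L \<le> \<tau> * F1 \<rho>m" "\<tau> * F1 \<rho>p \<le> L"
proof -
  show "- L \<le> \<tau> * F1 \<rho>m"
  proof (cases "0 \<le> F1 \<rho>m")
    case True
    then have "0 \<le> \<tau> * F1 \<rho>m" using \<tau> by simp
    then show ?thesis using L by simp
  next
    case False
    then have "\<tau>' * F1 \<rho>m \<le> \<tau> * F1 \<rho>m" using \<tau> by (intro mult_right_mono_neg) auto
    then show ?thesis using L by simp
  qed
  show "\<tau> * F1 \<rho>p \<le> L"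
  proof (cases "0 \<le> F1 \<rho>p")
    case True
    then have "\<tau> * F1 \<rho>p \<le> \<tau>' * F1 \<rho>p" using \<tau> by (intro mult_right_mono) auto
    then show ?thesis using L by simp
  next
    case False
    then have "\<tau> * F1 \<rho>p \<le> 0" using \<tau> by (simp add: mult_nonneg_nonpos)
    then show ?thesis using L by simp
  qed
qed

text \<open>
  The conservation law for the fan, tested with \<open>a x * h t\<close>. There are no boundary terms, whatever the values of \<open>a\<close> at
  \<open>\<plusminus> L\<close>, because the fan stays inside the strip and \<open>F\<close> vanishes outside of it.
\<close>
lemma fan_mass_balance:
  assumes g: "0 < g" and T: "0 < T" and L: "- L \<le> g * T^2 / 2 * F1 \<rho>m" "g * T^2 / 2 * F1 \<rho>p \<le> L" "0 < L"
    and A: "\<And>x. (A has_real_derivative a x) (at x)"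
    and a: "\<And>x. (a has_real_derivative b x) (at x)" and b: "continuous_on UNIV b"
    and h: "\<And>t. (h has_real_derivative h1 t) (at t)" "h T = 0"
  shows "((\<lambda>t. h1 t * integral {- L..L} (\<lambda>x. fan (x / (g * t^2 / 2)) * a x)
      + h t * (g * t * integral {- L..L} (\<lambda>x. F (fan (x / (g * t^2 / 2))) * b x)))
      has_integral - h 0 * fan_moment L A 0) {0..T}"
proof -
  have a_cont: "continuous_on UNIV a" by (rule DERIV_continuous_on) (rule a)
  have h_cont: "continuous_on S h" for S by (rule DERIV_continuous_on, rule DERIV_subset[OF h(1)]) auto
  define m where "m t = fan_moment L A (g * t^2 / 2)" for t
  have m1: "(m has_real_derivative - integral {\<rho>m..\<rho>p} (\<lambda>k. a (g * t^2 / 2 * F1 k) * (g * t * F1 k))) (at t)" for t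
    unfolding m_def by (rule fan_moment_deriv[OF A a_cont])
  have m_cont: "continuous_on S m" for S by (rule DERIV_continuous_on, rule DERIV_subset[OF m1]) auto
  have "((\<lambda>t. h1 t * integral {- L..L} (\<lambda>x. fan (x / (g * t^2 / 2)) * a x)
      + h t * (g * t * integral {- L..L} (\<lambda>x. F (fan (x / (g * t^2 / 2))) * b x)))
      has_integral h T * m T - h 0 * m 0) {0..T}"
  proof (rule fundamental_theorem_of_calculus_interior)
    show "continuous_on {0..T} (\<lambda>t. h t * m t)" by (intro continuous_intros h_cont m_cont)
    fix t assume t: "t \<in> {0<..<T}"
    define \<tau> where "\<tau> = g * t^2 / 2"
    have \<tau>: "0 < \<tau>" "\<tau> \<le> g * T^2 / 2"
      using t g by (auto simp: \<tau>_def intro!: mult_left_mono power_mono)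
    note L' = fan_inside_strip[OF less_imp_le[OF \<tau>(1)] \<tau>(2) L]
    have 1: "integral {- L..L} (\<lambda>x. fan (x / \<tau>) * a x) = m t"
      unfolding m_def \<tau>_def[symmetric] by (rule integral_unique[OF fan_has_moment[OF \<tau>(1) L' A a_cont]])
    have 2: "integral {- L..L} (\<lambda>x. F (fan (x / \<tau>)) * b x) = - integral {\<rho>m..\<rho>p} (\<lambda>k. F1 k * a (\<tau> * F1 k))"
      using integral_unique[OF fan_integral_parts[OF \<tau>(1) L' F1 F1_cont a b]] by simp
    have "integral {\<rho>m..\<rho>p} (\<lambda>k. a (\<tau> * F1 k) * (g * t * F1 k)) = integral {\<rho>m..\<rho>p} (\<lambda>k. (g * t) * (F1 k * a (\<tau> * F1 k)))"
      by (intro integral_cong) simp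
    then have 3: "- integral {\<rho>m..\<rho>p} (\<lambda>k. a (\<tau> * F1 k) * (g * t * F1 k)) = g * t * integral {- L..L} (\<lambda>x. F (fan (x / \<tau>)) * b x)"
      unfolding 2 by simp
    have "((\<lambda>t. h t * m t) has_real_derivative h1 t * m t + (g * t * integral {- L..L} (\<lambda>x. F (fan (x / \<tau>)) * b x)) * h t) (at t)"
      using DERIV_mult[OF h(1) m1[of t]] unfolding \<tau>_def[symmetric] 3 .
    then show "((\<lambda>t. h t * m t) has_vector_derivative h1 t * integral {- L..L} (\<lambda>x. fan (x / (g * t^2 / 2)) * a x)
      + h t * (g * t * integral {- L..L} (\<lambda>x. F (fan (x / (g * t^2 / 2))) * b x))) (at t)"
      unfolding \<tau>_def[symmetric] 1 by (simp add: has_real_derivative_iff_has_vector_derivative mult.commute)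
  qed (use T in simp)
  then show ?thesis by (simp add: h m_def)
qed

end

section \<open>Integration over a period cell\<close>
lemma at_height_eq: "at_height d s y = y + (s - y $ d) *\<^sub>R axis d 1"
  by (auto simp: at_height_def vec_eq_iff axis_def)

lemma at_height_nth [simp]: "at_height d s y $ d = s"
  by (simp add: at_height_def)

lemma at_height_in_cell [simp]: "y \<in> unit_cube \<Longrightarrow> at_height d s y \<in> cell d"
  by (auto simp: at_height_def cell_def unit_cube_def)

lemma sets_cell [measurable]: "cell (d::'n::finite) \<in> sets borel"
proof -
  have "cell d = (\<Inter>j\<in>UNIV - {d}. {y. 0 \<le> y $ j} \<inter> {y. y $ j < 1})"
    by (auto simp: cell_def)
  also have "\<dots> \<in> sets borel"
    by (cases "UNIV - {d} = {}")
      (auto simp del: Diff_eq_empty_iff intro!: sets.finite_INT borel_closed borel_open closed_halfspace_component_ge_cart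
        open_halfspace_component_lt_cart sets.Int)
  finally show ?thesis .
qed

lemma sets_unit_cube [measurable]: "(unit_cube :: (real^'n::finite) set) \<in> sets borel"
proof -
  have "unit_cube = (\<Inter>j\<in>(UNIV::'n set). {y. 0 \<le> y $ j} \<inter> {y. y $ j < 1})"
    by (auto simp: unit_cube_def)
  also have "\<dots> \<in> sets borel"
    by (auto intro!: sets.finite_INT borel_closed borel_open closed_halfspace_component_ge_cart
        open_halfspace_component_lt_cart)
  finally show ?thesis .
qed

lemma emeasure_unit_cube [simp]: "emeasure lborel (unit_cube :: (real^'n::finite) set) = 1"
proof -
  let ?o = "(\<chi> i. 1) :: real^'n"
  have o: "?o \<bullet> b = 1" if "b \<in> Basis" for b
    using that by (auto simp: Basis_vec_def inner_axis)
  have "box 0 ?o \<subseteq> unit_cube" "unit_cube \<subseteq> cbox 0 ?o"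
    by (auto simp: unit_cube_def mem_box_cart less_imp_le)
  then have "emeasure lborel (box 0 ?o) \<le> emeasure lborel (unit_cube :: (real^'n) set)"
    "emeasure lborel (unit_cube :: (real^'n) set) \<le> emeasure lborel (cbox 0 ?o)"
    by (auto intro!: emeasure_mono)
  moreover have "emeasure lborel (box 0 ?o) = 1" "emeasure lborel (cbox 0 ?o) = 1"
    by (simp_all add: emeasure_lborel_box emeasure_lborel_cbox o)
  ultimately show ?thesis by simp
qed

text \<open>
  Fubini for the vertical coordinate without splitting off a type of lower dimension: \<open>at_height d s y\<close> is a translate of \<open>y\<close>
  along the axis \<open>d\<close>. Shifting both integrations moves the shift to the indicator of the cube, and its integral over
  all shifts is the indicator of the cell.
\<close>
lemma nn_integral_cell:
  fixes f :: "real^'n::finite \<Rightarrow> ennreal"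
  assumes f [measurable]: "f \<in> borel_measurable borel"
  shows "(\<integral>\<^sup>+y. indicator (cell d) y * f y \<partial>lborel) =
    (\<integral>\<^sup>+y. indicator unit_cube y * (\<integral>\<^sup>+s. f (at_height d (s + c) y) \<partial>lborel) \<partial>lborel)"
proof -
  let ?e = "axis d 1 :: real^'n"
  have m [measurable]: "(\<lambda>p. f (fst p + snd p *\<^sub>R ?e)) \<in> borel_measurable (borel \<Otimes>\<^sub>M borel)"
    by measurable
  have inner: "(\<integral>\<^sup>+s. f (at_height d (s + c) y) \<partial>lborel) = (\<integral>\<^sup>+s. f (y + s *\<^sub>R ?e) \<partial>lborel)" for y
  proof -
    have "(\<integral>\<^sup>+s. f (y + s *\<^sub>R ?e) \<partial>lborel) = (\<integral>\<^sup>+s. f (y + ((c - y $ d) + 1 * s) *\<^sub>R ?e) \<partial>lborel)"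
      using nn_integral_real_affine[of "\<lambda>s. f (y + s *\<^sub>R ?e)" 1 "c - y $ d"] by simp
    then show ?thesis by (simp add: at_height_eq add.commute add_diff_eq)
  qed
  have "(\<integral>\<^sup>+y. indicator unit_cube y * (\<integral>\<^sup>+s. f (at_height d (s + c) y) \<partial>lborel) \<partial>lborel)
     = (\<integral>\<^sup>+y. (\<integral>\<^sup>+s. indicator unit_cube y * f (y + s *\<^sub>R ?e) \<partial>lborel) \<partial>lborel)"
    unfolding inner by (intro nn_integral_cong) (simp add: nn_integral_cmult)
  also have "\<dots> = (\<integral>\<^sup>+s. (\<integral>\<^sup>+y. indicator unit_cube y * f (y + s *\<^sub>R ?e) \<partial>lborel) \<partial>lborel)"
    by (rule lborel_pair.Fubini') measurable
  also have "\<dots> = (\<integral>\<^sup>+s. (\<integral>\<^sup>+y. indicator unit_cube (y - s *\<^sub>R ?e) * f y \<partial>lborel) \<partial>lborel)"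
  proof (rule nn_integral_cong)
    fix s :: real
    have "(\<integral>\<^sup>+y. indicator unit_cube (y - s *\<^sub>R ?e) * f y \<partial>lborel)
      = (\<integral>\<^sup>+y. indicator unit_cube (y - s *\<^sub>R ?e) * f y \<partial>distr lborel borel ((+) (s *\<^sub>R ?e)))"
      by (simp add: lborel_distr_plus)
    also have "\<dots> = (\<integral>\<^sup>+y. indicator unit_cube y * f (y + s *\<^sub>R ?e) \<partial>lborel)"
      by (subst nn_integral_distr) (auto simp: add.commute)
    finally show "(\<integral>\<^sup>+y. indicator unit_cube y * f (y + s *\<^sub>R ?e) \<partial>lborel) = (\<integral>\<^sup>+y. indicator unit_cube (y - s *\<^sub>R ?e) * f y \<partial>lborel)" ..
  qed
  also have "\<dots> = (\<integral>\<^sup>+y. (\<integral>\<^sup>+s. indicator unit_cube (y - s *\<^sub>R ?e) * f y \<partial>lborel) \<partial>lborel)"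
    by (rule lborel_pair.Fubini'[symmetric]) measurable
  also have "\<dots> = (\<integral>\<^sup>+y. indicator (cell d) y * f y \<partial>lborel)"
  proof (rule nn_integral_cong)
    fix y :: "real^'n"
    have "indicator unit_cube (y - s *\<^sub>R ?e) = (indicator (cell d) y * indicator {y $ d - 1<..y $ d} s :: ennreal)" for s
      by (auto simp: unit_cube_def cell_def axis_def indicator_def)
    then have "(\<integral>\<^sup>+s. indicator unit_cube (y - s *\<^sub>R ?e) * f y \<partial>lborel) =
      (\<integral>\<^sup>+s. (indicator (cell d) y * f y) * indicator {y $ d - 1<..y $ d} s \<partial>lborel)"
      by (intro nn_integral_cong) (simp add: mult_ac)
    also have "\<dots> = indicator (cell d) y * f y" by (simp add: nn_integral_cmult)
    finally show "(\<integral>\<^sup>+s. indicator unit_cube (y - s *\<^sub>R ?e) * f y \<partial>lborel) = indicator (cell d) y * f y" .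
  qed
  finally show ?thesis ..
qed

text \<open>
  The projection to the moving frame, and its section through \<open>y\<close>. The latter restricts a function of all
  variables to a single vertical line of the torus.
\<close>
definition to_strip :: "real \<Rightarrow> 'n \<Rightarrow> (real^'n::finite) \<times> real \<Rightarrow> real \<times> real" where
  "to_strip g d p = (fst p $ d - g * (snd p)^2 / 2, snd p)"

definition lift_strip :: "real \<Rightarrow> 'n \<Rightarrow> real^'n::finite \<Rightarrow> real \<times> real \<Rightarrow> (real^'n) \<times> real" where
  "lift_strip g d y q = (at_height d (fst q + g * (snd q)^2 / 2) y, snd q)"

lemma to_strip_lift_strip [simp]: "to_strip g d (lift_strip g d y q) = q"
  by (simp add: to_strip_def lift_strip_def)

lemma measurable_to_strip [measurable]: "to_strip g d \<in> borel_measurable borel"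
  unfolding to_strip_def by (rule borel_measurable_continuous_onI) (intro continuous_intros; simp)

lemma measurable_lift_strip2: "(\<lambda>(y, q). lift_strip g d y q) \<in> borel_measurable borel"
  unfolding lift_strip_def at_height_eq case_prod_beta
  by (rule borel_measurable_continuous_onI) (intro continuous_intros; simp)

lemma measurable_lift_strip [measurable]: "lift_strip g d y \<in> borel_measurable borel"
  unfolding lift_strip_def[abs_def] at_height_eq
  by (rule borel_measurable_continuous_onI) (intro continuous_intros; simp)

lemma nn_integral_cell_time:
  fixes f :: "(real^'n::finite) \<times> real \<Rightarrow> ennreal"
  assumes f [measurable]: "f \<in> borel_measurable borel"
  shows "(\<integral>\<^sup>+p. indicator (cell d \<times> UNIV) p * f p \<partial>lborel) =
    (\<integral>\<^sup>+y. indicator unit_cube y * (\<integral>\<^sup>+q. f (lift_strip g d y q) \<partial>lborel) \<partial>lborel)"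
proof -
  have [measurable]: "f \<in> borel_measurable (borel \<Otimes>\<^sub>M borel)" using f by (simp add: borel_prod)
  have [measurable]: "cell d \<times> (UNIV :: real set) \<in> sets (borel \<Otimes>\<^sub>M borel)" by measurable
  have m [measurable]: "(\<lambda>p. f (lift_strip g d (fst p) (snd p))) \<in> borel_measurable borel"
    using measurable_compose[OF measurable_lift_strip2 f] by (simp add: case_prod_beta)
  have "(\<lambda>x :: ((real^'n) \<times> real) \<times> real. lift_strip g d (fst (fst x)) (snd x, snd (fst x))) \<in> borel_measurable borel"
    unfolding lift_strip_def at_height_eq
    by (rule borel_measurable_continuous_onI) (intro continuous_intros; simp)
  then have [measurable]: "(\<lambda>x :: ((real^'n) \<times> real) \<times> real. lift_strip g d (fst (fst x)) (snd x, snd (fst x)))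
      \<in> borel_measurable ((borel \<Otimes>\<^sub>M borel) \<Otimes>\<^sub>M borel)" by (simp add: borel_prod)
  have "(\<lambda>x :: (real \<times> (real^'n)) \<times> real. lift_strip g d (snd (fst x)) (snd x, fst (fst x))) \<in> borel_measurable borel"
    unfolding lift_strip_def at_height_eq
    by (rule borel_measurable_continuous_onI) (intro continuous_intros; simp)
  then have [measurable]: "(\<lambda>x :: (real \<times> (real^'n)) \<times> real. lift_strip g d (snd (fst x)) (snd x, fst (fst x)))
      \<in> borel_measurable ((borel \<Otimes>\<^sub>M borel) \<Otimes>\<^sub>M borel)" by (simp add: borel_prod)
  have "(\<integral>\<^sup>+p. indicator (cell d \<times> UNIV) p * f p \<partial>lborel) =
     (\<integral>\<^sup>+t. (\<integral>\<^sup>+y. indicator (cell d \<times> UNIV) (y, t) * f (y, t) \<partial>lborel) \<partial>lborel)"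
    unfolding lborel_prod[symmetric] by (rule lborel_pair.nn_integral_snd[symmetric]) measurable
  also have "\<dots> = (\<integral>\<^sup>+t. (\<integral>\<^sup>+y. indicator (cell d) y * f (y, t) \<partial>lborel) \<partial>lborel)"
    by (intro nn_integral_cong) (simp add: indicator_def)
  also have "\<dots> = (\<integral>\<^sup>+t. (\<integral>\<^sup>+y. indicator unit_cube y * (\<integral>\<^sup>+s. f (lift_strip g d y (s, t)) \<partial>lborel) \<partial>lborel) \<partial>lborel)"
  proof (rule nn_integral_cong)
    fix t :: real
    have [measurable]: "(\<lambda>y. f (y, t)) \<in> borel_measurable borel" by measurable
    show "(\<integral>\<^sup>+y. indicator (cell d) y * f (y, t) \<partial>lborel) =
      (\<integral>\<^sup>+y. indicator unit_cube y * (\<integral>\<^sup>+s. f (lift_strip g d y (s, t)) \<partial>lborel) \<partial>lborel)"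
      using nn_integral_cell[of "\<lambda>y. f (y, t)" d "g * t^2 / 2"] by (simp add: lift_strip_def)
  qed
  also have "\<dots> = (\<integral>\<^sup>+y. (\<integral>\<^sup>+t. indicator unit_cube y * (\<integral>\<^sup>+s. f (lift_strip g d y (s, t)) \<partial>lborel) \<partial>lborel) \<partial>lborel)"
    by (rule lborel_pair.Fubini') measurable
  also have "\<dots> = (\<integral>\<^sup>+y. indicator unit_cube y * (\<integral>\<^sup>+t. (\<integral>\<^sup>+s. f (lift_strip g d y (s, t)) \<partial>lborel) \<partial>lborel) \<partial>lborel)"
    by (intro nn_integral_cong nn_integral_cmult) measurable
  also have "\<dots> = (\<integral>\<^sup>+y. indicator unit_cube y * (\<integral>\<^sup>+q. f (lift_strip g d y q) \<partial>lborel) \<partial>lborel)"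
  proof (intro nn_integral_cong arg_cong2[where f = "(*)"] refl)
    fix y
    have [measurable]: "(\<lambda>q. f (lift_strip g d y q)) \<in> borel_measurable (borel \<Otimes>\<^sub>M borel)"
      unfolding borel_prod by measurable
    show "(\<integral>\<^sup>+t. (\<integral>\<^sup>+s. f (lift_strip g d y (s, t)) \<partial>lborel) \<partial>lborel) = (\<integral>\<^sup>+q. f (lift_strip g d y q) \<partial>lborel)"
      unfolding lborel_prod[symmetric] by (rule lborel_pair.nn_integral_snd) measurable
  qed
  finally show ?thesis .
qed

text \<open>A period of the torus has area one, so integrals of functions of height and time do not see the horizontal variables.\<close>
lemma distr_to_strip:
  fixes d :: "'n::finite"
  shows "distr (density lborel (indicator (cell d \<times> UNIV))) borel (to_strip g d) = (lborel :: (real \<times> real) measure)"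
proof (rule measure_eqI)
  fix A :: "(real \<times> real) set"
  assume "A \<in> sets (distr (density lborel (indicator (cell d \<times> UNIV))) borel (to_strip g d))"
  then have A [measurable]: "A \<in> sets borel" by simp
  have c [measurable]: "(cell d \<times> UNIV :: ((real^'n) \<times> real) set) \<in> sets borel"
    unfolding borel_prod[symmetric] by measurable
  have V [measurable]: "to_strip g d -` A \<in> sets borel"
    using measurable_sets[OF measurable_to_strip A] by simp
  have "emeasure (distr (density lborel (indicator (cell d \<times> UNIV))) borel (to_strip g d)) A
     = (\<integral>\<^sup>+p. indicator (cell d \<times> UNIV) p * indicator A (to_strip g d p) \<partial>lborel)"
    by (simp add: emeasure_distr emeasure_density) (simp add: indicator_vimage)
  also have "\<dots> = (\<integral>\<^sup>+y. indicator unit_cube (y::real^'n) * emeasure lborel A \<partial>lborel)"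
    by (subst nn_integral_cell_time[where g = g]) simp_all
  also have "\<dots> = emeasure lborel A" by (simp add: nn_integral_multc)
  finally show "emeasure (distr (density lborel (indicator (cell d \<times> UNIV :: ((real^'n) \<times> real) set))) borel (to_strip g d)) A = emeasure lborel A" .
qed simp

lemma distr_slice:
  fixes d :: "'n::finite"
  shows "distr (density lborel (indicator (cell d))) borel (\<lambda>y::real^'n. y $ d - c) = (lborel :: real measure)"
proof (rule measure_eqI)
  fix A :: "real set"
  assume "A \<in> sets (distr (density lborel (indicator (cell d))) borel (\<lambda>y::real^'n. y $ d - c))"
  then have A [measurable]: "A \<in> sets borel" by simp
  have V [measurable]: "(\<lambda>y::real^'n. y $ d - c) -` A \<in> sets borel"
    using measurable_sets[OF _ A, of "\<lambda>y::real^'n. y $ d - c" borel] by simp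
  have "emeasure (distr (density lborel (indicator (cell d))) borel (\<lambda>y::real^'n. y $ d - c)) A
     = (\<integral>\<^sup>+y. indicator (cell d) y * indicator A (y $ d - c) \<partial>lborel)"
    by (simp add: emeasure_distr emeasure_density) (simp add: indicator_vimage)
  also have "\<dots> = (\<integral>\<^sup>+y. indicator unit_cube (y::real^'n) * emeasure lborel A \<partial>lborel)"
    by (subst nn_integral_cell[where c = c]) simp_all
  also have "\<dots> = emeasure lborel A" by (simp add: nn_integral_multc)
  finally show "emeasure (distr (density lborel (indicator (cell d))) borel (\<lambda>y::real^'n. y $ d - c)) A = emeasure lborel A" .
qed simp

text \<open>
  The property \<open>P\<close> is arbitrary because it will involve the profile of a one-dimensional state, which is only
  characterised by an almost everywhere identity; hence the detour through a Borel null set.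
\<close>
lemma AE_lift_strip:
  assumes "AE p in lborel. fst p \<in> cell d \<longrightarrow> P p"
  shows "AE y in lborel. y \<in> unit_cube \<longrightarrow> (AE q in lborel. P (lift_strip g d (y::real^'n::finite) q))"
proof -
  obtain N where N: "{p. \<not> (fst p \<in> cell d \<longrightarrow> P p)} \<subseteq> N" "N \<in> sets borel" "emeasure lborel N = 0"
    using assms by (auto elim!: AE_E)
  note N(2) [measurable]
  have "(\<integral>\<^sup>+y. indicator unit_cube y * (\<integral>\<^sup>+q. indicator N (lift_strip g d y q) \<partial>lborel) \<partial>lborel)
     = (\<integral>\<^sup>+p. indicator (cell d \<times> UNIV) p * indicator N p \<partial>lborel)"
    by (rule nn_integral_cell_time[symmetric]) measurable
  also have "\<dots> \<le> (\<integral>\<^sup>+p. indicator N p \<partial>lborel)"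
    by (intro nn_integral_mono) (simp add: indicator_def)
  also have "\<dots> = 0" using N by simp
  finally have 0: "(\<integral>\<^sup>+y. indicator unit_cube y * (\<integral>\<^sup>+q. indicator N (lift_strip g d y q) \<partial>lborel) \<partial>lborel) = 0" by simp
  have "(\<lambda>p. indicator N (lift_strip g d (fst p) (snd p)) :: ennreal) \<in> borel_measurable borel"
    using measurable_compose[OF measurable_lift_strip2 borel_measurable_indicator[OF N(2)]] by (simp add: case_prod_beta)
  then have [measurable]: "(\<lambda>p. indicator N (lift_strip g d (fst p) (snd p)) :: ennreal) \<in> borel_measurable (borel \<Otimes>\<^sub>M borel)"
    by (simp add: borel_prod)
  have "(\<lambda>y. indicator unit_cube y * (\<integral>\<^sup>+q. indicator N (lift_strip g d y q) \<partial>lborel) :: ennreal) \<in> borel_measurable lborel"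
    by measurable
  then have "AE y in lborel. indicator unit_cube y * (\<integral>\<^sup>+q. indicator N (lift_strip g d y q) \<partial>lborel) = (0 :: ennreal)"
    using 0 nn_integral_0_iff_AE by blast
  then show ?thesis
  proof eventually_elim
    case (elim y)
    show ?case
    proof
      assume y: "y \<in> unit_cube"
      then have "(\<integral>\<^sup>+q. indicator N (lift_strip g d y q) \<partial>lborel) = (0 :: ennreal)" using elim by simp
      then have "AE q in lborel. indicator N (lift_strip g d y q) = (0 :: ennreal)"
        by (subst (asm) nn_integral_0_iff_AE) auto
      then show "AE q in lborel. P (lift_strip g d y q)"
      proof eventually_elim
        case (elim q)
        then have "lift_strip g d y q \<notin> N" by (simp add: indicator_def split: if_splits)
        moreover have "fst (lift_strip g d y q) \<in> cell d" using y by (simp add: lift_strip_def)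
        ultimately show ?case using N(1) by blast
      qed
    qed
  qed
qed

lemma AE_to_strip:
  fixes d :: "'n::finite"
  assumes "AE q in lborel. P q"
  shows "AE p in lborel. fst p \<in> cell d \<longrightarrow> P (to_strip g d p)"
proof -
  have c [measurable]: "(cell d \<times> UNIV :: ((real^'n) \<times> real) set) \<in> sets borel"
    unfolding borel_prod[symmetric] by measurable
  have "AE q in distr (density lborel (indicator (cell d \<times> UNIV))) borel (to_strip g d). P q"
    by (subst distr_to_strip) (rule assms)
  then have "AE p in density lborel (indicator (cell d \<times> UNIV)). P (to_strip g d p)"
    by (rule AE_distrD[rotated]) simp
  then have "AE p in lborel. 0 < (indicator (cell d \<times> UNIV) p :: ennreal) \<longrightarrow> P (to_strip g d p)"
    by (subst (asm) AE_density) simp_all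
  then show ?thesis by eventually_elim (auto simp: indicator_def)
qed

lemma integral_to_strip:
  fixes d :: "'n::finite" and f :: "real \<times> real \<Rightarrow> real"
  assumes f [measurable]: "f \<in> borel_measurable borel"
  shows "(LINT p|lborel. indicator (cell d \<times> UNIV) p * f (to_strip g d p)) = (LINT q|lborel. f q)"
proof -
  have c [measurable]: "(cell d \<times> UNIV :: ((real^'n) \<times> real) set) \<in> sets borel"
    unfolding borel_prod[symmetric] by measurable
  have d: "density lborel (indicator (cell d \<times> UNIV)) = density lborel (\<lambda>p. ennreal (indicator (cell d \<times> UNIV) p))"
    by (simp add: ennreal_indicator)
  have m: "(\<lambda>p. f (to_strip g d p)) \<in> borel_measurable lborel"
    using measurable_compose[OF measurable_to_strip f] by simp
  have "(LINT q|lborel. f q) = (LINT q|distr (density lborel (indicator (cell d \<times> UNIV))) borel (to_strip g d). f q)"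
    by (simp add: distr_to_strip)
  also have "\<dots> = (LINT p|density lborel (indicator (cell d \<times> UNIV)). f (to_strip g d p))"
    by (rule integral_distr) simp_all
  also have "\<dots> = (LINT p|lborel. indicator (cell d \<times> UNIV) p * f (to_strip g d p))"
    unfolding d by (subst integral_density) (use m in simp_all)
  finally show ?thesis ..
qed

lemma integral_slice:
  fixes d :: "'n::finite" and f :: "real \<Rightarrow> real"
  assumes f [measurable]: "f \<in> borel_measurable borel"
  shows "(LINT y|lborel. indicator (cell d) y * f (y $ d - c)) = (LINT x|lborel. f x)"
proof -
  have d: "density lborel (indicator (cell d)) = density lborel (\<lambda>p. ennreal (indicator (cell d) p))"
    by (simp add: ennreal_indicator)
  have "(LINT q|lborel. f q) = (LINT q|distr (density lborel (indicator (cell d))) borel (\<lambda>y. y $ d - c). f q)"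
    by (simp add: distr_slice)
  also have "\<dots> = (LINT p|density lborel (indicator (cell d)). f (p $ d - c))"
    by (rule integral_distr) simp_all
  also have "\<dots> = (LINT p|lborel. indicator (cell d) p * f (p $ d - c))"
    unfolding d by (subst integral_density) simp_all
  finally show ?thesis ..
qed

section \<open>The hull inequality for one-dimensional states\<close>
lemma lambda_max_scaled_identity:
  "lambda_max (c *\<^sub>R mat 1 :: real^'n::finite^'n) = c"
proof -
  have "{l. \<exists>v. v \<noteq> 0 \<and> (c *\<^sub>R mat 1 :: real^'n^'n) *v v = l *\<^sub>R v} = {c}"
  proof -
    have "(c *\<^sub>R mat 1 :: real^'n^'n) *v v = c *\<^sub>R v" for v
      by (simp add: scaleR_matrix_vector_assoc[symmetric])
    moreover have "\<exists>v::real^'n. v \<noteq> 0"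
      by (rule exI[of _ "axis undefined 1"]) (simp add: axis_eq_0_iff)
    ultimately show ?thesis by auto
  qed
  then show ?thesis by (simp add: lambda_max_def)
qed

lemma sigma_1d_nth:
  fixes d :: "'n::finite"
  assumes "CARD('n) \<in> {2, 3}"
  shows "sigma_1d d f $ i $ j = (if i \<noteq> j then 0 else if i = d then f - f / real CARD('n) else - f / real CARD('n))"
  using assms by (auto simp: sigma_1d_def)

text \<open>
  The quadratic part has \<open>f\<close> as its only entry, in the vertical direction, and the prescribed \<open>\<sigma>\<close> is exactly its
  traceless part. Only the mean value \<open>f / n\<close> remains.
\<close>
lemma M_tilde_1d:
  fixes d :: "'n::finite" and w m h :: "real^'n"
  assumes n: "CARD('n) \<in> {2, 3}" and w: "w = c *\<^sub>R axis d 1" and m: "\<And>j. j \<noteq> d \<Longrightarrow> m $ j = 0"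
    and f: "f = (\<mu> * \<rho>m * \<rho>p * c^2 - 2 * \<rho>m * \<rho>p * m $ d * c + (\<rho>p + \<rho>m - \<mu>) * (m $ d)^2) / ((\<rho>p - \<mu>) * (\<mu> - \<rho>m))"
  shows "M_tilde \<rho>m \<rho>p (\<mu>, w, m, h, sigma_1d d f, e) = (f / real CARD('n)) *\<^sub>R mat 1"
proof -
  have "M_tilde \<rho>m \<rho>p (\<mu>, w, m, h, sigma_1d d f, e) $ i $ j = ((f / real CARD('n)) *\<^sub>R mat 1) $ i $ j" for i j
  proof (cases "i = d \<and> j = d")
    case True
    have "M_tilde \<rho>m \<rho>p (\<mu>, w, m, h, sigma_1d d f, e) $ d $ d =
      (1 / ((\<rho>p - \<mu>) * (\<mu> - \<rho>m))) * (\<mu> * \<rho>m * \<rho>p * (c * c) - \<rho>m * \<rho>p * (m $ d * c + c * m $ d) + (\<rho>p + \<rho>m - \<mu>) * (m $ d * m $ d)) - (f - f / real CARD('n))"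
      by (simp add: M_tilde_def outer_prod_def w axis_def sigma_1d_nth[OF n])
    also have "\<mu> * \<rho>m * \<rho>p * (c * c) - \<rho>m * \<rho>p * (m $ d * c + c * m $ d) + (\<rho>p + \<rho>m - \<mu>) * (m $ d * m $ d)
       = \<mu> * \<rho>m * \<rho>p * c^2 - 2 * \<rho>m * \<rho>p * m $ d * c + (\<rho>p + \<rho>m - \<mu>) * (m $ d)^2"
      by (simp add: power2_eq_square algebra_simps)
    also have "1 / ((\<rho>p - \<mu>) * (\<mu> - \<rho>m)) * \<dots> = f" by (simp add: f)
    finally show ?thesis using True by (simp add: mat_def)
  next
    case False
    then have "w $ i * w $ j = 0" "m $ i * w $ j = 0" "w $ i * m $ j = 0" "m $ i * m $ j = 0"
      using m[of i] m[of j] by (auto simp: w axis_def)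
    then show ?thesis using False
      by (auto simp: M_tilde_def outer_prod_def sigma_1d_nth[OF n] mat_def)
  qed
  then show ?thesis by (simp add: vec_eq_iff)
qed

text \<open>Half of \<^const>\<open>f_1d\<close> as a function of the velocity \<open>c = g t\<close>, the density and the vertical momentum.\<close>
definition energy_1d :: "real \<Rightarrow> real \<Rightarrow> real \<Rightarrow> real \<Rightarrow> real \<Rightarrow> real" where
  "energy_1d \<rho>m \<rho>p c \<mu> m = (if \<mu> \<in> {\<rho>m, \<rho>p} then \<mu> * c^2 else
     (\<mu> * \<rho>m * \<rho>p * c^2 - 2 * \<rho>m * \<rho>p * m * c + (\<rho>p + \<rho>m - \<mu>) * m^2) / ((\<rho>p - \<mu>) * (\<mu> - \<rho>m))) / 2"

lemma f_1d_energy: "f_1d g \<rho>m \<rho>p d Z t = 2 * energy_1d \<rho>m \<rho>p (g * t) (z_mu Z) (z_m Z $ d)"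
  by (simp add: f_1d_def energy_1d_def Let_def power_mult_distrib mult.assoc)

text \<open>The choice of the momentum is dictated by mass conservation; the identity explains the weight.\<close>
lemma (in convex_flux) energy_1d_fan:
  assumes "\<mu> \<in> {\<rho>m..\<rho>p}"
  shows "energy_1d \<rho>m \<rho>p c \<mu> (c * (\<mu> + F \<mu>)) - c * (\<mu> + F \<mu>) * c = c^2 / 2 * (weight \<mu> * (F \<mu>)^2 - \<mu>)"
proof (cases "\<mu> \<in> {\<rho>m, \<rho>p}")
  case True
  then have "F \<mu> = 0" "weight \<mu> = 0" by (auto simp: weight_def)
  then show ?thesis using True by (simp add: energy_1d_def power2_eq_square)
next
  case False
  then have P: "(\<rho>p - \<mu>) * (\<mu> - \<rho>m) \<noteq> 0" using assms by auto
  define P where "P = (\<rho>p - \<mu>) * (\<mu> - \<rho>m)"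
  define f where "f = F \<mu>"
  have "energy_1d \<rho>m \<rho>p c \<mu> (c * (\<mu> + f)) =
    (\<mu> * \<rho>m * \<rho>p * c^2 - 2 * \<rho>m * \<rho>p * (c * (\<mu> + f)) * c + (\<rho>p + \<rho>m - \<mu>) * (c * (\<mu> + f))^2) / P / 2"
    using False by (simp add: energy_1d_def P_def)
  also have "\<mu> * \<rho>m * \<rho>p * c^2 - 2 * \<rho>m * \<rho>p * (c * (\<mu> + f)) * c + (\<rho>p + \<rho>m - \<mu>) * (c * (\<mu> + f))^2
     = c^2 * (P * (\<mu> + 2 * f) + (\<rho>p + \<rho>m - \<mu>) * f^2)"
    by (simp add: P_def power2_eq_square algebra_simps)
  also have "\<dots> / P / 2 = c^2 / 2 * (\<mu> + 2 * f + (\<rho>p + \<rho>m - \<mu>) / P * f^2)"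
    using P unfolding P_def[symmetric] by (simp add: field_simps)
  finally show ?thesis
    unfolding f_def[symmetric] weight_def P_def[symmetric] by (simp add: power2_eq_square algebra_simps)
qed

text \<open>Trace of the constitutive relation \<open>\<mu> w \<otimes> w = \<sigma> + 2 / n * e * id\<close>.\<close>
lemma mixing_zone_complement_energy:
  fixes d :: "'n::finite"
  assumes n: "CARD('n) \<in> {2, 3}"
    and ws: "weak_solution g L T \<rho>m \<rho>p d z q \<nu>" and od: "one_dimensional g L T \<rho>m \<rho>p d z q \<nu>"
    and mz: "mixing_zone g L T \<rho>m \<rho>p d z q U"
  shows "AE p in lborel. p \<in> dom g L T d - U \<longrightarrow>
     z_e (z p) = energy_1d \<rho>m \<rho>p (g * snd p) (z_mu (z p)) (z_m (z p) $ d)"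
proof -
  have 1: "AE p in lborel. p \<in> dom g L T d \<longrightarrow> transpose (z_sigma (z p)) = z_sigma (z p) \<and> trace (z_sigma (z p)) = 0"
    using ws unfolding weak_solution_def by (elim conjE)
  have 2: "AE p in lborel. p \<in> dom g L T d - U \<longrightarrow>
        z_m (z p) = z_mu (z p) *\<^sub>R z_w (z p) \<and>
        z_h (z p) = (z_e (z p) + q p) *\<^sub>R z_w (z p) \<and>
        z_mu (z p) *\<^sub>R outer_prod (z_w (z p)) (z_w (z p)) =
          z_sigma (z p) + (2 / real CARD('n) * z_e (z p)) *\<^sub>R mat 1 \<and>
        z_mu (z p) \<in> {\<rho>m, \<rho>p}"
    using mz unfolding mixing_zone_def by (elim conjE)
  have "AE (y, t) in lborel. (y, t) \<in> dom g L T d \<longrightarrow>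
        z_w (z (y, t)) = (g * t) *\<^sub>R axis d 1 \<and>
        (\<forall>j. j \<noteq> d \<longrightarrow> z_m (z (y, t)) $ j = 0 \<and> z_h (z (y, t)) $ j = 0) \<and>
        z_sigma (z (y, t)) = sigma_1d d (f_1d g \<rho>m \<rho>p d (z (y, t)) t)"
    using od unfolding one_dimensional_def by (elim conjE)
  with 1 2 show ?thesis
  proof eventually_elim
    case (elim p)
    show ?case
    proof
      assume p: "p \<in> dom g L T d - U"
      obtain y t where yt: "p = (y, t)" by (cases p)
      have w: "z_w (z p) = (g * t) *\<^sub>R axis d 1" using elim(3) p yt by auto
      have mu: "z_mu (z p) \<in> {\<rho>m, \<rho>p}"
        and o: "z_mu (z p) *\<^sub>R outer_prod (z_w (z p)) (z_w (z p)) = z_sigma (z p) + (2 / real CARD('n) * z_e (z p)) *\<^sub>R mat 1"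
        using elim(2) p by auto
      have "trace (outer_prod (z_w (z p)) (z_w (z p))) = (g * t)^2"
      proof -
        have "trace (outer_prod (z_w (z p)) (z_w (z p))) = (\<Sum>i\<in>UNIV. if i = d then (g * t)^2 else 0)"
          unfolding trace_def w by (intro sum.cong) (auto simp: outer_prod_def axis_def power2_eq_square)
        then show ?thesis by simp
      qed
      moreover have "trace (z_sigma (z p)) = 0" using elim(1) p by auto
      moreover have "trace (z_mu (z p) *\<^sub>R outer_prod (z_w (z p)) (z_w (z p))) = z_mu (z p) * trace (outer_prod (z_w (z p)) (z_w (z p)))"
        by (simp add: trace_def sum_distrib_left)
      moreover have "trace (z_sigma (z p) + (2 / real CARD('n) * z_e (z p)) *\<^sub>R mat 1) = trace (z_sigma (z p)) + 2 * z_e (z p)"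
        by (simp add: trace_def sum.distrib mat_def)
      ultimately have "z_mu (z p) * (g * t)^2 = 2 * z_e (z p)" using o by simp
      then show "z_e (z p) = energy_1d \<rho>m \<rho>p (g * snd p) (z_mu (z p)) (z_m (z p) $ d)"
        using mu yt by (auto simp: energy_1d_def)
    qed
  qed
qed

lemma nonstrict_subsolution_energy:
  fixes d :: "'n::finite"
  assumes n: "CARD('n) \<in> {2, 3}" and ns: "nonstrict_subsolution_1d g L T \<rho>m \<rho>p d z q \<nu>"
  shows "AE p in lborel. p \<in> dom g L T d \<longrightarrow>
     z_e (z p) = energy_1d \<rho>m \<rho>p (g * snd p) (z_mu (z p)) (z_m (z p) $ d)"
proof -
  obtain U where U: "mixing_zone g L T \<rho>m \<rho>p d z q U"
    "\<And>y t. (y, t) \<in> U \<Longrightarrow> z_e (z (y, t)) = f_1d g \<rho>m \<rho>p d (z (y, t)) t / 2"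
    using ns unfolding nonstrict_subsolution_1d_def by fast
  have "AE p in lborel. p \<in> dom g L T d - U \<longrightarrow>
     z_e (z p) = energy_1d \<rho>m \<rho>p (g * snd p) (z_mu (z p)) (z_m (z p) $ d)"
    using ns by (intro mixing_zone_complement_energy[OF n _ _ U(1)]) (auto simp: nonstrict_subsolution_1d_def)
  then show ?thesis
  proof eventually_elim
    case (elim p)
    then show ?case using U(2)[of "fst p" "snd p"] by (cases "p \<in> U") (auto simp: f_1d_energy)
  qed
qed

lemma strict_subsolution_energy:
  fixes d :: "'n::finite"
  assumes n: "CARD('n) \<in> {2, 3}" and ss: "strict_subsolution_1d g L T \<rho>m \<rho>p d z q \<nu>"
  shows "AE p in lborel. p \<in> dom g L T d \<longrightarrow>
     energy_1d \<rho>m \<rho>p (g * snd p) (z_mu (z p)) (z_m (z p) $ d) \<le> z_e (z p)"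
proof -
  have od: "one_dimensional g L T \<rho>m \<rho>p d z q \<nu>" and ws: "weak_solution g L T \<rho>m \<rho>p d z q \<nu>"
    using ss by (auto simp: strict_subsolution_1d_def strict_subsolution_def)
  obtain U \<epsilon> where U: "mixing_zone g L T \<rho>m \<rho>p d z q U" "0 < \<epsilon>"
    "\<forall>p\<in>U. lambda_max (M_tilde \<rho>m \<rho>p (z p)) + \<epsilon> * norm (z_h (z p) - h_relaxed \<rho>m \<rho>p (z p) (q p))
               < 2 / real CARD('n) * z_e (z p)"
    using ss unfolding strict_subsolution_1d_def strict_subsolution_def by (elim conjE exE) blast
  have mu: "\<forall>p\<in>U. \<rho>m < z_mu (z p) \<and> z_mu (z p) < \<rho>p"
    using U(1) unfolding mixing_zone_def by (elim conjE)
  have 1: "AE p in lborel. p \<in> dom g L T d - U \<longrightarrow>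
     z_e (z p) = energy_1d \<rho>m \<rho>p (g * snd p) (z_mu (z p)) (z_m (z p) $ d)"
    by (rule mixing_zone_complement_energy[OF n ws od U(1)])
  have "AE (y, t) in lborel. (y, t) \<in> dom g L T d \<longrightarrow>
        z_w (z (y, t)) = (g * t) *\<^sub>R axis d 1 \<and>
        (\<forall>j. j \<noteq> d \<longrightarrow> z_m (z (y, t)) $ j = 0 \<and> z_h (z (y, t)) $ j = 0) \<and>
        z_sigma (z (y, t)) = sigma_1d d (f_1d g \<rho>m \<rho>p d (z (y, t)) t)"
    using od unfolding one_dimensional_def by (elim conjE)
  with 1 show ?thesis
  proof eventually_elim
    case (elim p)
    show ?case
    proof
      assume p: "p \<in> dom g L T d"
      show "energy_1d \<rho>m \<rho>p (g * snd p) (z_mu (z p)) (z_m (z p) $ d) \<le> z_e (z p)"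
      proof (cases "p \<in> U")
        case False
        then show ?thesis using elim(1) p by simp
      next
        case True
        obtain y t where yt: "p = (y, t)" by (cases p)
        obtain \<mu> w m h \<sigma> e where z: "z p = (\<mu>, w, m, h, \<sigma>, e)" by (cases "z p")
        note proj = z_mu_def z_w_def z_m_def z_h_def z_sigma_def z_e_def
        define f where "f = f_1d g \<rho>m \<rho>p d (z p) t"
        have w: "w = (g * t) *\<^sub>R axis d 1" and m: "\<And>j. j \<noteq> d \<Longrightarrow> m $ j = 0" and \<sigma>: "\<sigma> = sigma_1d d f"
          using elim(2) p z yt by (auto simp: proj f_def)
        have "\<mu> \<noteq> \<rho>m" "\<mu> \<noteq> \<rho>p" using mu True z by (auto simp: proj)
        then have f: "f = (\<mu> * \<rho>m * \<rho>p * (g * t)^2 - 2 * \<rho>m * \<rho>p * m $ d * (g * t) + (\<rho>p + \<rho>m - \<mu>) * (m $ d)^2) / ((\<rho>p - \<mu>) * (\<mu> - \<rho>m))"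
          by (simp add: f_def f_1d_def z proj Let_def power_mult_distrib mult_ac)
        have "M_tilde \<rho>m \<rho>p (z p) = (f / real CARD('n)) *\<^sub>R mat 1"
          unfolding z \<sigma> by (rule M_tilde_1d[OF n w _ f]) (rule m)
        then have "lambda_max (M_tilde \<rho>m \<rho>p (z p)) = f / real CARD('n)"
          by (simp only: lambda_max_scaled_identity)
        moreover have "lambda_max (M_tilde \<rho>m \<rho>p (z p)) + \<epsilon> * norm (z_h (z p) - h_relaxed \<rho>m \<rho>p (z p) (q p))
               < 2 / real CARD('n) * z_e (z p)" using U(3) True by blast
        moreover have "0 \<le> \<epsilon> * norm (z_h (z p) - h_relaxed \<rho>m \<rho>p (z p) (q p))" using U(2) by simp
        ultimately have "f / real CARD('n) < 2 * z_e (z p) / real CARD('n)" by simp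
        then have "f < 2 * z_e (z p)" by (simp add: divide_less_cancel)
        then show ?thesis unfolding f_def using yt by (simp add: f_1d_energy)
      qed
    qed
  qed
qed

section \<open>Reduction to the strip\<close>
definition strip :: "real \<Rightarrow> real \<Rightarrow> (real \<times> real) set" where
  "strip L T = {- L<..<L} \<times> {0<..<T}"

lemma dom_iff_strip: "p \<in> dom g L T d \<longleftrightarrow> to_strip g d p \<in> strip L T"
  by (cases p) (auto simp: dom_def dom_at_def to_strip_def strip_def)

lemma sets_strip [measurable]: "strip L T \<in> sets borel"
  unfolding strip_def by (simp add: borel_open open_Times)

lemma sets_dom [measurable]: "dom g L T (d::'n::finite) \<in> sets borel"
proof -
  have "dom g L T d = to_strip g d -` strip L T" by (auto simp: dom_iff_strip)
  then show ?thesis using measurable_sets[OF measurable_to_strip[of g d] sets_strip[of L T]] by simp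
qed

lemma sets_cell_time [measurable]: "(cell d \<times> UNIV :: ((real^'n::finite) \<times> real) set) \<in> sets borel"
  unfolding borel_prod[symmetric] by measurable

lemma bounded_linear_z_mu: "bounded_linear (z_mu :: 'n::finite Z \<Rightarrow> real)"
  unfolding z_mu_def case_prod_beta by (rule bounded_linear_fst)

lemma bounded_linear_z_m: "bounded_linear (\<lambda>Z :: 'n::finite Z. z_m Z $ d)"
  unfolding z_m_def case_prod_beta
  by (intro bounded_linear_compose[OF bounded_linear_vec_nth] bounded_linear_fst_comp bounded_linear_snd_comp bounded_linear_ident)

lemma bounded_linear_z_e: "bounded_linear (z_e :: 'n::finite Z \<Rightarrow> real)"
  unfolding z_e_def case_prod_beta
  by (intro bounded_linear_snd_comp bounded_linear_ident)

lemmas z_proj_linear = bounded_linear_z_mu bounded_linear_z_m bounded_linear_z_e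

lemma z_proj_measurable [measurable]:
  "(z_mu :: 'n::finite Z \<Rightarrow> real) \<in> borel_measurable borel"
  "(\<lambda>Z :: 'n Z. z_m Z $ d) \<in> borel_measurable borel"
  "(z_e :: 'n Z \<Rightarrow> real) \<in> borel_measurable borel"
  by (intro borel_measurable_continuous_onI linear_continuous_on z_proj_linear)+

text \<open>
  The profile \<open>z1\<close> is an arbitrary function. By Fubini almost every vertical line carries it almost everywhere; on
  one such line the Borel representative of \<open>z\<close> provides a Borel profile. The bound is imposed everywhere by cutting off
  a null set.
\<close>
lemma strip_reduction:
  fixes d :: "'n::finite" and z :: "(real^'n) \<times> real \<Rightarrow> 'n Z"
  assumes z: "Linf (dom g L T d) z"
    and z1: "AE (y, t) in lborel. (y, t) \<in> dom g L T d \<longrightarrow> z (y, t) = z1 (y $ d, t)"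
    and P: "AE p in lborel. p \<in> dom g L T d \<longrightarrow> P (z p) (to_strip g d p)"
  obtains Z C where "Z \<in> borel_measurable borel" "\<And>q. norm (Z q) \<le> C"
    "AE p in lborel. fst p \<in> cell d \<and> p \<in> dom g L T d \<longrightarrow> z p = Z (to_strip g d p)"
    "AE q in lborel. q \<in> strip L T \<longrightarrow> P (Z q) q"
proof -
  define z' where "z' p = indicator (dom g L T d) p *\<^sub>R z p" for p
  have z': "z' \<in> borel_measurable borel" using z by (simp add: z'_def[abs_def] Linf_def set_borel_measurable_def)
  obtain C where C: "AE p in lborel. p \<in> dom g L T d \<longrightarrow> norm (z p) \<le> C" using z by (auto simp: Linf_def)
  have "AE p in lborel. fst p \<in> cell d \<longrightarrow> (p \<in> dom g L T d \<longrightarrow> norm (z p) \<le> max 0 C \<and> P (z p) (to_strip g d p) \<and> z p = z1 (fst p $ d, snd p))"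
    using C P z1 by eventually_elim (auto simp: case_prod_beta)
  from AE_lift_strip[OF this, of g]
  have ae: "AE y in lborel. y \<in> unit_cube \<longrightarrow> (AE q in lborel. lift_strip g d y q \<in> dom g L T d \<longrightarrow>
     norm (z (lift_strip g d y q)) \<le> max 0 C \<and> P (z (lift_strip g d y q)) q \<and> z (lift_strip g d y q) = z1 (fst q + g * (snd q)^2 / 2, snd q))"
    by (simp add: lift_strip_def to_strip_def)
  \<comment> \<open>The unit cube has measure one, so it is not contained in the exceptional null set.\<close>
  have "\<exists>y. y \<in> unit_cube \<and> (AE q in lborel. lift_strip g d y q \<in> dom g L T d \<longrightarrow>
     norm (z (lift_strip g d y q)) \<le> max 0 C \<and> P (z (lift_strip g d y q)) q \<and> z (lift_strip g d y q) = z1 (fst q + g * (snd q)^2 / 2, snd q))"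
  proof (rule ccontr)
    assume "\<not> ?thesis"
    with ae have "AE y in lborel. y \<notin> (unit_cube :: (real^'n) set)"
      by (auto elim!: eventually_mono)
    then have "emeasure lborel (unit_cube :: (real^'n) set) = 0"
      by (subst (asm) AE_iff_measurable[OF _ refl]) auto
    then show False by simp
  qed
  then obtain y where y: "y \<in> unit_cube" "AE q in lborel. lift_strip g d y q \<in> dom g L T d \<longrightarrow>
     norm (z (lift_strip g d y q)) \<le> max 0 C \<and> P (z (lift_strip g d y q)) q \<and> z (lift_strip g d y q) = z1 (fst q + g * (snd q)^2 / 2, snd q)"
    by blast
  have ldom: "lift_strip g d y q \<in> dom g L T d \<longleftrightarrow> q \<in> strip L T" for q by (simp add: dom_iff_strip)
  \<comment> \<open>Cutting off the values above the essential bound makes the profile bounded everywhere.\<close>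
  define Z where "Z q = (if norm (z' (lift_strip g d y q)) \<le> max 0 C then z' (lift_strip g d y q) else 0)" for q
  have Zm: "Z \<in> borel_measurable borel"
    unfolding Z_def using z' by measurable
  have ZP: "AE q in lborel. q \<in> strip L T \<longrightarrow> P (Z q) q \<and> Z q = z1 (fst q + g * (snd q)^2 / 2, snd q)"
    using y(2) by eventually_elim (auto simp: ldom Z_def z'_def)
  have "AE p in lborel. fst p \<in> cell d \<longrightarrow> (to_strip g d p \<in> strip L T \<longrightarrow> Z (to_strip g d p) = z1 (fst p $ d, snd p))"
    using AE_to_strip[OF ZP, of d g] by eventually_elim (auto simp: to_strip_def)
  with z1 have "AE p in lborel. fst p \<in> cell d \<and> p \<in> dom g L T d \<longrightarrow> z p = Z (to_strip g d p)"
    by eventually_elim (auto simp: dom_iff_strip)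
  moreover have "norm (Z q) \<le> max 0 C" for q by (simp add: Z_def)
  moreover have "AE q in lborel. q \<in> strip L T \<longrightarrow> P (Z q) q" using ZP by eventually_elim auto
  ultimately show ?thesis by (intro that[OF Zm, of "max 0 C"])
qed

lemma norm_fst_le_norm: "norm (fst p) \<le> norm p" and norm_snd_le_norm: "norm (snd p) \<le> norm p"
  using norm_fst_le[of "fst p" "snd p"] norm_snd_le[of "snd p" "fst p"] by simp_all

lemma strip_fields:
  fixes d :: "'n::finite" and z :: "(real^'n) \<times> real \<Rightarrow> 'n Z"
  assumes z: "Linf (dom g L T d) z" and od: "one_dimensional g L T \<rho>m \<rho>p d z q \<nu>"
    and P: "AE p in lborel. p \<in> dom g L T d \<longrightarrow> P (z_mu (z p)) (z_m (z p) $ d) (z_e (z p)) (to_strip g d p)"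
  obtains mu mo en :: "real \<times> real \<Rightarrow> real" and C where
    "mu \<in> borel_measurable borel" "mo \<in> borel_measurable borel" "en \<in> borel_measurable borel"
    "\<And>q. \<bar>mu q\<bar> \<le> C" "\<And>q. \<bar>mo q\<bar> \<le> C" "\<And>q. \<bar>en q\<bar> \<le> C"
    "AE p in lborel. fst p \<in> cell d \<and> p \<in> dom g L T d \<longrightarrow>
       z_mu (z p) = mu (to_strip g d p) \<and> z_m (z p) $ d = mo (to_strip g d p) \<and> z_e (z p) = en (to_strip g d p)"
    "AE q in lborel. q \<in> strip L T \<longrightarrow> P (mu q) (mo q) (en q) q"
proof -
  obtain z1 where z1: "AE (y, t) in lborel. (y, t) \<in> dom g L T d \<longrightarrow> z (y, t) = z1 (y $ d, t)"
    using od unfolding one_dimensional_def by (elim conjE exE) blast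
  obtain Z C where Z [measurable]: "Z \<in> borel_measurable borel" and C: "\<And>q. norm (Z q) \<le> C"
    and ZZ: "AE p in lborel. fst p \<in> cell d \<and> p \<in> dom g L T d \<longrightarrow> z p = Z (to_strip g d p)"
    and ZP: "AE q in lborel. q \<in> strip L T \<longrightarrow> P (z_mu (Z q)) (z_m (Z q) $ d) (z_e (Z q)) q"
    using strip_reduction[OF z z1, of "\<lambda>Z. P (z_mu Z) (z_m Z $ d) (z_e Z)"] P by blast
  have mu: "\<bar>z_mu Y\<bar> \<le> norm Y" for Y :: "'n Z"
    unfolding z_mu_def case_prod_beta using norm_fst_le_norm[of Y] by simp
  have mo: "\<bar>z_m Y $ d\<bar> \<le> norm Y" for Y :: "'n Z"
  proof -
    have "z_m Y = fst (snd (snd Y))" by (simp add: z_m_def case_prod_beta)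
    then show ?thesis
      using component_le_norm_cart[of "z_m Y" d] norm_fst_le_norm[of "snd (snd Y)"] norm_snd_le_norm[of "snd Y"] norm_snd_le_norm[of Y] by simp
  qed
  have en: "\<bar>z_e Y\<bar> \<le> norm Y" for Y :: "'n Z"
  proof -
    have "z_e Y = snd (snd (snd (snd (snd Y))))" by (simp add: z_e_def case_prod_beta)
    then show ?thesis
      using norm_snd_le_norm[of "snd (snd (snd (snd Y)))"] norm_snd_le_norm[of "snd (snd (snd Y))"] norm_snd_le_norm[of "snd (snd Y)"]
        norm_snd_le_norm[of "snd Y"] norm_snd_le_norm[of Y] by simp
  qed
  show ?thesis
  proof (rule that[of "\<lambda>q. z_mu (Z q)" "\<lambda>q. z_m (Z q) $ d" "\<lambda>q. z_e (Z q)" C])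
    show "\<bar>z_mu (Z q)\<bar> \<le> C" "\<bar>z_m (Z q) $ d\<bar> \<le> C" "\<bar>z_e (Z q)\<bar> \<le> C" for q
      using order_trans[OF mu C] order_trans[OF mo C] order_trans[OF en C] by blast+
    show "AE p in lborel. fst p \<in> cell d \<and> p \<in> dom g L T d \<longrightarrow>
       z_mu (z p) = z_mu (Z (to_strip g d p)) \<and> z_m (z p) $ d = z_m (Z (to_strip g d p)) $ d \<and> z_e (z p) = z_e (Z (to_strip g d p))"
      using ZZ by eventually_elim auto
  qed (use ZP in measurable)
qed

text \<open>
  The integrand is only measurable after multiplication by the indicator of the domain, since nothing is known about
  \<open>z\<close> outside; this measurability has to accompany the almost everywhere identity.
\<close>
lemma int_dom_strip:
  fixes d :: "'n::finite"
  assumes f: "(\<lambda>p. indicator (dom g L T d) p * f p) \<in> borel_measurable borel"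
    and k: "k \<in> borel_measurable borel"
    and eq: "AE p in lborel. fst p \<in> cell d \<and> p \<in> dom g L T d \<longrightarrow> f p = k (to_strip g d p)"
  shows "int_dom g L T d f = (LINT q|lborel. indicator (strip L T) q * k q)"
proof -
  note k [measurable] f [measurable]
  have "int_dom g L T d f = (LINT p|lborel. indicator (cell d \<times> UNIV) p * (indicator (dom g L T d) p * f p))"
    unfolding int_dom_def set_lebesgue_integral_def
    by (intro Bochner_Integration.integral_cong) (auto simp: indicator_def)
  also have "\<dots> = (LINT p|lborel. indicator (cell d \<times> UNIV) p * (indicator (strip L T) (to_strip g d p) * k (to_strip g d p)))"
  proof (rule integral_cong_AE)
    show "AE p in lborel. indicator (cell d \<times> UNIV) p * (indicator (dom g L T d) p * f p) =
        indicator (cell d \<times> UNIV) p * (indicator (strip L T) (to_strip g d p) * k (to_strip g d p))"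
      using eq by eventually_elim (auto simp: indicator_def dom_iff_strip)
  qed measurable
  also have "\<dots> = (LINT q|lborel. indicator (strip L T) q * k q)"
    by (rule integral_to_strip) measurable
  finally show ?thesis .
qed

lemma int_dom_at_strip:
  fixes d :: "'n::finite"
  assumes k: "k \<in> borel_measurable borel"
  shows "int_dom_at g L d t (\<lambda>y. k (y $ d - g * t^2 / 2)) = (LINT x|lborel. indicator {- L<..<L} x * k x)"
proof -
  note k [measurable]
  have "int_dom_at g L d t (\<lambda>y. k (y $ d - g * t^2 / 2)) =
     (LINT y|lborel. indicator (cell d) y * (indicator {- L<..<L} (y $ d - g * t^2 / 2) * k (y $ d - g * t^2 / 2)))"
    unfolding int_dom_at_def set_lebesgue_integral_def
    by (intro Bochner_Integration.integral_cong) (auto simp: indicator_def dom_at_def)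
  also have "\<dots> = (LINT x|lborel. indicator {- L<..<L} x * k x)"
    by (rule integral_slice) measurable
  finally show ?thesis .
qed

lemma int_dom_at_strip_AE:
  fixes d :: "'n::finite"
  assumes f: "(\<lambda>p. indicator (dom g L T d) p * f p) \<in> borel_measurable borel"
    and k: "k \<in> borel_measurable borel"
    and eq: "AE p in lborel. fst p \<in> cell d \<and> p \<in> dom g L T d \<longrightarrow> f p = k (to_strip g d p)"
  shows "AE t in lborel. t \<in> {0<..<T} \<longrightarrow> int_dom_at g L d t (\<lambda>y. f (y, t)) = (LINT x|lborel. indicator {- L<..<L} x * k (x, t))"
proof -
  define f' where "f' p = indicator (cell d \<times> UNIV) p * (indicator (dom g L T d) p * f p)" for p
  define k' where "k' p = indicator (cell d \<times> UNIV) p * (indicator (strip L T) (to_strip g d p) * k (to_strip g d p))" for p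
  note k [measurable] f [measurable]
  have f'm: "f' \<in> borel_measurable borel" and k'm: "k' \<in> borel_measurable borel"
    unfolding f'_def k'_def by measurable
  then have m [measurable]: "f' \<in> borel_measurable (borel \<Otimes>\<^sub>M borel)" "k' \<in> borel_measurable (borel \<Otimes>\<^sub>M borel)"
    by (simp_all add: borel_prod)
  have "AE p in lborel. f' p = k' p"
    using eq by eventually_elim (auto simp: f'_def k'_def indicator_def dom_iff_strip)
  then have "AE p in lborel \<Otimes>\<^sub>M lborel. f' p = k' p" by (subst lborel_prod)
  then have "AE y in lborel. AE t in lborel. f' (y, t) = k' (y, t)" by (rule lborel_pair.AE_pair)
  then have "AE t in lborel. AE y in lborel. f' (y, t) = k' (y, t)"
    by (subst lborel_pair.AE_commute[symmetric]) measurable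
  then show ?thesis
  proof eventually_elim
    case (elim t)
    show ?case
    proof
      assume t: "t \<in> {0<..<T}"
      have k't: "(\<lambda>x. k (x, t)) \<in> borel_measurable borel"
        by (rule measurable_compose[OF _ k]) (auto intro!: borel_measurable_continuous_onI continuous_intros)
      have "int_dom_at g L d t (\<lambda>y. f (y, t)) = (LINT y|lborel. f' (y, t))"
        unfolding int_dom_at_def set_lebesgue_integral_def f'_def using t
        by (intro Bochner_Integration.integral_cong) (auto simp: indicator_def dom_at_def dom_def)
      also have "\<dots> = (LINT y|lborel. k' (y, t))"
        by (rule integral_cong_AE[OF _ _ elim]) measurable
      also have "\<dots> = int_dom_at g L d t (\<lambda>y. k (y $ d - g * t^2 / 2, t))"
        unfolding int_dom_at_def set_lebesgue_integral_def k'_def using t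
        by (intro Bochner_Integration.integral_cong) (auto simp: indicator_def dom_at_def to_strip_def strip_def)
      also have "\<dots> = (LINT x|lborel. indicator {- L<..<L} x * k (x, t))"
        by (rule int_dom_at_strip[OF k't])
      finally show "int_dom_at g L d t (\<lambda>y. f (y, t)) = (LINT x|lborel. indicator {- L<..<L} x * k (x, t))" .
    qed
  qed
qed

lemma strip_integrable:
  fixes u c :: "real \<times> real \<Rightarrow> real"
  assumes u: "u \<in> borel_measurable borel" "\<And>q. \<bar>u q\<bar> \<le> C" and c: "continuous_on UNIV c"
  shows "integrable lborel (\<lambda>q. indicator (strip L T) q * (u q * c q))"
proof -
  define K where "K = cbox (- L, 0) (L, T)"
  have K: "compact K" "strip L T \<subseteq> K" by (auto simp: K_def strip_def)
  obtain B where B: "\<And>q. q \<in> K \<Longrightarrow> \<bar>c q\<bar> \<le> B"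
    using compact_imp_bounded[OF compact_continuous_image[OF continuous_on_subset[OF c subset_UNIV] K(1)]]
    unfolding bounded_iff by auto
  note u(1) [measurable] borel_measurable_continuous_onI[OF c, measurable]
  have "integrable lborel (\<lambda>q. indicator (strip L T) q *\<^sub>R (u q * c q))"
  proof (rule integrableI_bounded_set_indicator[where B = "C * B"])
    have "emeasure lborel (strip L T) \<le> emeasure lborel K" by (rule emeasure_mono[OF K(2)]) (simp add: K_def)
    also have "\<dots> < \<infinity>" unfolding K_def using emeasure_lborel_cbox_finite by blast
    finally show "emeasure lborel (strip L T) < \<infinity>" .
    show "AE q in lborel. q \<in> strip L T \<longrightarrow> norm (u q * c q) \<le> C * B"
    proof (rule AE_I2, rule impI)
      fix q assume "q \<in> strip L T"
      then have "q \<in> K" using K by blast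
      then show "norm (u q * c q) \<le> C * B"
        using u(2)[of q] B[of q] by (auto simp: abs_mult intro!: mult_mono intro: order_trans[OF abs_ge_zero])
    qed
  qed measurable
  then show ?thesis by simp
qed

section \<open>The weak equations on the strip\<close>
lemma borel_measurable_rho0 [measurable]: "rho0 \<rho>m \<rho>p \<in> borel_measurable borel"
  unfolding rho0_def[abs_def] by measurable

lemma z_proj_scaleR: "z_mu (r *\<^sub>R Z) = r * z_mu Z" "z_m (r *\<^sub>R Z) = r *\<^sub>R z_m Z" "z_e (r *\<^sub>R Z) = r * z_e Z"
  by (simp_all add: z_mu_def z_m_def z_e_def case_prod_beta)

lemma Linf_fields_measurable:
  fixes d :: "'n::finite" and z :: "(real^'n) \<times> real \<Rightarrow> 'n Z"
  assumes "Linf D z"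
  shows "(\<lambda>p. indicator D p * z_mu (z p)) \<in> borel_measurable borel"
    "(\<lambda>p. indicator D p * z_m (z p) $ d) \<in> borel_measurable borel"
    "(\<lambda>p. indicator D p * z_e (z p)) \<in> borel_measurable borel"
proof -
  have z: "(\<lambda>p. indicator D p *\<^sub>R z p) \<in> borel_measurable borel"
    using assms by (simp add: Linf_def set_borel_measurable_def)
  show "(\<lambda>p. indicator D p * z_mu (z p)) \<in> borel_measurable borel"
    "(\<lambda>p. indicator D p * z_m (z p) $ d) \<in> borel_measurable borel"
    "(\<lambda>p. indicator D p * z_e (z p)) \<in> borel_measurable borel"
    using z_proj_measurable[THEN measurable_compose[OF z]] by (simp_all add: z_proj_scaleR)
qed

lemma weak_solution_Linf: "weak_solution g L T \<rho>m \<rho>p d z q \<nu> \<Longrightarrow> Linf (dom g L T d) z"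
  unfolding weak_solution_def by (elim conjE)

lemma weak_solution_dissipation:
  "weak_solution g L T \<rho>m \<rho>p d z q \<nu> \<Longrightarrow> test_fun g L T d \<phi> \<Longrightarrow> (\<And>p. 0 \<le> \<phi> p) \<Longrightarrow> \<nu> \<phi> \<le> 0"
  unfolding weak_solution_def dissipation_measure_def by (elim conjE) blast

lemma weak_solution_momentum:
  fixes \<Phi> :: "(real^'n::finite) \<times> real \<Rightarrow> real^'n"
  assumes ws: "weak_solution g L T \<rho>m \<rho>p d z q \<nu>" and test: "test_fun g L T d \<Phi>"
  shows "int_dom g L T d (\<lambda>p. z_m (z p) \<bullet> dt \<Phi> p +
          frob (z_sigma (z p) + (2 / real CARD('n) * z_e (z p)) *\<^sub>R mat 1 + q p *\<^sub>R mat 1) (jacobian \<Phi> p))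
        - (LINT t:{0<..<T}|lborel. int_bdry_normal g L d t (\<lambda>y. q (y, t) * \<Phi> (y, t) $ d)) = 0"
  using ws[unfolded weak_solution_def, THEN conjunct2, THEN conjunct2, THEN conjunct2, THEN conjunct2,
      THEN conjunct2, THEN conjunct2, THEN conjunct2, THEN conjunct1, THEN spec, THEN mp, OF test] .

lemma weak_solution_mass:
  fixes \<Psi> :: "(real^'n::finite) \<times> real \<Rightarrow> real"
  assumes ws: "weak_solution g L T \<rho>m \<rho>p d z q \<nu>" and test: "test_fun g L T d \<Psi>"
  shows "int_dom g L T d (\<lambda>p. z_mu (z p) * dt \<Psi> p + z_m (z p) \<bullet> grad \<Psi> p)
        + int_dom_at g L d 0 (\<lambda>y. rho0 \<rho>m \<rho>p (y $ d) * \<Psi> (y, 0)) = 0"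
  using ws[unfolded weak_solution_def, THEN conjunct2, THEN conjunct2, THEN conjunct2, THEN conjunct2,
      THEN conjunct2, THEN conjunct2, THEN conjunct2, THEN conjunct2, THEN spec, THEN mp, OF test, THEN conjunct2, THEN conjunct1] .

lemma weak_solution_energy:
  fixes \<Psi> :: "(real^'n::finite) \<times> real \<Rightarrow> real"
  assumes ws: "weak_solution g L T \<rho>m \<rho>p d z q \<nu>" and test: "test_fun g L T d \<Psi>"
  shows "int_dom g L T d (\<lambda>p. z_e (z p) * dt \<Psi> p + z_h (z p) \<bullet> grad \<Psi> p)
        - (LINT t:{0<..<T}|lborel. g * t * int_bdry_normal g L d t (\<lambda>y. q (y, t) * \<Psi> (y, t))) = - \<nu> \<Psi>"
  using ws[unfolded weak_solution_def, THEN conjunct2, THEN conjunct2, THEN conjunct2, THEN conjunct2,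
      THEN conjunct2, THEN conjunct2, THEN conjunct2, THEN conjunct2, THEN spec, THEN mp, OF test, THEN conjunct2, THEN conjunct2] .

lemma test_funI:
  assumes "smooth \<phi>" "\<And>j y t. j \<noteq> d \<Longrightarrow> \<phi> (y + axis j 1, t) = \<phi> (y, t)" "\<tau> < T" "\<And>y t. \<tau> \<le> t \<Longrightarrow> \<phi> (y, t) = 0"
  shows "test_fun g L T d \<phi>"
  using assms unfolding test_fun_def hperiodic_def by blast

lemma test_fun_deriv:
  fixes \<Psi> :: "(real^'n::finite) \<times> real \<Rightarrow> real"
  assumes "(\<Psi> has_derivative (\<lambda>v. fst v $ d * A + snd v * B)) (at p)"
  shows "dt \<Psi> p = B" "grad \<Psi> p = A *\<^sub>R axis d 1"
proof -
  have "frechet_derivative \<Psi> (at p) = (\<lambda>v. fst v $ d * A + snd v * B)"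
    using frechet_derivative_at[OF assms] by simp
  then show "dt \<Psi> p = B" "grad \<Psi> p = A *\<^sub>R axis d 1"
    by (auto simp: dt_def grad_def dx_def vec_eq_iff axis_def)
qed

lemma inner_scaled_axis: "m \<bullet> (A *\<^sub>R axis d 1) = m $ d * A" for m :: "real^'n::finite"
  by (simp add: inner_axis)

text \<open>
  A weak solution whose density, vertical momentum and energy are, up to null sets, given by bounded Borel functions
  of height in the moving frame and time.
\<close>
locale strip_state =
  fixes d :: "'n::finite" and g L T \<rho>m \<rho>p :: real
    and z :: "(real^'n) \<times> real \<Rightarrow> 'n Z" and q :: "(real^'n) \<times> real \<Rightarrow> real"
    and \<nu> :: "((real^'n) \<times> real \<Rightarrow> real) \<Rightarrow> real"
    and mu mo en :: "real \<times> real \<Rightarrow> real" and C :: real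
  assumes ws: "weak_solution g L T \<rho>m \<rho>p d z q \<nu>"
    and meas: "mu \<in> borel_measurable borel" "mo \<in> borel_measurable borel" "en \<in> borel_measurable borel"
    and bdd: "\<And>p. \<bar>mu p\<bar> \<le> C" "\<And>p. \<bar>mo p\<bar> \<le> C" "\<And>p. \<bar>en p\<bar> \<le> C"
    and fields: "AE p in lborel. fst p \<in> cell d \<and> p \<in> dom g L T d \<longrightarrow>
       z_mu (z p) = mu (to_strip g d p) \<and> z_m (z p) $ d = mo (to_strip g d p) \<and> z_e (z p) = en (to_strip g d p)"
begin

abbreviation (input) strip_int :: "(real \<times> real \<Rightarrow> real) \<Rightarrow> real" where
  "strip_int f \<equiv> LINT p|lborel. indicator (strip L T) p * f p"

lemma int_dom_fields:
  assumes c: "continuous_on UNIV c1" "continuous_on UNIV c2" "continuous_on UNIV c3"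
  shows "int_dom g L T d (\<lambda>p. z_mu (z p) * c1 (to_strip g d p) + z_m (z p) $ d * c2 (to_strip g d p) + z_e (z p) * c3 (to_strip g d p))
    = strip_int (\<lambda>p. mu p * c1 p) + strip_int (\<lambda>p. mo p * c2 p) + strip_int (\<lambda>p. en p * c3 p)"
proof -
  note c[THEN borel_measurable_continuous_onI, measurable] meas [measurable]
  note Linf_fields_measurable[OF weak_solution_Linf[OF ws], measurable]
  have "int_dom g L T d (\<lambda>p. z_mu (z p) * c1 (to_strip g d p) + z_m (z p) $ d * c2 (to_strip g d p) + z_e (z p) * c3 (to_strip g d p))
    = strip_int (\<lambda>p. mu p * c1 p + mo p * c2 p + en p * c3 p)"
  proof (rule int_dom_strip)
    have "(\<lambda>p. indicator (dom g L T d) p * z_mu (z p) * c1 (to_strip g d p) + indicator (dom g L T d) p * z_m (z p) $ d * c2 (to_strip g d p)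
      + indicator (dom g L T d) p * z_e (z p) * c3 (to_strip g d p)) \<in> borel_measurable borel"
      by measurable
    then show "(\<lambda>p. indicator (dom g L T d) p * (z_mu (z p) * c1 (to_strip g d p) + z_m (z p) $ d * c2 (to_strip g d p) + z_e (z p) * c3 (to_strip g d p))) \<in> borel_measurable borel"
      by (simp add: algebra_simps)
    show "AE p in lborel. fst p \<in> cell d \<and> p \<in> dom g L T d \<longrightarrow>
      z_mu (z p) * c1 (to_strip g d p) + z_m (z p) $ d * c2 (to_strip g d p) + z_e (z p) * c3 (to_strip g d p)
       = mu (to_strip g d p) * c1 (to_strip g d p) + mo (to_strip g d p) * c2 (to_strip g d p) + en (to_strip g d p) * c3 (to_strip g d p)"
      using fields by eventually_elim simp
  qed measurable
  also have "\<dots> = (LINT p|lborel. indicator (strip L T) p * (mu p * c1 p) + indicator (strip L T) p * (mo p * c2 p) + indicator (strip L T) p * (en p * c3 p))"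
    by (intro Bochner_Integration.integral_cong) (auto simp: algebra_simps)
  also have "\<dots> = strip_int (\<lambda>p. mu p * c1 p) + strip_int (\<lambda>p. mo p * c2 p) + strip_int (\<lambda>p. en p * c3 p)"
    using strip_integrable[OF meas(1) bdd(1) c(1)] strip_integrable[OF meas(2) bdd(2) c(2)] strip_integrable[OF meas(3) bdd(3) c(3)]
    by simp
  finally show ?thesis .
qed

text \<open>
  Test functions \<open>a (y\<^sub>d - g t\<^sup>2 / 2) * h t\<close>; the term with \<open>g * snd p * b\<close> comes from the moving frame.
\<close>
lemma mass_balance:
  assumes a: "smooth a" "\<And>x. (a has_real_derivative b x) (at x)"
    and h: "smooth h" "\<And>t. (h has_real_derivative h1 t) (at t)" and \<tau>: "\<tau> < T" "\<And>t. \<tau> \<le> t \<Longrightarrow> h t = 0"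
  shows "strip_int (\<lambda>p. mu p * (a (fst p) * h1 (snd p) - g * snd p * b (fst p) * h (snd p)))
    + strip_int (\<lambda>p. mo p * (b (fst p) * h (snd p)))
    + h 0 * (LINT x|lborel. indicator {- L<..<L} x * (rho0 \<rho>m \<rho>p x * a x)) = 0"
proof -
  define \<Psi> where "\<Psi> p = a (fst (to_strip g d p)) * h (snd p)" for p :: "(real^'n) \<times> real"
  have test: "test_fun g L T d \<Psi>"
  proof (rule test_funI[OF _ _ \<tau>(1)])
    have "(\<lambda>p. fst (to_strip g d p)) = (\<lambda>p. fst p $ d - (g / 2) * (snd p)^2)" by (auto simp: to_strip_def)
    then have "smooth (\<lambda>p. fst (to_strip g d p))" by (simp only:) (intro smooth_intros)
    then show "smooth \<Psi>" unfolding \<Psi>_def[abs_def] by (intro smooth_mult smooth_compose[OF a(1)] smooth_compose[OF h(1)] smooth_snd)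
    show "\<Psi> (y + axis j 1, t) = \<Psi> (y, t)" if "j \<noteq> d" for j y t
      using that by (simp add: \<Psi>_def to_strip_def axis_def)
    show "\<Psi> (y, t) = 0" if "\<tau> \<le> t" for y t using \<tau>(2)[OF that] by (simp add: \<Psi>_def)
  qed
  have deriv: "(\<Psi> has_derivative (\<lambda>v. fst v $ d * (b (fst (to_strip g d p)) * h (snd p)) +
      snd v * (a (fst (to_strip g d p)) * h1 (snd p) - g * snd p * b (fst (to_strip g d p)) * h (snd p)))) (at p)" for p
  proof -
    have s: "((\<lambda>p :: (real^'n) \<times> real. fst (to_strip g d p)) has_derivative (\<lambda>v. fst v $ d - g * snd p * snd v)) (at p)"
      unfolding to_strip_def fst_conv by (auto intro!: derivative_eq_intros bounded_linear.has_derivative[OF bounded_linear_vec_nth])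
    have "((\<lambda>p. a (fst (to_strip g d p))) has_derivative (\<lambda>v. b (fst (to_strip g d p)) * (fst v $ d - g * snd p * snd v))) (at p)"
      using has_derivative_compose[OF s, of a] a(2)[of "fst (to_strip g d p)"] by (simp add: has_field_derivative_def)
    moreover have "((\<lambda>p. h (snd p)) has_derivative (\<lambda>v. h1 (snd p) * snd v)) (at p)"
      using has_derivative_compose[OF has_derivative_snd[OF has_derivative_ident], of h] h(2)[of "snd p"] by (simp add: has_field_derivative_def)
    ultimately show ?thesis
      unfolding \<Psi>_def by (rule has_derivative_eq_rhs[OF has_derivative_mult]) (auto simp: fun_eq_iff algebra_simps)
  qed
  have c: "continuous_on UNIV a" "continuous_on UNIV h" "continuous_on UNIV b" "continuous_on UNIV h1"
    using a(1) h(1) smooth_deriv[OF a] smooth_deriv[OF h] by (auto intro: continuous_on_smooth)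
  have cc: "continuous_on UNIV (\<lambda>p::real \<times> real. f (fst p))" "continuous_on UNIV (\<lambda>p::real \<times> real. f (snd p))" if "continuous_on UNIV f" for f :: "real \<Rightarrow> real"
    by (auto intro!: continuous_on_compose2[OF that] continuous_intros)
  have "int_dom g L T d (\<lambda>p. z_mu (z p) * dt \<Psi> p + z_m (z p) \<bullet> grad \<Psi> p)
     = int_dom g L T d (\<lambda>p. z_mu (z p) * (a (fst (to_strip g d p)) * h1 (snd (to_strip g d p)) - g * snd (to_strip g d p) * b (fst (to_strip g d p)) * h (snd (to_strip g d p)))
       + z_m (z p) $ d * (b (fst (to_strip g d p)) * h (snd (to_strip g d p))) + z_e (z p) * 0)"
    unfolding test_fun_deriv[OF deriv] inner_scaled_axis by (simp add: to_strip_def)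
  also have "\<dots> = strip_int (\<lambda>p. mu p * (a (fst p) * h1 (snd p) - g * snd p * b (fst p) * h (snd p)))
    + strip_int (\<lambda>p. mo p * (b (fst p) * h (snd p))) + strip_int (\<lambda>p. en p * 0)"
    by (rule int_dom_fields) (intro continuous_intros cc c; simp)+
  finally have 1: "int_dom g L T d (\<lambda>p. z_mu (z p) * dt \<Psi> p + z_m (z p) \<bullet> grad \<Psi> p) =
     strip_int (\<lambda>p. mu p * (a (fst p) * h1 (snd p) - g * snd p * b (fst p) * h (snd p)))
    + strip_int (\<lambda>p. mo p * (b (fst p) * h (snd p)))" by simp
  note c(1)[THEN borel_measurable_continuous_onI, measurable]
  have "int_dom_at g L d 0 (\<lambda>y. rho0 \<rho>m \<rho>p (y $ d) * \<Psi> (y, 0)) = (LINT x|lborel. indicator {- L<..<L} x * (rho0 \<rho>m \<rho>p x * (a x * h 0)))"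
    using int_dom_at_strip[of "\<lambda>x. rho0 \<rho>m \<rho>p x * (a x * h 0)" g L d 0] by (simp add: \<Psi>_def to_strip_def)
  also have "(\<lambda>x. indicator {- L<..<L} x * (rho0 \<rho>m \<rho>p x * (a x * h 0))) = (\<lambda>x. h 0 * (indicator {- L<..<L} x * (rho0 \<rho>m \<rho>p x * a x)))"
    by (auto simp: mult_ac)
  finally have 2: "int_dom_at g L d 0 (\<lambda>y. rho0 \<rho>m \<rho>p (y $ d) * \<Psi> (y, 0)) = h 0 * (LINT x|lborel. indicator {- L<..<L} x * (rho0 \<rho>m \<rho>p x * a x))"
    by simp
  show ?thesis using weak_solution_mass[OF ws test] unfolding 1 2 .
qed

text \<open>
  The energy equation with \<open>h t\<close>, minus the momentum equation with \<open>g t h t e\<^sub>d\<close>, plus the mass equation with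
  \<open>g y\<^sub>d h t\<close>. The horizontal and vertical derivatives of the first two test functions vanish, so the fluxes disappear; the unknown pressure at the
  boundary occurs in both with the same coefficient \<open>g t\<close> and cancels.
\<close>
lemma energy_balance:
  assumes h: "smooth h" "\<And>t. (h has_real_derivative h1 t) (at t)" "\<And>t. 0 \<le> h t" and \<tau>: "\<tau> < T" "\<And>t. \<tau> \<le> t \<Longrightarrow> h t = 0"
  shows "0 \<le> strip_int (\<lambda>p. (en p - mo p * (g * snd p) + mu p * (g * (fst p + g * (snd p)^2 / 2))) * h1 (snd p))
    + h 0 * (LINT x|lborel. indicator {- L<..<L} x * (rho0 \<rho>m \<rho>p x * (g * x)))"
proof -
  have c: "continuous_on UNIV h" "continuous_on UNIV h1"
    using h(1) smooth_deriv[OF h(1,2)] by (auto intro: continuous_on_smooth)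
  have cc: "continuous_on UNIV (\<lambda>p::real \<times> real. f (fst p))" "continuous_on UNIV (\<lambda>p::real \<times> real. f (snd p))" if "continuous_on UNIV f" for f :: "real \<Rightarrow> real"
    by (auto intro!: continuous_on_compose2[OF that] continuous_intros)
  have hd: "((\<lambda>p. h (snd p)) has_derivative (\<lambda>v. h1 (snd p) * snd v)) (at p)" for p :: "(real^'n) \<times> real"
    using has_derivative_compose[OF has_derivative_snd[OF has_derivative_ident], of h] h(2)[of "snd p"] by (simp add: has_field_derivative_def)
  define \<Psi> where "\<Psi> p = h (snd p)" for p :: "(real^'n) \<times> real"
  have test: "test_fun g L T d \<Psi>"
    by (rule test_funI[OF _ _ \<tau>(1)]) (auto simp: \<Psi>_def[abs_def] \<tau> intro!: smooth_compose[OF h(1)] smooth_snd)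
  have \<Psi>d: "(\<Psi> has_derivative (\<lambda>v. fst v $ d * 0 + snd v * h1 (snd p))) (at p)" for p
    unfolding \<Psi>_def by (rule has_derivative_eq_rhs[OF hd]) (auto simp: mult.commute)
  \<comment> \<open>the work of the boundary pressure, common to the energy and the momentum equation\<close>
  define X where "X = (LINT t:{0<..<T}|lborel. g * t * int_bdry_normal g L d t (\<lambda>y. q (y, t) * h t))"
  have "int_dom g L T d (\<lambda>p. z_e (z p) * dt \<Psi> p + z_h (z p) \<bullet> grad \<Psi> p) =
     int_dom g L T d (\<lambda>p. z_mu (z p) * 0 + z_m (z p) $ d * 0 + z_e (z p) * h1 (snd (to_strip g d p)))"
    unfolding test_fun_deriv[OF \<Psi>d] by (simp add: to_strip_def)
  also have "\<dots> = strip_int (\<lambda>p. mu p * 0) + strip_int (\<lambda>p. mo p * 0) + strip_int (\<lambda>p. en p * h1 (snd p))"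
    by (rule int_dom_fields) (intro continuous_intros cc c; simp)+
  finally have "strip_int (\<lambda>p. en p * h1 (snd p)) - X = - \<nu> \<Psi>"
    using weak_solution_energy[OF ws test] by (simp add: X_def \<Psi>_def)
  moreover have "\<nu> \<Psi> \<le> 0" by (rule weak_solution_dissipation[OF ws test]) (simp add: \<Psi>_def h)
  ultimately have 1: "0 \<le> strip_int (\<lambda>p. en p * h1 (snd p)) - X" by simp
  define \<Phi> where "\<Phi> p = (g * snd p * h (snd p)) *\<^sub>R (axis d 1 :: real^'n)" for p :: "(real^'n) \<times> real"
  have test: "test_fun g L T d \<Phi>"
    by (rule test_funI[OF _ _ \<tau>(1)])
      (auto simp: \<Phi>_def[abs_def] \<tau> intro!: smooth_scaleR smooth_mult smooth_const smooth_compose[OF h(1)] smooth_snd)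
  have "(\<Phi> has_derivative (\<lambda>v. (g * snd p * (h1 (snd p) * snd v) + g * snd v * h (snd p)) *\<^sub>R axis d 1)) (at p)" for p
    unfolding \<Phi>_def
    by (intro has_derivative_scaleR_left has_derivative_mult[OF _ hd]) (auto intro!: derivative_eq_intros)
  then have fd: "frechet_derivative \<Phi> (at p) = (\<lambda>v. (g * snd p * (h1 (snd p) * snd v) + g * snd v * h (snd p)) *\<^sub>R axis d 1)" for p
    by (rule frechet_derivative_at[symmetric])
  have dt\<Phi>: "dt \<Phi> p = (g * snd p * h1 (snd p) + g * h (snd p)) *\<^sub>R axis d 1" for p
    by (simp add: dt_def fd)
  have j\<Phi>: "jacobian \<Phi> p = 0" for p
    by (simp add: jacobian_def dx_def fd vec_eq_iff)
  have frob0: "frob A 0 = 0" for A :: "real^'n^'n" by (simp add: frob_def)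
  have "int_dom g L T d (\<lambda>p. z_m (z p) \<bullet> dt \<Phi> p +
          frob (z_sigma (z p) + (2 / real CARD('n) * z_e (z p)) *\<^sub>R mat 1 + q p *\<^sub>R mat 1) (jacobian \<Phi> p)) =
     int_dom g L T d (\<lambda>p. z_mu (z p) * 0 + z_m (z p) $ d * (g * snd (to_strip g d p) * h1 (snd (to_strip g d p)) + g * h (snd (to_strip g d p))) + z_e (z p) * 0)"
    unfolding dt\<Phi> j\<Phi> frob0 inner_scaled_axis by (simp add: to_strip_def)
  also have "\<dots> = strip_int (\<lambda>p. mu p * 0) + strip_int (\<lambda>p. mo p * (g * snd p * h1 (snd p) + g * h (snd p))) + strip_int (\<lambda>p. en p * 0)"
    by (rule int_dom_fields) (intro continuous_intros cc c; simp)+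
  finally have "strip_int (\<lambda>p. mo p * (g * snd p * h1 (snd p) + g * h (snd p)))
     = (LINT t:{0<..<T}|lborel. int_bdry_normal g L d t (\<lambda>y. q (y, t) * \<Phi> (y, t) $ d))"
    using weak_solution_momentum[OF ws test] by simp
  also have "\<dots> = X"
  proof -
    have ih: "int_height d b (\<lambda>y. q (y, t) * (g * t * h t)) = g * t * int_height d b (\<lambda>y. q (y, t) * h t)" for b t
      unfolding int_height_def by (subst set_integral_mult_right[symmetric]) (simp add: mult_ac)
    have "int_bdry_normal g L d t (\<lambda>y. q (y, t) * \<Phi> (y, t) $ d) = g * t * int_bdry_normal g L d t (\<lambda>y. q (y, t) * h t)" for t
      unfolding int_bdry_normal_def by (simp add: \<Phi>_def ih right_diff_distrib del: times_divide_eq_right)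
    then show ?thesis unfolding X_def by simp
  qed
  finally have 2: "strip_int (\<lambda>p. mo p * (g * snd p * h1 (snd p) + g * h (snd p))) = X" .
  define \<Theta> where "\<Theta> p = g * fst p $ d * h (snd p)" for p :: "(real^'n) \<times> real"
  have test: "test_fun g L T d \<Theta>"
    by (rule test_funI[OF _ _ \<tau>(1)])
      (auto simp: \<Theta>_def[abs_def] \<tau> axis_def intro!: smooth_mult smooth_const smooth_compose[OF h(1)] smooth_snd smooth_fst_nth)
  have \<Theta>d: "(\<Theta> has_derivative (\<lambda>v. fst v $ d * (g * h (snd p)) + snd v * (g * fst p $ d * h1 (snd p)))) (at p)" for p
  proof -
    have "((\<lambda>p :: (real^'n) \<times> real. g * fst p $ d) has_derivative (\<lambda>v. g * fst v $ d)) (at p)"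
      by (auto intro!: derivative_eq_intros bounded_linear.has_derivative[OF bounded_linear_vec_nth])
    from has_derivative_mult[OF this hd] show ?thesis
      unfolding \<Theta>_def by (rule has_derivative_eq_rhs) (auto simp: fun_eq_iff algebra_simps)
  qed
  have "int_dom g L T d (\<lambda>p. z_mu (z p) * dt \<Theta> p + z_m (z p) \<bullet> grad \<Theta> p)
     = int_dom g L T d (\<lambda>p. z_mu (z p) * (g * (fst (to_strip g d p) + g * (snd (to_strip g d p))^2 / 2) * h1 (snd (to_strip g d p)))
       + z_m (z p) $ d * (g * h (snd (to_strip g d p))) + z_e (z p) * 0)"
    unfolding test_fun_deriv[OF \<Theta>d] inner_scaled_axis by (simp add: to_strip_def)
  also have "\<dots> = strip_int (\<lambda>p. mu p * (g * (fst p + g * (snd p)^2 / 2) * h1 (snd p)))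
    + strip_int (\<lambda>p. mo p * (g * h (snd p))) + strip_int (\<lambda>p. en p * 0)"
    by (rule int_dom_fields) (intro continuous_intros cc c; simp)+
  finally have 31: "int_dom g L T d (\<lambda>p. z_mu (z p) * dt \<Theta> p + z_m (z p) \<bullet> grad \<Theta> p) =
     strip_int (\<lambda>p. mu p * (g * (fst p + g * (snd p)^2 / 2) * h1 (snd p))) + strip_int (\<lambda>p. mo p * (g * h (snd p)))" by simp
  have "int_dom_at g L d 0 (\<lambda>y. rho0 \<rho>m \<rho>p (y $ d) * \<Theta> (y, 0)) = (LINT x|lborel. indicator {- L<..<L} x * (rho0 \<rho>m \<rho>p x * (g * x * h 0)))"
    using int_dom_at_strip[of "\<lambda>x. rho0 \<rho>m \<rho>p x * (g * x * h 0)" g L d 0] by (simp add: \<Theta>_def)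
  also have "(\<lambda>x. indicator {- L<..<L} x * (rho0 \<rho>m \<rho>p x * (g * x * h 0))) = (\<lambda>x. h 0 * (indicator {- L<..<L} x * (rho0 \<rho>m \<rho>p x * (g * x))))"
    by (auto simp: mult_ac)
  finally have 32: "int_dom_at g L d 0 (\<lambda>y. rho0 \<rho>m \<rho>p (y $ d) * \<Theta> (y, 0)) = h 0 * (LINT x|lborel. indicator {- L<..<L} x * (rho0 \<rho>m \<rho>p x * (g * x)))"
    by simp
  have 3: "strip_int (\<lambda>p. mu p * (g * (fst p + g * (snd p)^2 / 2) * h1 (snd p))) + strip_int (\<lambda>p. mo p * (g * h (snd p)))
     + h 0 * (LINT x|lborel. indicator {- L<..<L} x * (rho0 \<rho>m \<rho>p x * (g * x))) = 0"
    using weak_solution_mass[OF ws test] unfolding 31 32 .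
  have i: "integrable lborel (\<lambda>p. indicator (strip L T) p * (en p * h1 (snd p)))"
    "integrable lborel (\<lambda>p. indicator (strip L T) p * (mo p * (g * snd p * h1 (snd p) + g * h (snd p))))"
    "integrable lborel (\<lambda>p. indicator (strip L T) p * (mu p * (g * (fst p + g * (snd p)^2 / 2) * h1 (snd p))))"
    "integrable lborel (\<lambda>p. indicator (strip L T) p * (mo p * (g * h (snd p))))"
    by (rule strip_integrable[OF meas(3) bdd(3)] strip_integrable[OF meas(2) bdd(2)] strip_integrable[OF meas(1) bdd(1)];
        intro continuous_intros cc c; simp)+
  have "strip_int (\<lambda>p. (en p - mo p * (g * snd p) + mu p * (g * (fst p + g * (snd p)^2 / 2))) * h1 (snd p))
    = (LINT p|lborel. indicator (strip L T) p * (en p * h1 (snd p))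
        - indicator (strip L T) p * (mo p * (g * snd p * h1 (snd p) + g * h (snd p)))
        + indicator (strip L T) p * (mu p * (g * (fst p + g * (snd p)^2 / 2) * h1 (snd p)))
        + indicator (strip L T) p * (mo p * (g * h (snd p))))"
    by (intro Bochner_Integration.integral_cong) (auto simp: algebra_simps)
  also have "\<dots> = strip_int (\<lambda>p. en p * h1 (snd p)) - strip_int (\<lambda>p. mo p * (g * snd p * h1 (snd p) + g * h (snd p)))
     + strip_int (\<lambda>p. mu p * (g * (fst p + g * (snd p)^2 / 2) * h1 (snd p))) + strip_int (\<lambda>p. mo p * (g * h (snd p)))"
    using i by simp
  finally show ?thesis using 1 2 3 by linarith
qed

lemma energy_slice_strip:
  "AE t in lborel. t \<in> {0<..<T} \<longrightarrow> energy_slice g L d z t =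
     (LINT x|lborel. indicator {- L<..<L} x * (en (x, t) - mo (x, t) * (g * t) + mu (x, t) * (g * (x + g * t^2 / 2))))"
proof -
  note meas [measurable]
  note Linf_fields_measurable[OF weak_solution_Linf[OF ws], measurable]
  have [measurable]: "(\<lambda>p :: (real^'n) \<times> real. snd p) \<in> borel_measurable borel" "(\<lambda>p :: (real^'n) \<times> real. fst p $ d) \<in> borel_measurable borel"
    "(\<lambda>p :: real \<times> real. snd p) \<in> borel_measurable borel" "(\<lambda>p :: real \<times> real. fst p) \<in> borel_measurable borel"
    by (auto intro!: borel_measurable_continuous_onI continuous_intros)
  define f where "f p = z_e (z p) - z_m (z p) $ d * g * snd p + z_mu (z p) * g * fst p $ d" for p
  define k where "k p = en p - mo p * (g * snd p) + mu p * (g * (fst p + g * (snd p)^2 / 2))" for p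
  have "AE t in lborel. t \<in> {0<..<T} \<longrightarrow> int_dom_at g L d t (\<lambda>y. f (y, t)) = (LINT x|lborel. indicator {- L<..<L} x * k (x, t))"
  proof (rule int_dom_at_strip_AE)
    have "(\<lambda>p. indicator (dom g L T d) p * z_e (z p) - indicator (dom g L T d) p * z_m (z p) $ d * g * snd p
       + indicator (dom g L T d) p * z_mu (z p) * g * fst p $ d) \<in> borel_measurable borel"
      by measurable
    then show "(\<lambda>p. indicator (dom g L T d) p * f p) \<in> borel_measurable borel"
      by (simp add: f_def algebra_simps)
    show "k \<in> borel_measurable borel" unfolding k_def[abs_def] by measurable
    show "AE p in lborel. fst p \<in> cell d \<and> p \<in> dom g L T d \<longrightarrow> f p = k (to_strip g d p)"
      using fields by eventually_elim (simp add: f_def k_def to_strip_def)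
  qed
  then show ?thesis by (simp add: energy_slice_def f_def k_def)
qed

end

section \<open>Right-sided averages and the total energy\<close>
lemma AE_lborel_pair_swap:
  fixes P :: "'a::euclidean_space \<times> 'b::euclidean_space \<Rightarrow> bool"
  assumes "AE p in lborel. P p"
  shows "AE t in lborel. AE x in lborel. P (x, t)"
proof -
  obtain N where N: "{p. \<not> P p} \<subseteq> N" "N \<in> sets borel" "emeasure lborel N = 0"
    using assms by (auto elim!: AE_E)
  have Nm [measurable]: "N \<in> sets (borel \<Otimes>\<^sub>M borel)" using N(2) by (subst borel_prod)
  have "AE p in lborel. p \<notin> N"
    using N by (intro AE_not_in) (auto intro: null_setsI)
  then have "AE p in lborel \<Otimes>\<^sub>M lborel. p \<notin> N" by (subst lborel_prod)
  then have "AE x in lborel. AE t in lborel. (x, t) \<notin> N" by (rule lborel_pair.AE_pair)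
  then have "AE t in lborel. AE x in lborel. (x, t) \<notin> N"
    by (subst lborel_pair.AE_commute[symmetric]) measurable
  then show ?thesis
    by eventually_elim (use N(1) in \<open>auto elim!: eventually_mono\<close>)
qed

lemma integral_lborel_pair_swap:
  fixes f :: "real \<times> real \<Rightarrow> real"
  assumes "integrable lborel f"
  shows "(LINT p|lborel. f p) = (LINT t|lborel. LINT x|lborel. f (x, t))"
    and "integrable lborel (\<lambda>t. LINT x|lborel. f (x, t))"
    and "AE t in lborel. integrable lborel (\<lambda>x. f (x, t))"
proof -
  have *: "integrable (lborel \<Otimes>\<^sub>M lborel) (case_prod (\<lambda>x t. f (x, t)))"
    using assms by (simp add: lborel_prod)
  show "(LINT p|lborel. f p) = (LINT t|lborel. LINT x|lborel. f (x, t))"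
    using lborel_pair.integral_snd[OF *] by (simp add: lborel_prod)
  show "integrable lborel (\<lambda>t. LINT x|lborel. f (x, t))"
    by (rule lborel_pair.integrable_snd[OF *])
  show "AE t in lborel. integrable lborel (\<lambda>x. f (x, t))"
    by (rule lborel_pair.AE_integrable_snd[OF *])
qed

text \<open>
  Quadrants generate all boxes up to null sets. The measures with densities \<open>max 0 f\<close> and \<open>max 0 (- f)\<close> are finite and
  agree on boxes, hence are equal.
\<close>
lemma AE_zero_of_box_integrals:
  fixes f :: "real \<times> real \<Rightarrow> real"
  assumes f: "integrable lborel f"
    and 0: "\<And>\<alpha> \<beta>. (LINT p|lborel. indicator ({\<alpha><..} \<times> {..<\<beta>}) p * f p) = 0"
  shows "AE p in lborel. f p = 0"
proof -
  have fm [measurable]: "f \<in> borel_measurable borel" using f by auto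
  have [measurable]: "{\<alpha><..} \<times> {..<\<beta>} \<in> sets (borel :: (real \<times> real) measure)" for \<alpha> \<beta> :: real
    by (intro borel_open open_Times) auto
  have fi: "integrable lborel (\<lambda>p. indicator A p * f p)" if "A \<in> sets borel" for A
    using integrable_mult_indicator[OF _ f, of A] that by simp
  have nl: "AE p in (lborel :: (real \<times> real) measure). fst p \<noteq> c" for c
  proof -
    have "AE q in lborel. q \<noteq> c" by (rule AE_lborel_singleton)
    then have **: "AE x in lborel. AE t in (lborel :: real measure). x \<noteq> c" by eventually_elim simp
    have "AE p in (lborel \<Otimes>\<^sub>M lborel :: (real \<times> real) measure). fst p \<noteq> c"
    proof (rule lborel_pair.AE_pair_measure)
      have "{p :: real \<times> real. fst p \<noteq> c} \<in> sets borel"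
        by (intro borel_open open_Collect_neq continuous_intros)
      then show "{p \<in> space (lborel \<Otimes>\<^sub>M lborel). fst p \<noteq> c} \<in> sets (lborel \<Otimes>\<^sub>M lborel :: (real \<times> real) measure)"
        unfolding lborel_prod by simp
      show "AE x in (lborel :: real measure). AE y in (lborel :: real measure). fst (x, y) \<noteq> c" using ** by simp
    qed
    then show ?thesis unfolding lborel_prod .
  qed
  have nl2: "AE p in (lborel :: (real \<times> real) measure). snd p \<noteq> c" for c
  proof -
    have "AE q in lborel. q \<noteq> c" by (rule AE_lborel_singleton)
    then have **: "AE x in (lborel :: real measure). AE t in (lborel :: real measure). t \<noteq> c" by simp
    have "AE p in (lborel \<Otimes>\<^sub>M lborel :: (real \<times> real) measure). snd p \<noteq> c"
    proof (rule lborel_pair.AE_pair_measure)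
      have "{p :: real \<times> real. snd p \<noteq> c} \<in> sets borel"
        by (intro borel_open open_Collect_neq continuous_intros)
      then show "{p \<in> space (lborel \<Otimes>\<^sub>M lborel). snd p \<noteq> c} \<in> sets (lborel \<Otimes>\<^sub>M lborel :: (real \<times> real) measure)"
        unfolding lborel_prod by simp
      show "AE x in (lborel :: real measure). AE y in (lborel :: real measure). snd (x, y) \<noteq> c" using ** by simp
    qed
    then show ?thesis unfolding lborel_prod .
  qed
  have box: "(LINT p|lborel. indicator (box a b) p * f p) = 0" for a b :: "real \<times> real"
  proof (cases "box a b = {}")
    case False
    obtain a1 a2 b1 b2 where ab: "a = (a1, a2)" "b = (b1, b2)" by (cases a, cases b)
    have bx: "box a b = {a1<..<b1} \<times> {a2<..<b2}" by (auto simp: ab box_def Basis_prod_def)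
    then have le: "a1 < b1" "a2 < b2" using False by auto
    define I where "I \<alpha> \<beta> p = indicator ({\<alpha><..} \<times> {..<\<beta>}) p * f p" for \<alpha> \<beta> and p :: "real \<times> real"
    have Ii: "integrable lborel (I \<alpha> \<beta>)" for \<alpha> \<beta> unfolding I_def by (intro fi) measurable
    have "AE p in lborel. indicator (box a b) p * f p = I a1 b2 p - I b1 b2 p - (I a1 a2 p - I b1 a2 p)"
      using nl[of b1] nl2[of a2]
      by eventually_elim (use le in \<open>auto simp: I_def bx indicator_def\<close>)
    then have "(LINT p|lborel. indicator (box a b) p * f p) = (LINT p|lborel. I a1 b2 p - I b1 b2 p - (I a1 a2 p - I b1 a2 p))"
      using Ii fi[of "box a b"] by (intro integral_cong_AE) auto
    also have "\<dots> = 0"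
    proof -
      have "(LINT p|lborel. I \<alpha> \<beta> p) = 0" for \<alpha> \<beta> unfolding I_def by (rule 0)
      then show ?thesis using Ii by simp
    qed
    finally show ?thesis .
  qed simp
  define M where "M s = density lborel (\<lambda>p. ennreal (max 0 (s * f p)))" for s :: real
  have emM: "emeasure (M s) A = ennreal (LINT p|lborel. indicator A p * max 0 (s * f p))" if "A \<in> sets borel" for s A
  proof -
    have i: "integrable lborel (\<lambda>p. indicator A p * max 0 (s * f p))"
      using integrable_mult_indicator[of A lborel "\<lambda>p. max 0 (s * f p)"] that f by simp
    have "emeasure (M s) A = (\<integral>\<^sup>+p. ennreal (max 0 (s * f p)) * indicator A p \<partial>lborel)"
      unfolding M_def using that by (intro emeasure_density) auto
    also have "\<dots> = (\<integral>\<^sup>+p. ennreal (indicator A p * max 0 (s * f p)) \<partial>lborel)"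
      by (intro nn_integral_cong) (simp add: indicator_def)
    also have "\<dots> = ennreal (LINT p|lborel. indicator A p * max 0 (s * f p))"
      by (rule nn_integral_eq_integral[OF i]) auto
    finally show ?thesis .
  qed
  have eqbox: "emeasure (M 1) (box a b) = emeasure (M (-1)) (box a b)" for a b
  proof -
    have i: "integrable lborel (\<lambda>p. indicator (box a b) p * max 0 (s * f p))" for s
      using integrable_mult_indicator[of "box a b" lborel "\<lambda>p. max 0 (s * f p)"] f by simp
    have "(LINT p|lborel. indicator (box a b) p * max 0 (1 * f p)) - (LINT p|lborel. indicator (box a b) p * max 0 (-1 * f p))
      = (LINT p|lborel. indicator (box a b) p * max 0 (1 * f p) - indicator (box a b) p * max 0 (-1 * f p))"
      by (rule Bochner_Integration.integral_diff[OF i i, symmetric])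
    also have "\<dots> = (LINT p|lborel. indicator (box a b) p * f p)"
      by (intro Bochner_Integration.integral_cong) (auto simp: indicator_def)
    finally show ?thesis using box[of a b] by (simp add: emM)
  qed
  have "M 1 = M (-1)"
  proof (rule measure_eqI_generator_eq)
    let ?E = "range (\<lambda>(a, b). box a b :: (real \<times> real) set)"
    show "Int_stable ?E" by (auto simp: Int_stable_def box_Int_box)
    show "?E \<subseteq> Pow UNIV" "sets (M 1) = sigma_sets UNIV ?E" "sets (M (-1)) = sigma_sets UNIV ?E"
      by (simp_all add: M_def borel_eq_box)
    let ?A = "\<lambda>n::nat. box (- (real n *\<^sub>R One)) (real n *\<^sub>R One) :: (real \<times> real) set"
    show "range ?A \<subseteq> ?E" "(\<Union>i. ?A i) = UNIV"
      unfolding UN_box_eq_UNIV by auto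
    show "emeasure (M 1) (?A i) \<noteq> \<infinity>" for i by (simp add: emM)
    show "emeasure (M 1) X = emeasure (M (-1)) X" if "X \<in> ?E" for X
      using that eqbox by auto
  qed
  then have "AE p in lborel. ennreal (max 0 (1 * f p)) = ennreal (max 0 (-1 * f p))"
    unfolding M_def by (subst (asm) sigma_finite_measure.density_unique_iff[OF sigma_finite_lborel]) auto
  then show ?thesis
    by eventually_elim (auto simp: max_def split: if_splits)
qed

lemma right_average_tendsto:
  fixes c C :: "real \<Rightarrow> real"
  assumes C: "\<And>s. (C has_real_derivative c s) (at s)" and c: "continuous_on UNIV c"
    and W: "AE s in lborel. s \<in> {0<..<T} \<longrightarrow> W s = c s" "(\<lambda>s. indicator {0<..<T} s * W s) \<in> borel_measurable borel"
    and t: "0 \<le> t" "t < T"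
  shows "((\<lambda>\<delta>. (LINT s:{t<..<t + \<delta>}|lborel. W s) / \<delta>) \<longlongrightarrow> c t) (at_right 0)"
proof -
  have "((\<lambda>\<delta>. (C (t + \<delta>) - C t) / \<delta>) \<longlongrightarrow> c t) (at_right 0)"
    using C[of t] unfolding DERIV_def by (rule tendsto_within_subset) simp
  then show ?thesis
  proof (rule Lim_transform_eventually)
    have "\<forall>\<^sub>F \<delta> in at_right 0. \<delta> < T - t"
      using t by (intro eventually_at_rightI[of 0 "T - t"]) auto
    moreover have "\<forall>\<^sub>F \<delta> in at_right 0. 0 < (\<delta>::real)" by (simp add: eventually_at_right_less)
    ultimately show "\<forall>\<^sub>F \<delta> in at_right 0. (C (t + \<delta>) - C t) / \<delta> = (LINT s:{t<..<t + \<delta>}|lborel. W s) / \<delta>"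
    proof eventually_elim
      case (elim \<delta>)
      have cm [measurable]: "c \<in> borel_measurable borel" using c by (rule borel_measurable_continuous_onI)
      have [measurable]: "(\<lambda>s. indicator {t<..<t + \<delta>} s * (indicator {0<..<T} s * W s)) \<in> borel_measurable borel"
        using W(2) by measurable
      have e: "(\<lambda>s. indicator {t<..<t + \<delta>} s * (indicator {0<..<T} s * W s)) = (\<lambda>s. indicator {t<..<t + \<delta>} s * W s)"
        using elim t by (auto simp: indicator_def)
      have "(LINT s:{t<..<t + \<delta>}|lborel. W s) = (LINT s:{t<..<t + \<delta>}|lborel. c s)"
        unfolding set_lebesgue_integral_def real_scaleR_def e[symmetric]
      proof (rule integral_cong_AE)
        show "AE s in lborel. indicator {t<..<t + \<delta>} s * (indicator {0<..<T} s * W s) = indicator {t<..<t + \<delta>} s * c s"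
          using W(1) by eventually_elim (use elim t in \<open>auto simp: indicator_def\<close>)
      qed measurable
      also have "\<dots> = integral {t<..<t + \<delta>} c"
      proof (rule set_borel_integral_eq_integral(2))
        have "set_integrable lborel {t..t + \<delta>} c" by (rule borel_integrable_atLeastAtMost') (rule continuous_on_subset[OF c], simp)
        then show "set_integrable lborel {t<..<t + \<delta>} c" by (rule set_integrable_subset) auto
      qed
      also have "\<dots> = integral {t..t + \<delta>} c" by (rule integral_open_interval_real[symmetric])
      also have "\<dots> = C (t + \<delta>) - C t"
        using elim by (intro integral_unique fundamental_theorem_of_calculus)
          (auto simp flip: has_real_derivative_iff_has_vector_derivative intro: DERIV_subset[OF C])
      finally show ?case by simp
    qed
  qed
qed

context strip_state begin

text \<open>The integrand of the total energy in the moving frame, where the height is \<open>x + g t\<^sup>2 / 2\<close>.\<close>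
definition energy_dens :: "real \<times> real \<Rightarrow> real" where
  "energy_dens p = en p - mo p * (g * snd p) + mu p * (g * (fst p + g * (snd p)^2 / 2))"

lemma energy_dens_measurable [measurable]: "energy_dens \<in> borel_measurable borel"
proof -
  note meas [measurable]
  have [measurable]: "(\<lambda>p :: real \<times> real. snd p) \<in> borel_measurable borel" "(\<lambda>p :: real \<times> real. fst p) \<in> borel_measurable borel"
    by (auto intro!: borel_measurable_continuous_onI continuous_intros)
  show ?thesis unfolding energy_dens_def[abs_def] by measurable
qed

lemma energy_dens_integrable:
  assumes "continuous_on UNIV c"
  shows "integrable lborel (\<lambda>p. indicator (strip L T) p * (energy_dens p * c (snd p)))"
proof -
  have cs: "continuous_on UNIV (\<lambda>p::real \<times> real. c (snd p))"
    by (rule continuous_on_compose2[OF assms]) (auto intro!: continuous_intros)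
  have i: "integrable lborel (\<lambda>p. indicator (strip L T) p * (en p * c (snd p)))"
    "integrable lborel (\<lambda>p. indicator (strip L T) p * (mo p * (g * snd p * c (snd p))))"
    "integrable lborel (\<lambda>p. indicator (strip L T) p * (mu p * (g * (fst p + g * (snd p)^2 / 2) * c (snd p))))"
    by (rule strip_integrable[OF meas(3) bdd(3)] strip_integrable[OF meas(2) bdd(2)] strip_integrable[OF meas(1) bdd(1)];
        intro continuous_intros cs; simp)+
  have "(\<lambda>p. indicator (strip L T) p * (energy_dens p * c (snd p))) = (\<lambda>p. indicator (strip L T) p * (en p * c (snd p))
     - indicator (strip L T) p * (mo p * (g * snd p * c (snd p)))
     + indicator (strip L T) p * (mu p * (g * (fst p + g * (snd p)^2 / 2) * c (snd p))))"
    by (auto simp: energy_dens_def algebra_simps)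
  then show ?thesis using i by simp
qed

lemma energy_dens_int: "integrable lborel (\<lambda>p. indicator (strip L T) p * energy_dens p)"
  using energy_dens_integrable[of "\<lambda>_. 1"] by simp

lemma energy_slice_eq:
  "AE t in lborel. t \<in> {0<..<T} \<longrightarrow> energy_slice g L d z t = (LINT x|lborel. indicator {- L<..<L} x * energy_dens (x, t))"
  using energy_slice_strip by (simp add: energy_dens_def)

lemma energy_slice_measurable: "(\<lambda>t. indicator {0<..<T} t * energy_slice g L d z t) \<in> borel_measurable borel"
proof -
  note Linf_fields_measurable[OF weak_solution_Linf[OF ws], measurable]
  have [measurable]: "(\<lambda>p :: (real^'n) \<times> real. snd p) \<in> borel_measurable borel" "(\<lambda>p :: (real^'n) \<times> real. fst p $ d) \<in> borel_measurable borel"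
    by (auto intro!: borel_measurable_continuous_onI continuous_intros)
  define f where "f p = indicator (cell d \<times> UNIV) p * (indicator (dom g L T d) p * z_e (z p) - indicator (dom g L T d) p * z_m (z p) $ d * g * snd p
       + indicator (dom g L T d) p * z_mu (z p) * g * fst p $ d)" for p
  have "f \<in> borel_measurable borel" unfolding f_def[abs_def] by measurable
  then have "f \<in> borel_measurable (borel \<Otimes>\<^sub>M borel)" by (simp add: borel_prod)
  then have "(\<lambda>(t, y). f (y, t)) \<in> borel_measurable (borel \<Otimes>\<^sub>M lborel)" by measurable
  then have [measurable]: "(\<lambda>t. LINT y|lborel. f (y, t)) \<in> borel_measurable borel"
    using lborel.borel_measurable_lebesgue_integral by fastforce
  have "indicator {0<..<T} t * energy_slice g L d z t = indicator {0<..<T} t * (LINT y|lborel. f (y, t))" for t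
  proof (cases "t \<in> {0<..<T}")
    case True
    then have "energy_slice g L d z t = (LINT y|lborel. f (y, t))"
      unfolding energy_slice_def int_dom_at_def set_lebesgue_integral_def f_def
      by (intro Bochner_Integration.integral_cong) (auto simp: indicator_def dom_at_def dom_def)
    then show ?thesis by simp
  qed simp
  then have "(\<lambda>t. indicator {0<..<T} t * energy_slice g L d z t) = (\<lambda>t. indicator {0<..<T} t * (LINT y|lborel. f (y, t)))"
    by (intro ext)
  then show ?thesis by (simp only:) measurable
qed

lemma energy_dens_time_integral:
  assumes c [measurable]: "c \<in> borel_measurable borel" and B: "\<And>s. \<bar>c s\<bar> \<le> B"
  shows "strip_int (\<lambda>p. energy_dens p * c (snd p)) = (LINT s|lborel. indicator {0<..<T} s * energy_slice g L d z s * c s)"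
    and "integrable lborel (\<lambda>s. indicator {0<..<T} s * energy_slice g L d z s * c s)"
proof -
  have [measurable]: "(\<lambda>p :: real \<times> real. c (snd p)) \<in> borel_measurable borel"
    by (rule measurable_compose[OF _ c]) (auto intro!: borel_measurable_continuous_onI continuous_intros)
  have i: "integrable lborel (\<lambda>p. indicator (strip L T) p * (energy_dens p * c (snd p)))"
  proof (rule Bochner_Integration.integrable_bound[OF integrable_mult_right[OF energy_dens_int, of B]])
    show "AE p in lborel. norm (indicator (strip L T) p * (energy_dens p * c (snd p))) \<le> norm (B * (indicator (strip L T) p * energy_dens p))"
    proof (rule AE_I2)
      fix p :: "real \<times> real"
      have "\<bar>c (snd p)\<bar> \<le> \<bar>B\<bar>" using B[of "snd p"] by linarith
      then have "\<bar>c (snd p)\<bar> * \<bar>energy_dens p\<bar> \<le> \<bar>B\<bar> * \<bar>energy_dens p\<bar>" by (intro mult_right_mono) auto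
      then show "norm (indicator (strip L T) p * (energy_dens p * c (snd p))) \<le> norm (B * (indicator (strip L T) p * energy_dens p))"
        by (auto simp: abs_mult indicator_def mult.commute)
    qed
  qed measurable
  note sw = integral_lborel_pair_swap[OF i]
  have inner: "(LINT x|lborel. indicator (strip L T) (x, t) * (energy_dens (x, t) * c (snd (x, t)))) =
     indicator {0<..<T} t * (LINT x|lborel. indicator {- L<..<L} x * energy_dens (x, t)) * c t" for t
  proof -
    have "(LINT x|lborel. indicator (strip L T) (x, t) * (energy_dens (x, t) * c (snd (x, t)))) =
      (LINT x|lborel. (indicator {0<..<T} t * c t) * (indicator {- L<..<L} x * energy_dens (x, t)))"
      by (intro Bochner_Integration.integral_cong) (auto simp: strip_def indicator_def)
    then show ?thesis by simp
  qed
  note energy_slice_measurable [measurable]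
  have ae: "AE t in lborel. indicator {0<..<T} t * (LINT x|lborel. indicator {- L<..<L} x * energy_dens (x, t)) * c t =
      indicator {0<..<T} t * energy_slice g L d z t * c t"
    using energy_slice_eq by eventually_elim (auto simp: indicator_def)
  have m: "(\<lambda>t. indicator {0<..<T} t * (LINT x|lborel. indicator {- L<..<L} x * energy_dens (x, t)) * c t) \<in> borel_measurable lborel"
    using borel_measurable_integrable[OF sw(2)] unfolding inner .
  show "strip_int (\<lambda>p. energy_dens p * c (snd p)) = (LINT s|lborel. indicator {0<..<T} s * energy_slice g L d z s * c s)"
    unfolding sw(1) inner by (rule integral_cong_AE[OF m _ ae]) measurable
  show "integrable lborel (\<lambda>s. indicator {0<..<T} s * energy_slice g L d z s * c s)"
    using sw(2) unfolding inner by (subst (asm) integrable_cong_AE[OF m _ ae]) measurable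
qed

definition right_av :: "real \<Rightarrow> real \<Rightarrow> real" where
  "right_av t \<delta> = (LINT s:{t<..<t + \<delta>}|lborel. energy_slice g L d z s) / \<delta>"

lemma right_av_strip:
  assumes "0 \<le> t" "t + \<delta> \<le> T"
  shows "right_av t \<delta> = strip_int (\<lambda>p. energy_dens p * (indicator {t<..<t + \<delta>} (snd p) / \<delta>))"
proof -
  have "strip_int (\<lambda>p. energy_dens p * (indicator {t<..<t + \<delta>} (snd p) / \<delta>)) =
    (LINT s|lborel. indicator {0<..<T} s * energy_slice g L d z s * (indicator {t<..<t + \<delta>} s / \<delta>))"
    by (rule energy_dens_time_integral(1)[where B = "\<bar>1 / \<delta>\<bar>"]) (auto simp: indicator_def)
  also have "\<dots> = (LINT s|lborel. (indicator {t<..<t + \<delta>} s * energy_slice g L d z s) / \<delta>)"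
    using assms by (intro Bochner_Integration.integral_cong) (auto simp: indicator_def)
  also have "\<dots> = right_av t \<delta>" by (simp add: right_av_def set_lebesgue_integral_def)
  finally show ?thesis by (rule sym)
qed

text \<open>The energy of the initial data.\<close>
definition E0 :: real where
  "E0 = (LINT x|lborel. indicator {- L<..<L} x * (rho0 \<rho>m \<rho>p x * (g * x)))"

text \<open>The energy inequality for test functions whose time derivatives are merely bounded pointwise limits of smooth ones.\<close>
lemma energy_balance_limit:
  fixes c :: "nat \<Rightarrow> real \<Rightarrow> real"
  assumes h: "\<And>n. smooth (h n)" "\<And>n s. (h n has_real_derivative c n s) (at s)" "\<And>n s. 0 \<le> h n s"
    and \<tau>: "\<tau> < T" "\<And>n s. \<tau> \<le> s \<Longrightarrow> h n s = 0"
    and lim: "\<And>s. (\<lambda>n. c n s) \<longlonglongrightarrow> c' s" and B: "\<And>n s. \<bar>c n s\<bar> \<le> B"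
    and h0: "(\<lambda>n. h n 0) \<longlonglongrightarrow> h0"
  shows "0 \<le> strip_int (\<lambda>p. energy_dens p * c' (snd p)) + h0 * E0"
proof -
  have c_cont: "continuous_on UNIV (c n)" for n
    using smooth_deriv[OF h(1,2)] by (rule continuous_on_smooth)
  have c2: "continuous_on UNIV (\<lambda>p::real \<times> real. c n (snd p))" for n
    by (rule continuous_on_compose2[OF c_cont]) (auto intro!: continuous_intros)
  have c'm: "c' \<in> borel_measurable borel"
    by (rule borel_measurable_LIMSEQ_real[OF lim]) (auto intro: borel_measurable_continuous_onI c_cont)
  have [measurable]: "(\<lambda>p::real \<times> real. c' (snd p)) \<in> borel_measurable borel"
    by (rule measurable_compose[OF _ c'm]) (auto intro!: borel_measurable_continuous_onI continuous_intros)
  note c2[THEN borel_measurable_continuous_onI, measurable]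
  have 1: "(\<lambda>n. strip_int (\<lambda>p. energy_dens p * c n (snd p))) \<longlonglongrightarrow> strip_int (\<lambda>p. energy_dens p * c' (snd p))"
  proof (rule integral_dominated_convergence[where w = "\<lambda>p. \<bar>B * (indicator (strip L T) p * energy_dens p)\<bar>"])
    show "AE p in lborel. (\<lambda>n. indicator (strip L T) p * (energy_dens p * c n (snd p))) \<longlonglongrightarrow> indicator (strip L T) p * (energy_dens p * c' (snd p))"
      by (intro AE_I2 tendsto_intros lim)
    show "AE p in lborel. norm (indicator (strip L T) p * (energy_dens p * c n (snd p))) \<le> \<bar>B * (indicator (strip L T) p * energy_dens p)\<bar>" for n
    proof (rule AE_I2)
      fix p :: "real \<times> real"
      have "\<bar>c n (snd p)\<bar> \<le> \<bar>B\<bar>" using B[of n "snd p"] by linarith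
      then have "\<bar>c n (snd p)\<bar> * \<bar>energy_dens p\<bar> \<le> \<bar>B\<bar> * \<bar>energy_dens p\<bar>" by (intro mult_right_mono) auto
      then show "norm (indicator (strip L T) p * (energy_dens p * c n (snd p))) \<le> \<bar>B * (indicator (strip L T) p * energy_dens p)\<bar>"
        by (auto simp: abs_mult indicator_def mult.commute)
    qed
    show "integrable lborel (\<lambda>p. \<bar>B * (indicator (strip L T) p * energy_dens p)\<bar>)"
      by (intro integrable_abs integrable_mult_right energy_dens_int)
  qed measurable
  have "(\<lambda>n. strip_int (\<lambda>p. energy_dens p * c n (snd p)) + h n 0 * E0) \<longlonglongrightarrow> strip_int (\<lambda>p. energy_dens p * c' (snd p)) + h0 * E0"
    by (intro tendsto_intros 1 h0)
  moreover have "0 \<le> strip_int (\<lambda>p. energy_dens p * c n (snd p)) + h n 0 * E0" for n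
    using energy_balance[OF h \<tau>, of n] by (simp add: energy_dens_def E0_def)
  ultimately show ?thesis by (intro LIMSEQ_le_const) auto
qed

text \<open>
  The difference of the two averages is the energy tested with
  \<open>h' = 1 / \<delta>1\<close> on \<open>(t, t + \<delta>1)\<close> minus \<open>1 / \<delta>2\<close> on \<open>(t, t + \<delta>2)\<close>. The primitive \<open>h\<close> vanishing after \<open>t + \<delta>2\<close> is the
  difference of the slopes of the positive part over \<open>[t - s, t - s + \<delta>2]\<close> and \<open>[t - s, t - s + \<delta>1]\<close>. It is nonnegative by
  convexity and vanishes for \<open>s = 0\<close>, where both slopes are \<open>1\<close>. The ramp \<^const>\<open>sramp\<close> keeps these properties, the last one in the limit.
\<close>
lemma right_av_antimono:
  assumes t: "0 \<le> t" and \<delta>: "0 < \<delta>1" "\<delta>1 \<le> \<delta>2" "t + \<delta>2 < T"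
  shows "right_av t \<delta>2 \<le> right_av t \<delta>1"
proof -
  define B where "B n y = sramp (real (Suc n) * y) / real (Suc n)" for n y
  define c where "c n s = (sstep (real (Suc n) * (t + \<delta>1 - s)) - sstep (real (Suc n) * (t - s))) / \<delta>1
     - (sstep (real (Suc n) * (t + \<delta>2 - s)) - sstep (real (Suc n) * (t - s))) / \<delta>2" for n s
  define h where "h n s = (B n (t + \<delta>2 - s) - B n (t - s)) / \<delta>2 - (B n (t + \<delta>1 - s) - B n (t - s)) / \<delta>1" for n s
  \<comment> \<open>The pointwise limit of the smooth steps; it differs from the indicators of the open intervals only at \<open>s = t\<close>.\<close>
  define c' where "c' s = ((if s < t + \<delta>1 then 1 else 0) - (if s < t then 1 else 0)) / \<delta>1
     - ((if s < t + \<delta>2 then 1 else 0) - (if s < t then 1 else 0)) / \<delta>2" for s :: real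
  have Bd: "((\<lambda>s. B n (u - s)) has_real_derivative - sstep (real (Suc n) * (u - s))) (at s)" for n u s
  proof -
    have "((\<lambda>s. sramp (real (Suc n) * (u - s))) has_real_derivative sstep (real (Suc n) * (u - s)) * (real (Suc n) * - 1)) (at s)"
      by (rule DERIV_chain2[OF sramp_has_real_derivative]) (auto intro!: derivative_eq_intros)
    from DERIV_cdivide[OF this, of "real (Suc n)"] show ?thesis
      by (simp add: B_def del: of_nat_Suc)
  qed
  have Bs: "smooth (\<lambda>s. B n (u - s))" for n u
  proof -
    have "smooth (\<lambda>s. (1 / real (Suc n)) * sramp (real (Suc n) * (u - s)))"
      by (intro smooth_mult smooth_const smooth_compose[OF smooth_sramp] smooth_diff smooth_linear bounded_linear_ident)
    then show ?thesis by (simp add: B_def del: of_nat_Suc)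
  qed
  have "0 \<le> strip_int (\<lambda>p. energy_dens p * c' (snd p)) + ((max 0 (t + \<delta>2) - max 0 t) / \<delta>2 - (max 0 (t + \<delta>1) - max 0 t) / \<delta>1) * E0"
  proof (rule energy_balance_limit)
    show "smooth (h n)" for n
    proof -
      have "smooth (\<lambda>s. (1 / \<delta>2) * (B n (t + \<delta>2 - s) - B n (t - s)) - (1 / \<delta>1) * (B n (t + \<delta>1 - s) - B n (t - s)))"
        by (intro smooth_diff smooth_mult smooth_const Bs)
      then show ?thesis by (simp add: h_def[abs_def])
    qed
    show "(h n has_real_derivative c n s) (at s)" for n s
    proof -
      have "(h n has_real_derivative (- sstep (real (Suc n) * (t + \<delta>2 - s)) - - sstep (real (Suc n) * (t - s))) / \<delta>2
          - (- sstep (real (Suc n) * (t + \<delta>1 - s)) - - sstep (real (Suc n) * (t - s))) / \<delta>1) (at s)"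
        unfolding h_def[abs_def] by (intro DERIV_diff DERIV_cdivide Bd)
      then show ?thesis by (rule back_subst) (use \<delta> in \<open>simp add: c_def field_simps del: of_nat_Suc\<close>)
    qed
    show "0 \<le> h n s" for n s
    proof -
      have "(sramp (real (Suc n) * (t - s) + real (Suc n) * \<delta>1) - sramp (real (Suc n) * (t - s))) / (real (Suc n) * \<delta>1)
         \<le> (sramp (real (Suc n) * (t - s) + real (Suc n) * \<delta>2) - sramp (real (Suc n) * (t - s))) / (real (Suc n) * \<delta>2)"
        using \<delta> by (intro sramp_slope_mono mult_left_mono) auto
      moreover have "real (Suc n) * (t - s) + real (Suc n) * \<delta> = real (Suc n) * (t + \<delta> - s)" for \<delta>
        by (simp only: distrib_left[symmetric]) (simp add: algebra_simps)
      ultimately show ?thesis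
        by (simp add: h_def B_def diff_divide_distrib[symmetric] divide_divide_eq_left del: of_nat_Suc)
    qed
    show "t + \<delta>2 < T" by fact
    show "h n s = 0" if "t + \<delta>2 \<le> s" for n s
      using that \<delta> by (simp add: h_def B_def mult_nonneg_nonpos)
    show "(\<lambda>n. c n s) \<longlonglongrightarrow> c' s" for s
    proof -
      have "(\<lambda>n. sstep (real (Suc n) * (u - s))) \<longlonglongrightarrow> (if s < u then 1 else 0)" for u
        using LIMSEQ_Suc[OF sstep_tendsto_1[of "u - s"]] by simp
      then show ?thesis unfolding c_def c'_def by (intro tendsto_intros) (use \<delta> in auto)
    qed
    show "\<bar>c n s\<bar> \<le> 1 / \<delta>1 + 1 / \<delta>2" for n s
    proof -
      have *: "\<bar>(sstep x - sstep y) / \<delta>\<bar> \<le> 1 / \<delta>" if "0 < \<delta>" for x y \<delta>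
        using that sstep_nonneg[of x] sstep_nonneg[of y] sstep_le_1[of x] sstep_le_1[of y]
        by (auto simp: abs_le_iff divide_simps)
      show ?thesis
        unfolding c_def using *[of \<delta>1] *[of \<delta>2] \<delta> by (intro order_trans[OF abs_triangle_ineq4] add_mono) auto
    qed
    have "(\<lambda>n. B n y) \<longlonglongrightarrow> max 0 y" for y
      unfolding B_def by (rule LIMSEQ_Suc[OF sramp_tendsto])
    then show "(\<lambda>n. h n 0) \<longlonglongrightarrow> (max 0 (t + \<delta>2) - max 0 t) / \<delta>2 - (max 0 (t + \<delta>1) - max 0 t) / \<delta>1"
      unfolding h_def by (intro tendsto_intros) (use \<delta> in auto)
  qed
  moreover have "(max 0 (t + \<delta>2) - max 0 t) / \<delta>2 - (max 0 (t + \<delta>1) - max 0 t) / \<delta>1 = 0"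
    using t \<delta> by simp
  ultimately have 0: "0 \<le> strip_int (\<lambda>p. energy_dens p * c' (snd p))" by simp
  have [measurable]: "c' \<in> borel_measurable borel" unfolding c'_def[abs_def] by measurable
  have cb: "\<bar>c' s\<bar> \<le> 1 / \<delta>1 + 1 / \<delta>2" for s
  proof -
    have "\<bar>1 / \<delta>1 - 1 / \<delta>2\<bar> \<le> 1 / \<delta>1 + 1 / \<delta>2"
      using \<delta> by (intro order_trans[OF abs_triangle_ineq4]) auto
    then show ?thesis using \<delta> by (auto simp: c'_def)
  qed
  have ib: "\<bar>indicator {t<..<t + \<delta>} s / \<delta>\<bar> \<le> \<bar>1 / \<delta>\<bar>" for s \<delta> :: real
    by (auto simp: indicator_def)
  note i = energy_dens_time_integral[where c = "\<lambda>s. indicator {t<..<t + \<delta>} s / \<delta>" for \<delta>, OF _ ib]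
  note ic = energy_dens_time_integral[of c', OF _ cb]
  note energy_slice_measurable [measurable]
  have "strip_int (\<lambda>p. energy_dens p * c' (snd p)) = (LINT s|lborel. indicator {0<..<T} s * energy_slice g L d z s * c' s)"
    by (rule ic(1)) measurable
  also have "\<dots> = (LINT s|lborel. indicator {0<..<T} s * energy_slice g L d z s * (indicator {t<..<t + \<delta>1} s / \<delta>1)
      - indicator {0<..<T} s * energy_slice g L d z s * (indicator {t<..<t + \<delta>2} s / \<delta>2))"
  proof (rule integral_cong_AE)
    have "AE s in lborel. s \<noteq> t" by (rule AE_lborel_singleton)
    then show "AE s in lborel. indicator {0<..<T} s * energy_slice g L d z s * c' s =
      indicator {0<..<T} s * energy_slice g L d z s * (indicator {t<..<t + \<delta>1} s / \<delta>1)
      - indicator {0<..<T} s * energy_slice g L d z s * (indicator {t<..<t + \<delta>2} s / \<delta>2)"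
      by eventually_elim (use \<delta> in \<open>auto simp: c'_def indicator_def algebra_simps\<close>)
  qed measurable
  also have "\<dots> = strip_int (\<lambda>p. energy_dens p * (indicator {t<..<t + \<delta>1} (snd p) / \<delta>1)) - strip_int (\<lambda>p. energy_dens p * (indicator {t<..<t + \<delta>2} (snd p) / \<delta>2))"
  proof -
    have m: "(\<lambda>s. indicator {t<..<t + \<delta>} s / \<delta>) \<in> borel_measurable borel" for \<delta> :: real by measurable
    show ?thesis
      unfolding i(1)[OF m] by (rule Bochner_Integration.integral_diff[OF i(2)[OF m] i(2)[OF m]])
  qed
  also have "\<dots> = right_av t \<delta>1 - right_av t \<delta>2" using t \<delta> by (simp add: right_av_strip)
  finally show ?thesis using 0 by simp
qed

text \<open>Here \<open>h\<close> decreases linearly from \<open>1\<close> to \<open>0\<close> on \<open>(0, \<delta>)\<close>, so the initial energy appears with coefficient \<open>1\<close>.\<close>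
lemma right_av_0_le_E0:
  assumes \<delta>: "0 < \<delta>" "\<delta> < T"
  shows "right_av 0 \<delta> \<le> E0"
proof -
  define h where "h n s = sramp (real (Suc n) * (\<delta> - s)) / (real (Suc n) * \<delta>)" for n s
  define c where "c n s = - sstep (real (Suc n) * (\<delta> - s)) / \<delta>" for n s
  define c' where "c' s = - (if s < \<delta> then 1 else 0) / \<delta>" for s :: real
  have "0 \<le> strip_int (\<lambda>p. energy_dens p * c' (snd p)) + (max 0 \<delta> / \<delta>) * E0"
  proof (rule energy_balance_limit)
    show "smooth (h n)" for n
    proof -
      have "smooth (\<lambda>s. (1 / (real (Suc n) * \<delta>)) * sramp (real (Suc n) * (\<delta> - s)))"
        by (intro smooth_mult smooth_const smooth_compose[OF smooth_sramp] smooth_diff smooth_linear bounded_linear_ident)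
      then show ?thesis by (simp add: h_def[abs_def] del: of_nat_Suc)
    qed
    show "(h n has_real_derivative c n s) (at s)" for n s
    proof -
      have "((\<lambda>s. sramp (real (Suc n) * (\<delta> - s))) has_real_derivative sstep (real (Suc n) * (\<delta> - s)) * (real (Suc n) * - 1)) (at s)"
        by (rule DERIV_chain2[OF sramp_has_real_derivative]) (auto intro!: derivative_eq_intros)
      from DERIV_cdivide[OF this, of "real (Suc n) * \<delta>"] show ?thesis
        by (simp add: h_def[abs_def] c_def del: of_nat_Suc)
    qed
    show "0 \<le> h n s" for n s using \<delta> by (simp add: h_def sramp_nonneg)
    show "\<delta> < T" by fact
    show "h n s = 0" if "\<delta> \<le> s" for n s using that by (simp add: h_def mult_nonneg_nonpos)
    show "(\<lambda>n. c n s) \<longlonglongrightarrow> c' s" for s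
    proof -
      have "(\<lambda>n. sstep (real (Suc n) * (\<delta> - s))) \<longlonglongrightarrow> (if s < \<delta> then 1 else 0)"
        using LIMSEQ_Suc[OF sstep_tendsto_1[of "\<delta> - s"]] by simp
      then show ?thesis unfolding c_def c'_def by (intro tendsto_intros) (use \<delta> in auto)
    qed
    show "\<bar>c n s\<bar> \<le> 1 / \<delta>" for n s
      using \<delta> sstep_nonneg[of "real (Suc n) * (\<delta> - s)"] sstep_le_1[of "real (Suc n) * (\<delta> - s)"]
      by (auto simp: c_def divide_right_mono)
    have "(\<lambda>n. sramp (real (Suc n) * \<delta>) / real (Suc n) / \<delta>) \<longlonglongrightarrow> max 0 \<delta> / \<delta>"
      by (intro tendsto_divide LIMSEQ_Suc[OF sramp_tendsto] tendsto_const) (use \<delta> in auto)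
    then show "(\<lambda>n. h n 0) \<longlonglongrightarrow> max 0 \<delta> / \<delta>" by (simp add: h_def del: of_nat_Suc)
  qed
  moreover have "strip_int (\<lambda>p. energy_dens p * c' (snd p)) = - strip_int (\<lambda>p. energy_dens p * (indicator {0<..<0 + \<delta>} (snd p) / \<delta>))"
    unfolding Bochner_Integration.integral_minus[symmetric]
    by (intro Bochner_Integration.integral_cong) (auto simp: c'_def strip_def indicator_def)
  ultimately show ?thesis using right_av_strip[of 0 \<delta>] \<delta> by simp
qed

lemma right_av_bounded_above: "\<exists>K. \<forall>\<delta>. 0 < \<delta> \<and> t + \<delta> < T \<and> 0 \<le> t \<longrightarrow> right_av t \<delta> \<le> K"
proof -
  obtain K where K: "\<And>x. x \<in> cbox (- L, 0) (L, T) \<Longrightarrow> \<bar>energy_dens x\<bar> \<le> K"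
  proof -
    define cc where "cc p = \<bar>C\<bar> + \<bar>C\<bar> * \<bar>g * snd p\<bar> + \<bar>C\<bar> * \<bar>g * (fst p + g * (snd p)^2 / 2)\<bar>" for p :: "real \<times> real"
    have "continuous_on (cbox (- L, 0) (L, T)) cc" unfolding cc_def by (intro continuous_intros; simp)
    from compact_imp_bounded[OF compact_continuous_image[OF this compact_cbox]]
    obtain K where K: "\<forall>x\<in>cbox (- L, 0) (L, T). \<bar>cc x\<bar> \<le> K" unfolding bounded_iff by auto
    have "\<bar>energy_dens p\<bar> \<le> cc p" for p
    proof -
      have "\<bar>energy_dens p\<bar> \<le> \<bar>en p\<bar> + \<bar>mo p\<bar> * \<bar>g * snd p\<bar> + \<bar>mu p\<bar> * \<bar>g * (fst p + g * (snd p)^2 / 2)\<bar>"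
      proof -
        have tri: "\<bar>a - b + c\<bar> \<le> \<bar>a\<bar> + \<bar>b\<bar> + \<bar>c\<bar>" for a b c :: real by linarith
        show ?thesis unfolding energy_dens_def abs_mult[symmetric] by (rule tri)
      qed
      also have "\<dots> \<le> cc p"
        unfolding cc_def using bdd[of p] by (intro add_mono mult_right_mono) (auto intro: order_trans[OF _ abs_ge_self])
      finally show ?thesis .
    qed
    then have "\<And>x. x \<in> cbox (- L, 0) (L, T) \<Longrightarrow> \<bar>energy_dens x\<bar> \<le> K" using K by (meson abs_le_D1 order_trans)
    then show ?thesis by (rule that)
  qed
  have sl: "(LINT x|lborel. indicator {- L<..<L} x * energy_dens (x, s)) \<le> 2 * \<bar>L\<bar> * \<bar>K\<bar>" if "s \<in> {0<..<T}" for s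
  proof -
    have "(LINT x|lborel. indicator {- L<..<L} x * energy_dens (x, s)) \<le> (LINT x|lborel. indicator {- \<bar>L\<bar><..<\<bar>L\<bar>} x * \<bar>K\<bar>)"
    proof (rule integral_mono')
      show "integrable lborel (\<lambda>x. indicator {- \<bar>L\<bar><..<\<bar>L\<bar>} x * \<bar>K\<bar>)" by simp
      show "indicator {- L<..<L} x * energy_dens (x, s) \<le> indicator {- \<bar>L\<bar><..<\<bar>L\<bar>} x * \<bar>K\<bar>" for x
        using K[of "(x, s)"] that by (auto simp: indicator_def)
    qed auto
    then show ?thesis by simp
  qed
  show ?thesis
  proof (intro exI allI impI)
    fix \<delta> assume *: "0 < \<delta> \<and> t + \<delta> < T \<and> 0 \<le> t"
    note energy_slice_measurable [measurable]
    have i: "integrable lborel (\<lambda>s. indicator {0<..<T} s * energy_slice g L d z s * indicator {t<..<t + \<delta>} s)"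
      by (rule energy_dens_time_integral(2)[where B = 1]) (auto simp: indicator_def)
    have ii: "integrable lborel (indicator {t<..<t + \<delta>} :: real \<Rightarrow> real)"
      using * by (intro integrable_real_indicator) auto
    have "(LINT s:{t<..<t + \<delta>}|lborel. energy_slice g L d z s) = (LINT s|lborel. indicator {0<..<T} s * energy_slice g L d z s * indicator {t<..<t + \<delta>} s)"
      unfolding set_lebesgue_integral_def using * by (intro Bochner_Integration.integral_cong) (auto simp: indicator_def)
    also have "\<dots> \<le> (LINT s|lborel. indicator {t<..<t + \<delta>} s * (2 * \<bar>L\<bar> * \<bar>K\<bar>))"
    proof (rule integral_mono_AE[OF i])
      show "AE s in lborel. indicator {0<..<T} s * energy_slice g L d z s * indicator {t<..<t + \<delta>} s \<le> indicator {t<..<t + \<delta>} s * (2 * \<bar>L\<bar> * \<bar>K\<bar>)"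
        using energy_slice_eq by eventually_elim (use * sl in \<open>auto simp: indicator_def\<close>)
    qed (use ii in simp)
    also have "\<dots> = \<delta> * (2 * \<bar>L\<bar> * \<bar>K\<bar>)" using * by simp
    finally show "right_av t \<delta> \<le> 2 * \<bar>L\<bar> * \<bar>K\<bar>" using * by (simp add: right_av_def pos_divide_le_eq mult.commute)
  qed
qed

lemma right_av_convergent:
  assumes t: "0 \<le> t" "t < T"
  shows "\<exists>l. (right_av t \<longlongrightarrow> l) (at_right 0)"
proof -
  obtain K where K: "\<forall>\<delta>. 0 < \<delta> \<and> t + \<delta> < T \<and> 0 \<le> t \<longrightarrow> right_av t \<delta> \<le> K" using right_av_bounded_above by blast
  let ?I = "{..<T - t}"
  have "((\<lambda>\<delta>. - right_av t \<delta>) \<longlongrightarrow> Inf ((\<lambda>\<delta>. - right_av t \<delta>) ` ({0<..} \<inter> ?I))) (at 0 within ({0<..} \<inter> ?I))"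
  proof (rule Lim_right_bound[where K = "- K"])
    show "- right_av t a \<le> - right_av t b" if "b \<in> ?I" "0 < a" "a \<le> b" for a b
      using right_av_antimono[of t a b] that t by auto
    show "- K \<le> - right_av t a" if "a \<in> ?I" "0 < a" for a using K that t by auto
  qed
  moreover have "at 0 within ({0<..} \<inter> ?I) = at_right 0"
    using t by (intro at_within_nhd[of _ "{..<T - t}"]) auto
  ultimately have "((\<lambda>\<delta>. - right_av t \<delta>) \<longlongrightarrow> Inf ((\<lambda>\<delta>. - right_av t \<delta>) ` ({0<..} \<inter> ?I))) (at_right 0)" by simp
  from tendsto_minus[OF this] show ?thesis by auto
qed

lemma total_energy_tendsto:
  assumes t: "0 \<le> t" "t < T"
  shows "(right_av t \<longlongrightarrow> total_energy g L d z t) (at_right 0)"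
proof -
  obtain l where l: "(right_av t \<longlongrightarrow> l) (at_right 0)" using right_av_convergent[OF t] by blast
  then have "total_energy g L d z t = l"
    unfolding total_energy_def right_av_def[symmetric] by (intro tendsto_Lim) auto
  with l show ?thesis by simp
qed

lemma total_energy_0_le:
  assumes "0 < T"
  shows "total_energy g L d z 0 \<le> E0"
proof (rule tendsto_upperbound[OF total_energy_tendsto])
  show "\<forall>\<^sub>F \<delta> in at_right 0. right_av 0 \<delta> \<le> E0"
    using assms right_av_0_le_E0 by (intro eventually_at_rightI[of 0 T]) auto
qed (use assms in auto)

lemma total_energy_ge:
  fixes c K :: "real \<Rightarrow> real"
  assumes K: "\<And>s. (K has_real_derivative c s) (at s)" and c: "continuous_on UNIV c"
    and W: "AE s in lborel. s \<in> {0<..<T} \<longrightarrow> c s \<le> energy_slice g L d z s"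
    and t: "0 \<le> t" "t < T"
  shows "c t \<le> total_energy g L d z t"
proof (rule tendsto_le[OF _ total_energy_tendsto[OF t]])
  have "(\<lambda>s. indicator {0<..<T} s * c s) \<in> borel_measurable borel"
    using borel_measurable_continuous_onI[OF c] by measurable
  then show "((\<lambda>\<delta>. (LINT s:{t<..<t + \<delta>}|lborel. c s) / \<delta>) \<longlongrightarrow> c t) (at_right 0)"
    by (intro right_average_tendsto[OF K c _ _ t]) auto
  show "\<forall>\<^sub>F \<delta> in at_right 0. (LINT s:{t<..<t + \<delta>}|lborel. c s) / \<delta> \<le> right_av t \<delta>"
  proof (rule eventually_at_rightI[of 0 "T - t"])
    fix \<delta> assume \<delta>: "\<delta> \<in> {0<..<T - t}"
    have i: "integrable lborel (\<lambda>s. indicator {0<..<T} s * energy_slice g L d z s * indicator {t<..<t + \<delta>} s)"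
      by (rule energy_dens_time_integral(2)[where B = 1]) (auto simp: indicator_def)
    have "set_integrable lborel {t..t + \<delta>} c" by (rule borel_integrable_atLeastAtMost') (rule continuous_on_subset[OF c], simp)
    then have ic: "set_integrable lborel {t<..<t + \<delta>} c" by (rule set_integrable_subset) auto
    have "(LINT s:{t<..<t + \<delta>}|lborel. c s) \<le> (LINT s|lborel. indicator {0<..<T} s * energy_slice g L d z s * indicator {t<..<t + \<delta>} s)"
      unfolding set_lebesgue_integral_def
    proof (rule integral_mono_AE[OF _ i])
      show "AE s in lborel. indicator {t<..<t + \<delta>} s *\<^sub>R c s \<le> indicator {0<..<T} s * energy_slice g L d z s * indicator {t<..<t + \<delta>} s"
        using W by eventually_elim (use \<delta> t in \<open>auto simp: indicator_def\<close>)
    qed (use ic in \<open>simp add: set_integrable_def\<close>)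
    also have "\<dots> = (LINT s:{t<..<t + \<delta>}|lborel. energy_slice g L d z s)"
      unfolding set_lebesgue_integral_def using \<delta> t by (intro Bochner_Integration.integral_cong) (auto simp: indicator_def)
    finally show "(LINT s:{t<..<t + \<delta>}|lborel. c s) / \<delta> \<le> right_av t \<delta>"
      using \<delta> by (simp add: right_av_def divide_right_mono)
  qed (use t in simp)
qed simp

lemma total_energy_eq:
  fixes c K :: "real \<Rightarrow> real"
  assumes K: "\<And>s. (K has_real_derivative c s) (at s)" and c: "continuous_on UNIV c"
    and W: "AE s in lborel. s \<in> {0<..<T} \<longrightarrow> energy_slice g L d z s = c s"
    and t: "0 \<le> t" "t < T"
  shows "total_energy g L d z t = c t"
  unfolding total_energy_def
  by (rule tendsto_Lim[OF _ right_average_tendsto[OF K c W energy_slice_measurable t]]) simp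

end

section \<open>The energy of subsolutions over a rarefaction fan\<close>
lemma lint_Ioo_eq_integral:
  fixes f :: "real \<Rightarrow> real"
  assumes "continuous_on UNIV f"
  shows "(LINT x|lborel. indicator {a<..<b} x * f x) = integral {a..b} f"
    and "integrable lborel (\<lambda>x. indicator {a<..<b} x * f x)"
proof -
  have "set_integrable lborel {a..b} f" by (rule borel_integrable_atLeastAtMost') (rule continuous_on_subset[OF assms], simp)
  then have i: "set_integrable lborel {a<..<b} f" by (rule set_integrable_subset) auto
  then show "integrable lborel (\<lambda>x. indicator {a<..<b} x * f x)" by (simp add: set_integrable_def)
  have "(LINT x|lborel. indicator {a<..<b} x * f x) = integral {a<..<b} f"
    using set_borel_integral_eq_integral(2)[OF i] by (simp add: set_lebesgue_integral_def)
  also have "\<dots> = integral {a..b} f" by (rule integral_open_interval_real[symmetric])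
  finally show "(LINT x|lborel. indicator {a<..<b} x * f x) = integral {a..b} f" .
qed

lemma rho0_moment:
  fixes A a :: "real \<Rightarrow> real"
  assumes L: "0 < L" and A: "\<And>x. (A has_real_derivative a x) (at x)" and a: "continuous_on UNIV a"
  shows "(LINT x|lborel. indicator {- L<..<L} x * (rho0 \<rho>m \<rho>p x * a x)) = \<rho>p * A L - \<rho>m * A (- L) - (\<rho>p - \<rho>m) * A 0"
proof -
  note lint_Ioo_eq_integral(2)[OF a, simp]
  have [measurable]: "a \<in> borel_measurable borel" using a by (rule borel_measurable_continuous_onI)
  have ia: "integral {x..y} a = A y - A x" if "x \<le> y" for x y
    using that by (intro integral_unique fundamental_theorem_of_calculus)
      (auto simp flip: has_real_derivative_iff_has_vector_derivative intro: DERIV_subset[OF A])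
  have "(LINT x|lborel. indicator {- L<..<L} x * (rho0 \<rho>m \<rho>p x * a x))
    = (LINT x|lborel. \<rho>m * (indicator {- L<..<0} x * a x) + \<rho>p * (indicator {0<..<L} x * a x))"
  proof (rule integral_cong_AE)
    have "AE x in lborel. x \<noteq> (0::real)" by (rule AE_lborel_singleton)
    then show "AE x in lborel. indicator {- L<..<L} x * (rho0 \<rho>m \<rho>p x * a x) =
       \<rho>m * (indicator {- L<..<0} x * a x) + \<rho>p * (indicator {0<..<L} x * a x)"
      by eventually_elim (use L in \<open>auto simp: rho0_def indicator_def\<close>)
  qed measurable
  also have "\<dots> = \<rho>m * integral {- L..0} a + \<rho>p * integral {0..L} a"
    by (simp add: lint_Ioo_eq_integral(1)[OF a])
  also have "\<dots> = \<rho>p * A L - \<rho>m * A (- L) - (\<rho>p - \<rho>m) * A 0"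
    using L by (simp add: ia algebra_simps)
  finally show ?thesis .
qed

lemma antiderivative_exists:
  fixes f :: "real \<Rightarrow> real"
  assumes "continuous_on UNIV f"
  shows "\<exists>A. \<forall>x. (A has_real_derivative f x) (at x)"
proof -
  have "\<exists>A. \<forall>x::real. - \<infinity> < ereal x \<longrightarrow> ereal x < \<infinity> \<longrightarrow> (A has_vector_derivative f x) (at x)"
    using assms by (intro einterval_antiderivative) (auto simp: continuous_on_eq_continuous_at)
  then show ?thesis by (simp add: has_real_derivative_iff_has_vector_derivative)
qed

locale fan_state = strip_state d g L T \<rho>m \<rho>p z q \<nu> mu mo en C + convex_flux \<rho>m \<rho>p F F1 F2
  for d :: "'n::finite" and g L T \<rho>m \<rho>p :: real
    and z :: "(real^'n) \<times> real \<Rightarrow> 'n Z" and q :: "(real^'n) \<times> real \<Rightarrow> real"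
    and \<nu> :: "((real^'n) \<times> real \<Rightarrow> real) \<Rightarrow> real"
    and mu mo en :: "real \<times> real \<Rightarrow> real" and C :: real and F F1 F2 :: "real \<Rightarrow> real" +
  assumes g: "0 < g" and L: "0 < L" and T: "0 < T"
    and speed: "- L \<le> g * T^2 / 2 * F1 \<rho>m" "g * T^2 / 2 * F1 \<rho>p \<le> L"
    and mu_fan: "AE p in lborel. p \<in> strip L T \<longrightarrow> mu p = fan (fst p / (g * (snd p)^2 / 2))"
begin

definition fan_at :: "real \<times> real \<Rightarrow> real" where
  "fan_at p = fan (fst p / (g * (snd p)^2 / 2))"

lemma Ffan_cont: "continuous_on UNIV (\<lambda>\<xi>. F (fan \<xi>))"
  by (rule continuous_on_compose2[OF F_cont fan_cont]) (use fan_in in auto)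

lemma fan_at_measurable [measurable]: "fan_at \<in> borel_measurable borel" "(\<lambda>p. F (fan_at p)) \<in> borel_measurable borel"
proof -
  have [measurable]: "(\<lambda>p :: real \<times> real. snd p) \<in> borel_measurable borel" "(\<lambda>p :: real \<times> real. fst p) \<in> borel_measurable borel"
    by (auto intro!: borel_measurable_continuous_onI continuous_intros)
  have m: "(\<lambda>p :: real \<times> real. fst p / (g * (snd p)^2 / 2)) \<in> borel_measurable borel" by measurable
  show "fan_at \<in> borel_measurable borel"
    unfolding fan_at_def[abs_def] by (rule measurable_compose[OF m borel_measurable_continuous_onI[OF fan_cont]])
  show "(\<lambda>p. F (fan_at p)) \<in> borel_measurable borel"
    unfolding fan_at_def by (rule measurable_compose[OF m borel_measurable_continuous_onI[OF Ffan_cont]])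
qed

lemma fan_at_bounded: "\<bar>fan_at p\<bar> \<le> \<rho>p"
  using fan_in[of "fst p / (g * (snd p)^2 / 2)"] rho by (auto simp: fan_at_def)

lemma Ffan_at_bounded: obtains B where "\<And>p. \<bar>F (fan_at p)\<bar> \<le> B"
proof -
  from compact_imp_bounded[OF compact_continuous_image[OF F_cont compact_Icc]]
  obtain B where "\<forall>x\<in>{\<rho>m..\<rho>p}. \<bar>F x\<bar> \<le> B" unfolding bounded_iff by auto
  then have "\<bar>F (fan_at p)\<bar> \<le> B" for p using fan_in by (auto simp: fan_at_def)
  then show ?thesis by (rule that)
qed

text \<open>Integrating \<open>fan_mass_balance\<close> over the strip by Fubini.\<close>
lemma fan_strip_balance:
  assumes A: "\<And>x. (A has_real_derivative a x) (at x)"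
    and a: "\<And>x. (a has_real_derivative b x) (at x)" and b: "continuous_on UNIV b"
    and h: "\<And>t. (h has_real_derivative h1 t) (at t)" "h T = 0" and h1: "continuous_on UNIV h1"
  shows "strip_int (\<lambda>p. fan_at p * (a (fst p) * h1 (snd p))) + strip_int (\<lambda>p. F (fan_at p) * (g * snd p * b (fst p) * h (snd p)))
     = - h 0 * fan_moment L A 0"
proof -
  have a_cont: "continuous_on UNIV a" by (rule DERIV_continuous_on) (rule a)
  have h_cont: "continuous_on UNIV h" by (rule DERIV_continuous_on) (rule h)
  have cc: "continuous_on UNIV (\<lambda>p::real \<times> real. f (fst p))" "continuous_on UNIV (\<lambda>p::real \<times> real. f (snd p))" if "continuous_on UNIV f" for f :: "real \<Rightarrow> real"
    by (auto intro!: continuous_on_compose2[OF that] continuous_intros)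
  obtain B where B: "\<And>p. \<bar>F (fan_at p)\<bar> \<le> B" using Ffan_at_bounded by blast
  have i1: "integrable lborel (\<lambda>p. indicator (strip L T) p * (fan_at p * (a (fst p) * h1 (snd p))))"
    by (rule strip_integrable[OF fan_at_measurable(1) fan_at_bounded]) (intro continuous_intros cc a_cont h1)
  have i2: "integrable lborel (\<lambda>p. indicator (strip L T) p * (F (fan_at p) * (g * snd p * b (fst p) * h (snd p))))"
    by (rule strip_integrable[OF fan_at_measurable(2) B]) (intro continuous_intros cc b h_cont)
  define f where "f p = indicator (strip L T) p * (fan_at p * (a (fst p) * h1 (snd p))) + indicator (strip L T) p * (F (fan_at p) * (g * snd p * b (fst p) * h (snd p)))" for p
  have f: "integrable lborel f" unfolding f_def[abs_def] using i1 i2 by simp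
  define W where "W t = h1 t * integral {- L..L} (\<lambda>x. fan (x / (g * t^2 / 2)) * a x)
      + h t * (g * t * integral {- L..L} (\<lambda>x. F (fan (x / (g * t^2 / 2))) * b x))" for t
  have inner: "(LINT x|lborel. f (x, t)) = indicator {0<..<T} t * W t" for t
  proof (cases "t \<in> {0<..<T}")
    case False
    then have "f (x, t) = 0" for x by (auto simp: f_def strip_def)
    then show ?thesis using False by simp
  next
    case True
    define \<tau> where "\<tau> = g * t^2 / 2"
    have \<tau>: "\<tau> \<noteq> 0" using True g by (simp add: \<tau>_def)
    have c1: "continuous_on UNIV (\<lambda>x. fan (x / \<tau>) * a x)" and c2: "continuous_on UNIV (\<lambda>x. F (fan (x / \<tau>)) * b x)"
      using \<tau> by (auto intro!: continuous_intros a_cont b continuous_on_compose2[OF fan_cont] continuous_on_compose2[OF Ffan_cont])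
    have "(LINT x|lborel. f (x, t)) = (LINT x|lborel. h1 t * (indicator {- L<..<L} x * (fan (x / \<tau>) * a x))
       + (h t * (g * t)) * (indicator {- L<..<L} x * (F (fan (x / \<tau>)) * b x)))"
      using True by (intro Bochner_Integration.integral_cong) (auto simp: f_def strip_def fan_at_def \<tau>_def indicator_def)
    also have "\<dots> = h1 t * integral {- L..L} (\<lambda>x. fan (x / \<tau>) * a x) + (h t * (g * t)) * integral {- L..L} (\<lambda>x. F (fan (x / \<tau>)) * b x)"
      using lint_Ioo_eq_integral(2)[OF c1, of "- L" L] lint_Ioo_eq_integral(2)[OF c2, of "- L" L]
      by (simp add: lint_Ioo_eq_integral(1)[OF c1] lint_Ioo_eq_integral(1)[OF c2])
    finally show ?thesis using True by (simp add: W_def \<tau>_def)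
  qed
  have "strip_int (\<lambda>p. fan_at p * (a (fst p) * h1 (snd p))) + strip_int (\<lambda>p. F (fan_at p) * (g * snd p * b (fst p) * h (snd p)))
    = (LINT p|lborel. f p)"
    unfolding f_def using i1 i2 by simp
  also have "\<dots> = (LINT t:{0<..<T}|lborel. W t)"
    unfolding integral_lborel_pair_swap(1)[OF f] inner by (simp add: set_lebesgue_integral_def)
  also have "\<dots> = integral {0<..<T} W"
    using integral_lborel_pair_swap(2)[OF f] unfolding inner
    by (intro set_borel_integral_eq_integral) (simp add: set_integrable_def)
  also have "\<dots> = integral {0..T} W" by (rule integral_open_interval_real[symmetric])
  also have "\<dots> = - h 0 * fan_moment L A 0"
    unfolding W_def by (rule integral_unique[OF fan_mass_balance[OF g T speed L A a b h]])
  finally show ?thesis .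
qed

text \<open>The deviation of the momentum from the value \<open>g t (\<mu> + F \<mu>)\<close> that solves the continuity equation.\<close>
definition defect :: "real \<times> real \<Rightarrow> real" where
  "defect p = mo p - g * snd p * mu p - g * snd p * F (fan_at p)"

text \<open>
  The mass balances of the state and of the fan have the same time derivative and the same initial term; their difference
  contains only the flux. The values of \<open>a\<close> at the boundary being free, its derivative \<open>b\<close> is arbitrary.
\<close>
lemma defect_orthogonal:
  assumes a: "smooth a" "\<And>x. (a has_real_derivative b x) (at x)"
    and h: "smooth h" "\<And>t. (h has_real_derivative h1 t) (at t)" and \<tau>: "\<tau> < T" "\<And>t. \<tau> \<le> t \<Longrightarrow> h t = 0"
  shows "strip_int (\<lambda>p. defect p * (b (fst p) * h (snd p))) = 0"
    and "integrable lborel (\<lambda>p. indicator (strip L T) p * (defect p * (b (fst p) * h (snd p))))"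
proof -
  have c: "continuous_on UNIV a" "continuous_on UNIV h" "continuous_on UNIV b" "continuous_on UNIV h1"
    using a(1) h(1) smooth_deriv[OF a] smooth_deriv[OF h] by (auto intro: continuous_on_smooth)
  obtain A where A: "\<And>x. (A has_real_derivative a x) (at x)" using antiderivative_exists[OF c(1)] by blast
  have cc: "continuous_on UNIV (\<lambda>p::real \<times> real. f (fst p))" "continuous_on UNIV (\<lambda>p::real \<times> real. f (snd p))" if "continuous_on UNIV f" for f :: "real \<Rightarrow> real"
    by (auto intro!: continuous_on_compose2[OF that] continuous_intros)
  obtain B where B: "\<And>p. \<bar>F (fan_at p)\<bar> \<le> B" using Ffan_at_bounded by blast
  have i: "integrable lborel (\<lambda>p. indicator (strip L T) p * (fan_at p * (a (fst p) * h1 (snd p))))"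
    "integrable lborel (\<lambda>p. indicator (strip L T) p * (F (fan_at p) * (g * snd p * b (fst p) * h (snd p))))"
    "integrable lborel (\<lambda>p. indicator (strip L T) p * (mu p * (a (fst p) * h1 (snd p) - g * snd p * b (fst p) * h (snd p))))"
    "integrable lborel (\<lambda>p. indicator (strip L T) p * (mo p * (b (fst p) * h (snd p))))"
    "integrable lborel (\<lambda>p. indicator (strip L T) p * (mu p * (g * snd p * b (fst p) * h (snd p))))"
    by (rule strip_integrable[OF fan_at_measurable(1) fan_at_bounded] strip_integrable[OF fan_at_measurable(2) B]
        strip_integrable[OF meas(1) bdd(1)] strip_integrable[OF meas(2) bdd(2)];
        intro continuous_intros cc c; simp)+
  have "(\<lambda>p. indicator (strip L T) p * (defect p * (b (fst p) * h (snd p)))) =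
     (\<lambda>p. indicator (strip L T) p * (mo p * (b (fst p) * h (snd p))) - indicator (strip L T) p * (mu p * (g * snd p * b (fst p) * h (snd p)))
       - indicator (strip L T) p * (F (fan_at p) * (g * snd p * b (fst p) * h (snd p))))"
    by (auto simp: defect_def algebra_simps)
  then show int: "integrable lborel (\<lambda>p. indicator (strip L T) p * (defect p * (b (fst p) * h (snd p))))"
    using i by simp
  have "strip_int (\<lambda>p. defect p * (b (fst p) * h (snd p))) = (LINT p|lborel.
     indicator (strip L T) p * (mu p * (a (fst p) * h1 (snd p) - g * snd p * b (fst p) * h (snd p)))
     + indicator (strip L T) p * (mo p * (b (fst p) * h (snd p)))
     - indicator (strip L T) p * (fan_at p * (a (fst p) * h1 (snd p)))
     - indicator (strip L T) p * (F (fan_at p) * (g * snd p * b (fst p) * h (snd p))))"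
  proof (rule integral_cong_AE)
    show "AE p in lborel. indicator (strip L T) p * (defect p * (b (fst p) * h (snd p))) =
     indicator (strip L T) p * (mu p * (a (fst p) * h1 (snd p) - g * snd p * b (fst p) * h (snd p)))
     + indicator (strip L T) p * (mo p * (b (fst p) * h (snd p)))
     - indicator (strip L T) p * (fan_at p * (a (fst p) * h1 (snd p)))
     - indicator (strip L T) p * (F (fan_at p) * (g * snd p * b (fst p) * h (snd p)))"
      using mu_fan
    proof eventually_elim
      case (elim p)
      show ?case
      proof (cases "p \<in> strip L T")
        case True
        then have "fan_at p = mu p" using elim by (simp add: fan_at_def)
        then show ?thesis by (simp add: defect_def algebra_simps)
      qed simp
    qed
  qed (use int i[THEN borel_measurable_integrable] in \<open>auto intro!: borel_measurable_add borel_measurable_diff\<close>)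
  also have "\<dots> = strip_int (\<lambda>p. mu p * (a (fst p) * h1 (snd p) - g * snd p * b (fst p) * h (snd p)))
     + strip_int (\<lambda>p. mo p * (b (fst p) * h (snd p)))
     - strip_int (\<lambda>p. fan_at p * (a (fst p) * h1 (snd p)))
     - strip_int (\<lambda>p. F (fan_at p) * (g * snd p * b (fst p) * h (snd p)))"
    using i by simp
  also have "\<dots> = 0"
    using mass_balance[OF a h \<tau>] rho0_moment[OF L A c(1), of \<rho>m \<rho>p] fan_strip_balance[OF A a(2) c(3) h(2) _ c(4)] \<tau>(2)[of T] \<tau>(1)
    by (simp add: fan_moment_0)
  finally show "strip_int (\<lambda>p. defect p * (b (fst p) * h (snd p))) = 0" .
qed

text \<open>
  Smooth steps in both variables approximate the indicator of a quadrant. The cut-off \<open>t < \<tau>\<close> with \<open>\<tau> < T\<close> keeps the test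
  functions away from the final time for every quadrant.
\<close>
lemma defect_zero: "AE p in lborel. p \<in> strip L T \<longrightarrow> defect p = 0"
proof -
  have "AE p in lborel. indicator (strip L T) p * (indicator {..<\<tau>} (snd p) * defect p) = 0" if \<tau>: "\<tau> < T" for \<tau>
  proof (rule AE_zero_of_box_integrals)
    have [measurable]: "(\<lambda>p :: real \<times> real. snd p) \<in> borel_measurable borel" "(\<lambda>p :: real \<times> real. fst p) \<in> borel_measurable borel"
      by (auto intro!: borel_measurable_continuous_onI continuous_intros)
    note meas [measurable]
    have defm [measurable]: "defect \<in> borel_measurable borel" unfolding defect_def[abs_def] by measurable
    obtain B where B: "\<And>p. \<bar>F (fan_at p)\<bar> \<le> B" using Ffan_at_bounded by blast
    have i: "integrable lborel (\<lambda>p. indicator (strip L T) p * (mo p * 1))"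
      "integrable lborel (\<lambda>p. indicator (strip L T) p * (mu p * (g * snd p)))"
      "integrable lborel (\<lambda>p. indicator (strip L T) p * (F (fan_at p) * (g * snd p)))"
      by (rule strip_integrable[OF fan_at_measurable(2) B] strip_integrable[OF meas(1) bdd(1)] strip_integrable[OF meas(2) bdd(2)];
          intro continuous_intros; simp)+
    have "(\<lambda>p. indicator (strip L T) p * defect p) = (\<lambda>p. indicator (strip L T) p * (mo p * 1) - indicator (strip L T) p * (mu p * (g * snd p))
        - indicator (strip L T) p * (F (fan_at p) * (g * snd p)))"
      by (auto simp: defect_def algebra_simps)
    then have di: "integrable lborel (\<lambda>p. indicator (strip L T) p * defect p)" using i by simp
    show "integrable lborel (\<lambda>p. indicator (strip L T) p * (indicator {..<\<tau>} (snd p) * defect p))"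
      by (rule Bochner_Integration.integrable_bound[OF di]) (auto simp: indicator_def)
    fix \<alpha> \<beta> :: real
    define \<beta>' where "\<beta>' = min \<beta> \<tau>"
    define s where "s n p = sstep (real (Suc n) * (fst p - \<alpha>)) * sstep (real (Suc n) * (\<beta>' - snd p))" for n and p :: "real \<times> real"
    have s0: "strip_int (\<lambda>p. defect p * s n p) = 0" and sint: "integrable lborel (\<lambda>p. indicator (strip L T) p * (defect p * s n p))" for n
    proof -
      define a where "a x = (1 / real (Suc n)) * sramp (real (Suc n) * (x - \<alpha>))" for x
      have a: "smooth a"
        unfolding a_def[abs_def]
        by (intro smooth_mult smooth_const smooth_compose[OF smooth_sramp] smooth_diff smooth_linear bounded_linear_ident)
      have a': "(a has_real_derivative sstep (real (Suc n) * (x - \<alpha>))) (at x)" for x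
      proof -
        have "((\<lambda>x. sramp (real (Suc n) * (x - \<alpha>))) has_real_derivative sstep (real (Suc n) * (x - \<alpha>)) * real (Suc n)) (at x)"
          by (rule DERIV_chain2[OF sramp_has_real_derivative]) (auto intro!: derivative_eq_intros)
        from DERIV_cmult[OF this, of "1 / real (Suc n)"] show ?thesis by (simp add: a_def[abs_def] del: of_nat_Suc)
      qed
      define h where "h t = sstep (real (Suc n) * (\<beta>' - t))" for t
      have h: "smooth h"
        unfolding h_def[abs_def]
        by (intro smooth_compose[OF smooth_sstep] smooth_mult smooth_const smooth_diff smooth_linear bounded_linear_ident)
      have h': "(h has_real_derivative flat_exp 3 (real (Suc n) * (\<beta>' - t)) * (real (Suc n) * - 1)) (at t)" for t
        unfolding h_def[abs_def]
        by (rule DERIV_chain2[OF sstep_has_real_derivative]) (auto intro!: derivative_eq_intros)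
      have z: "h t = 0" if "\<tau> \<le> t" for t
        using that by (simp add: h_def \<beta>'_def mult_nonneg_nonpos)
      show "strip_int (\<lambda>p. defect p * s n p) = 0" "integrable lborel (\<lambda>p. indicator (strip L T) p * (defect p * s n p))"
        using defect_orthogonal[OF a a' h h' \<tau> z] by (simp_all add: s_def h_def)
    qed
    have "(\<lambda>n. strip_int (\<lambda>p. defect p * s n p)) \<longlonglongrightarrow>
       (LINT p|lborel. indicator ({\<alpha><..} \<times> {..<\<beta>}) p * (indicator (strip L T) p * (indicator {..<\<tau>} (snd p) * defect p)))"
    proof (rule integral_dominated_convergence[where w = "\<lambda>p. \<bar>indicator (strip L T) p * defect p\<bar>"])
      show "AE p in lborel. (\<lambda>n. indicator (strip L T) p * (defect p * s n p)) \<longlonglongrightarrow>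
        indicator ({\<alpha><..} \<times> {..<\<beta>}) p * (indicator (strip L T) p * (indicator {..<\<tau>} (snd p) * defect p))"
      proof (rule AE_I2)
        fix p :: "real \<times> real"
        have "(\<lambda>n. sstep (real (Suc n) * y)) \<longlonglongrightarrow> (if 0 < y then 1 else 0)" for y
          by (rule LIMSEQ_Suc[OF sstep_tendsto_1])
        then have "(\<lambda>n. indicator (strip L T) p * (defect p * s n p)) \<longlonglongrightarrow>
           indicator (strip L T) p * (defect p * ((if 0 < fst p - \<alpha> then 1 else 0) * (if 0 < \<beta>' - snd p then 1 else 0)))"
          unfolding s_def by (intro tendsto_intros)
        also have "indicator (strip L T) p * (defect p * ((if 0 < fst p - \<alpha> then 1 else 0) * (if 0 < \<beta>' - snd p then 1 else 0)))
           = indicator ({\<alpha><..} \<times> {..<\<beta>}) p * (indicator (strip L T) p * (indicator {..<\<tau>} (snd p) * defect p))"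
          by (cases p) (auto simp: indicator_def \<beta>'_def)
        finally show "(\<lambda>n. indicator (strip L T) p * (defect p * s n p)) \<longlonglongrightarrow>
           indicator ({\<alpha><..} \<times> {..<\<beta>}) p * (indicator (strip L T) p * (indicator {..<\<tau>} (snd p) * defect p))" .
      qed
      show "AE p in lborel. norm (indicator (strip L T) p * (defect p * s n p)) \<le> \<bar>indicator (strip L T) p * defect p\<bar>" for n
      proof (rule AE_I2)
        fix p :: "real \<times> real"
        have "\<bar>s n p\<bar> \<le> 1" unfolding s_def abs_mult
          using sstep_nonneg sstep_le_1 by (intro mult_le_one) auto
        then have "\<bar>indicator (strip L T) p * defect p\<bar> * \<bar>s n p\<bar> \<le> \<bar>indicator (strip L T) p * defect p\<bar> * 1"
          by (intro mult_left_mono) auto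
        then show "norm (indicator (strip L T) p * (defect p * s n p)) \<le> \<bar>indicator (strip L T) p * defect p\<bar>"
          by (simp add: abs_mult mult.assoc)
      qed
      show "integrable lborel (\<lambda>p. \<bar>indicator (strip L T) p * defect p\<bar>)" by (intro integrable_abs di)
      have [measurable]: "{\<alpha><..} \<times> {..<\<beta>} \<in> sets (borel :: (real \<times> real) measure)" by (intro borel_open open_Times) auto
      show "(\<lambda>p. indicator ({\<alpha><..} \<times> {..<\<beta>}) p * (indicator (strip L T) p * (indicator {..<\<tau>} (snd p) * defect p))) \<in> borel_measurable lborel"
        by measurable
      show "(\<lambda>p. indicator (strip L T) p * (defect p * s n p)) \<in> borel_measurable lborel" for n
        using borel_measurable_integrable[OF sint] .
    qed
    then show "(LINT p|lborel. indicator ({\<alpha><..} \<times> {..<\<beta>}) p * (indicator (strip L T) p * (indicator {..<\<tau>} (snd p) * defect p))) = 0"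
      unfolding s0 by (simp add: LIMSEQ_const_iff)
  qed
  then have "AE p in lborel. \<forall>n::nat. indicator (strip L T) p * (indicator {..<T - 1 / real (Suc n)} (snd p) * defect p) = 0"
    unfolding AE_all_countable by auto
  then show ?thesis
  proof eventually_elim
    case (elim p)
    show ?case
    proof
      assume p: "p \<in> strip L T"
      then have "0 < T - snd p" by (auto simp: strip_def)
      then obtain n where "inverse (real (Suc n)) < T - snd p" using reals_Archimedean by blast
      then show "defect p = 0" using elim[rule_format, of n] p by (simp add: inverse_eq_divide indicator_def)
    qed
  qed
qed

lemma momentum_eq:
  "AE p in lborel. p \<in> strip L T \<longrightarrow> mu p = fan_at p \<and> mo p = g * snd p * (fan_at p + F (fan_at p))"
  using defect_zero mu_fan by eventually_elim (auto simp: defect_def fan_at_def algebra_simps)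

text \<open>The energy density of a non-strict subsolution over the fan.\<close>
definition fan_dens :: "real \<Rightarrow> real \<Rightarrow> real" where
  "fan_dens t x = (let r = fan (x / (g * t^2 / 2)) in (g * t)^2 / 2 * (weight r * (F r)^2) + r * (g * x))"

lemma E0_eq: "E0 = fan_moment L (\<lambda>x. g * x^2 / 2) 0"
  unfolding E0_def fan_moment_0
  by (rule rho0_moment[OF L]) (auto intro!: derivative_eq_intros continuous_intros)

text \<open>
  The kinetic part is evaluated by substitution; the potential part is the fan moment of \<open>g x\<^sup>2 / 2\<close>, whose
  dependence on \<open>\<tau>\<close> is \<open>- g \<tau>\<^sup>2 / 2\<close> times the integral of \<open>F1\<^sup>2\<close>. Both scale like \<open>t\<^sup>4\<close>.
\<close>
lemma fan_dens_integral:
  assumes t: "t \<in> {0<..<T}"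
  shows "(LINT x|lborel. indicator {- L<..<L} x * fan_dens t x) = E0 + g^3 * t^4 / 8 * energy_coeff"
    and "integrable lborel (\<lambda>x. indicator {- L<..<L} x * fan_dens t x)"
proof -
  define \<tau> where "\<tau> = g * t^2 / 2"
  have \<tau>: "0 < \<tau>" "\<tau> \<le> g * T^2 / 2"
    using t g by (auto simp: \<tau>_def intro!: mult_left_mono power_mono)
  note L' = fan_inside_strip[OF less_imp_le[OF \<tau>(1)] \<tau>(2) speed L]
  let ?G = "\<lambda>r. weight r * (F r)^2"
  have c1: "continuous_on UNIV (\<lambda>x. fan (x / \<tau>))"
    using \<tau> by (auto intro!: continuous_intros continuous_on_compose2[OF fan_cont])
  have c2: "continuous_on UNIV (\<lambda>x. ?G (fan (x / \<tau>)))"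
    by (rule continuous_on_compose2[OF weight_F_sq_cont c1]) (use fan_in in auto)
  have eq: "fan_dens t = (\<lambda>x. (g * t)^2 / 2 * ?G (fan (x / \<tau>)) + fan (x / \<tau>) * (g * x))"
    by (auto simp: fan_dens_def Let_def \<tau>_def)
  have cont: "continuous_on UNIV (fan_dens t)"
    unfolding eq by (intro continuous_intros c1 c2)
  show "integrable lborel (\<lambda>x. indicator {- L<..<L} x * fan_dens t x)" by (rule lint_Ioo_eq_integral(2)[OF cont])
  have 1: "((\<lambda>x. ?G (fan (x / \<tau>)) * 1) has_integral \<tau> * integral {\<rho>m..\<rho>p} (\<lambda>k. ?G k * F2 k)) {- L..L}"
    using fan_integral[OF \<tau>(1) L' weight_F_sq_cont, where a = "\<lambda>_. 1"] by (simp add: mult.commute)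
  have 2: "((\<lambda>x. fan (x / \<tau>) * (g * x)) has_integral fan_moment L (\<lambda>x. g * x^2 / 2) \<tau>) {- L..L}"
    by (rule fan_has_moment[OF \<tau>(1) L']) (auto intro!: derivative_eq_intros continuous_intros)
  have "fan_moment L (\<lambda>x. g * x^2 / 2) \<tau> = fan_moment L (\<lambda>x. g * x^2 / 2) 0 - g * \<tau>^2 / 2 * integral {\<rho>m..\<rho>p} (\<lambda>k. (F1 k)^2)"
  proof -
    have "integral {\<rho>m..\<rho>p} (\<lambda>k. g * (\<tau> * F1 k)^2 / 2) = integral {\<rho>m..\<rho>p} (\<lambda>k. (g * \<tau>^2 / 2) * (F1 k)^2)"
      by (intro integral_cong) (simp add: power_mult_distrib)
    then show ?thesis by (simp add: fan_moment_def)
  qed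
  then have 3: "fan_moment L (\<lambda>x. g * x^2 / 2) \<tau> = E0 - g * \<tau>^2 / 2 * integral {\<rho>m..\<rho>p} (\<lambda>k. (F1 k)^2)"
    by (simp add: E0_eq)
  have "(fan_dens t has_integral (g * t)^2 / 2 * (\<tau> * integral {\<rho>m..\<rho>p} (\<lambda>k. ?G k * F2 k)) + (E0 - g * \<tau>^2 / 2 * integral {\<rho>m..\<rho>p} (\<lambda>k. (F1 k)^2))) {- L..L}"
    using has_integral_add[OF has_integral_mult_right[OF 1, of "(g * t)^2 / 2"] 2] unfolding eq 3 by simp
  then have "integral {- L..L} (fan_dens t) = (g * t)^2 / 2 * (\<tau> * integral {\<rho>m..\<rho>p} (\<lambda>k. ?G k * F2 k)) + (E0 - g * \<tau>^2 / 2 * integral {\<rho>m..\<rho>p} (\<lambda>k. (F1 k)^2))"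
    by (rule integral_unique)
  also have "\<dots> = E0 + g^3 * t^4 / 8 * energy_coeff"
    unfolding energy_coeff_def \<tau>_def by (simp add: power2_eq_square power3_eq_cube power4_eq_xxxx field_simps)
  finally show "(LINT x|lborel. indicator {- L<..<L} x * fan_dens t x) = E0 + g^3 * t^4 / 8 * energy_coeff"
    by (simp add: lint_Ioo_eq_integral(1)[OF cont])
qed

lemma energy_dens_eq_fan_dens:
  "AE p in lborel. p \<in> strip L T \<longrightarrow>
    energy_dens p = fan_dens (snd p) (fst p) + (en p - energy_1d \<rho>m \<rho>p (g * snd p) (mu p) (mo p))"
  using momentum_eq
proof eventually_elim
  case (elim p)
  show ?case
  proof
    assume p: "p \<in> strip L T"
    then have mu: "mu p = fan_at p" and mo: "mo p = g * snd p * (fan_at p + F (fan_at p))" using elim by auto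
    have "fan_at p \<in> {\<rho>m..\<rho>p}" unfolding fan_at_def by (rule fan_in)
    from energy_1d_fan[OF this, of "g * snd p"]
    have "energy_1d \<rho>m \<rho>p (g * snd p) (mu p) (mo p) - mo p * (g * snd p) = (g * snd p)^2 / 2 * (weight (fan_at p) * (F (fan_at p))^2 - fan_at p)"
      unfolding mu mo by simp
    then show "energy_dens p = fan_dens (snd p) (fst p) + (en p - energy_1d \<rho>m \<rho>p (g * snd p) (mu p) (mo p))"
      unfolding energy_dens_def fan_dens_def Let_def fan_at_def[symmetric] mu
      by (simp add: power2_eq_square algebra_simps)
  qed
qed

lemma energy_slice_lower:
  assumes en: "AE p in lborel. p \<in> strip L T \<longrightarrow> energy_1d \<rho>m \<rho>p (g * snd p) (mu p) (mo p) \<le> en p"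
  shows "AE t in lborel. t \<in> {0<..<T} \<longrightarrow> E0 + g^3 * t^4 / 8 * energy_coeff \<le> energy_slice g L d z t"
proof -
  have "AE p in lborel. p \<in> strip L T \<longrightarrow> fan_dens (snd p) (fst p) \<le> energy_dens p"
    using en energy_dens_eq_fan_dens by eventually_elim auto
  from AE_lborel_pair_swap[OF this] energy_slice_eq integral_lborel_pair_swap(3)[OF energy_dens_int]
  show ?thesis
  proof eventually_elim
    case (elim t)
    show ?case
    proof
      assume t: "t \<in> {0<..<T}"
      have "E0 + g^3 * t^4 / 8 * energy_coeff = (LINT x|lborel. indicator {- L<..<L} x * fan_dens t x)" using fan_dens_integral(1)[OF t] ..
      also have "\<dots> \<le> (LINT x|lborel. indicator (strip L T) (x, t) * energy_dens (x, t))"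
      proof (rule integral_mono_AE[OF fan_dens_integral(2)[OF t] elim(3)])
        show "AE x in lborel. indicator {- L<..<L} x * fan_dens t x \<le> indicator (strip L T) (x, t) * energy_dens (x, t)"
          using elim(1) by eventually_elim (use t in \<open>auto simp: strip_def indicator_def\<close>)
      qed
      also have "\<dots> = (LINT x|lborel. indicator {- L<..<L} x * energy_dens (x, t))"
        using t by (intro Bochner_Integration.integral_cong) (auto simp: strip_def indicator_def)
      also have "\<dots> = energy_slice g L d z t" using elim(2) t by simp
      finally show "E0 + g^3 * t^4 / 8 * energy_coeff \<le> energy_slice g L d z t" .
    qed
  qed
qed

lemma energy_slice_exact:
  assumes en: "AE p in lborel. p \<in> strip L T \<longrightarrow> en p = energy_1d \<rho>m \<rho>p (g * snd p) (mu p) (mo p)"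
  shows "AE t in lborel. t \<in> {0<..<T} \<longrightarrow> energy_slice g L d z t = E0 + g^3 * t^4 / 8 * energy_coeff"
proof -
  have "AE p in lborel. p \<in> strip L T \<longrightarrow> energy_dens p = fan_dens (snd p) (fst p)"
    using en energy_dens_eq_fan_dens by eventually_elim auto
  from AE_lborel_pair_swap[OF this] energy_slice_eq integral_lborel_pair_swap(3)[OF energy_dens_int]
  show ?thesis
  proof eventually_elim
    case (elim t)
    show ?case
    proof
      assume t: "t \<in> {0<..<T}"
      have "energy_slice g L d z t = (LINT x|lborel. indicator {- L<..<L} x * energy_dens (x, t))" using elim(2) t by simp
      also have "\<dots> = (LINT x|lborel. indicator (strip L T) (x, t) * energy_dens (x, t))"
        using t by (intro Bochner_Integration.integral_cong) (auto simp: strip_def indicator_def)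
      also have "\<dots> = (LINT x|lborel. indicator {- L<..<L} x * fan_dens t x)"
      proof (rule integral_cong_AE[OF borel_measurable_integrable[OF elim(3)] borel_measurable_integrable[OF fan_dens_integral(2)[OF t]]])
        show "AE x in lborel. indicator (strip L T) (x, t) * energy_dens (x, t) = indicator {- L<..<L} x * fan_dens t x"
          using elim(1) by eventually_elim (use t in \<open>auto simp: strip_def indicator_def\<close>)
      qed
      finally show "energy_slice g L d z t = E0 + g^3 * t^4 / 8 * energy_coeff" using fan_dens_integral(1)[OF t] by simp
    qed
  qed
qed

text \<open>The antiderivative through which right-sided averages of the energy profile are computed.\<close>
lemma profile_deriv: "((\<lambda>s. E0 * s + g^3 * s^5 / 40 * energy_coeff) has_real_derivative E0 + g^3 * s^4 / 8 * energy_coeff) (at s)"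
  by (auto intro!: derivative_eq_intros)

lemma profile_cont: "continuous_on UNIV (\<lambda>s. E0 + g^3 * s^4 / 8 * energy_coeff)"
  by (intro continuous_intros; simp)

lemma dissipation_le:
  assumes en: "AE p in lborel. p \<in> strip L T \<longrightarrow> energy_1d \<rho>m \<rho>p (g * snd p) (mu p) (mo p) \<le> en p"
    and t: "t \<in> {0..<T}"
  shows "total_energy g L d z 0 - total_energy g L d z t \<le> - (g^3 * t^4 / 8 * energy_coeff)"
  using total_energy_0_le[OF T] total_energy_ge[OF profile_deriv profile_cont energy_slice_lower[OF en], of t] t by simp

lemma dissipation_eq:
  assumes en: "AE p in lborel. p \<in> strip L T \<longrightarrow> en p = energy_1d \<rho>m \<rho>p (g * snd p) (mu p) (mo p)"
    and t: "t \<in> {0..<T}"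
  shows "total_energy g L d z 0 - total_energy g L d z t = - (g^3 * t^4 / 8 * energy_coeff)"
  using total_energy_eq[OF profile_deriv profile_cont energy_slice_exact[OF en], of 0]
    total_energy_eq[OF profile_deriv profile_cont energy_slice_exact[OF en], of t] t T by simp

end

text \<open>
  The relation \<open>R\<close> is \<open>\<le>\<close> for a potentially non-strict subsolution and equality in the non-strict case, so that
  both subsolutions in the theorem are reduced to the fan by the same argument.
\<close>
lemma subsolution_fan_state:
  fixes d :: "'n::finite"
  assumes flux: "convex_flux \<rho>m \<rho>p F F1 F2" and g: "0 < g" and L: "0 < L" and T: "0 < T"
    and speed: "- F1 \<rho>m * (g * T^2 / 2) < L" "F1 \<rho>p * (g * T^2 / 2) < L"
    and ws: "weak_solution g L T \<rho>m \<rho>p d z q \<nu>" and od: "one_dimensional g L T \<rho>m \<rho>p d z q \<nu>"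
    and en: "AE p in lborel. p \<in> dom g L T d \<longrightarrow> R (energy_1d \<rho>m \<rho>p (g * snd p) (z_mu (z p)) (z_m (z p) $ d)) (z_e (z p))"
    and sol: "entropy_solution g T \<rho>m \<rho>p F \<rho>" and dens: "density_from g L T d z \<rho>"
  obtains mu mo en C where "fan_state d g L T \<rho>m \<rho>p z q \<nu> mu mo en C F F1 F2"
    "AE p in lborel. p \<in> strip L T \<longrightarrow> R (energy_1d \<rho>m \<rho>p (g * snd p) (mu p) (mo p)) (en p)"
proof -
  interpret convex_flux \<rho>m \<rho>p F F1 F2 by (rule flux)
  have "AE p in lborel. p \<in> dom g L T d \<longrightarrow> z_mu (z p) = \<rho> (to_strip g d p)"
    using dens unfolding density_from_def by eventually_elim (auto simp: to_strip_def)
  with en have "AE p in lborel. p \<in> dom g L T d \<longrightarrow>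
      R (energy_1d \<rho>m \<rho>p (g * snd (to_strip g d p)) (z_mu (z p)) (z_m (z p) $ d)) (z_e (z p)) \<and> z_mu (z p) = \<rho> (to_strip g d p)"
    by eventually_elim (auto simp: to_strip_def)
  then obtain mu mo en C where fields:
    "mu \<in> borel_measurable borel" "mo \<in> borel_measurable borel" "en \<in> borel_measurable borel"
    "\<And>q. \<bar>mu q\<bar> \<le> C" "\<And>q. \<bar>mo q\<bar> \<le> C" "\<And>q. \<bar>en q\<bar> \<le> C"
    "AE p in lborel. fst p \<in> cell d \<and> p \<in> dom g L T d \<longrightarrow>
       z_mu (z p) = mu (to_strip g d p) \<and> z_m (z p) $ d = mo (to_strip g d p) \<and> z_e (z p) = en (to_strip g d p)"
    and P: "AE p in lborel. p \<in> strip L T \<longrightarrow> R (energy_1d \<rho>m \<rho>p (g * snd p) (mu p) (mo p)) (en p) \<and> mu p = \<rho> p"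
    using strip_fields[OF weak_solution_Linf[OF ws] od,
        of "\<lambda>m' mo' e' p. R (energy_1d \<rho>m \<rho>p (g * snd p) m' mo') e' \<and> m' = \<rho> p"] by blast
  have "AE p in lborel. p \<in> strip L T \<longrightarrow> mu p = fan (fst p / (g * (snd p)^2 / 2))"
    using P entropy_solution_eq_fan[OF sol g] by eventually_elim (auto simp: strip_def)
  then have "fan_state d g L T \<rho>m \<rho>p z q \<nu> mu mo en C F F1 F2"
    by unfold_locales (use ws fields g L T speed in \<open>auto simp: mult.commute\<close>)
  moreover have "AE p in lborel. p \<in> strip L T \<longrightarrow> R (energy_1d \<rho>m \<rho>p (g * snd p) (mu p) (mo p)) (en p)"
    using P by eventually_elim auto
  ultimately show ?thesis by (rule that)
qed

theorem proposition1p4: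
  fixes d :: "'n::finite"
    and g L T \<rho>m \<rho>p :: real
    and F :: "real \<Rightarrow> real"
    and z z3 :: "(real^'n) \<times> real \<Rightarrow> 'n Z"
    and q q3 :: "(real^'n) \<times> real \<Rightarrow> real"
    and \<nu> \<nu>3 :: "((real^'n) \<times> real \<Rightarrow> real) \<Rightarrow> real"
    and \<rho> \<rho>3 :: "real \<times> real \<Rightarrow> real"
  assumes "CARD('n) \<in> {2, 3}"
    and "0 < g" and "0 < L" and "0 < \<rho>m" and "\<rho>m < \<rho>p" and "0 < T"
    and "uniformly_convex_C2 \<rho>m \<rho>p F" and "F \<rho>m = 0" and "F \<rho>p = 0"
    and "Max {- deriv_on \<rho>m \<rho>p F \<rho>m, deriv_on \<rho>m \<rho>p F \<rho>p,
              - deriv_on \<rho>m \<rho>p (F_third \<rho>m \<rho>p) \<rho>m, deriv_on \<rho>m \<rho>p (F_third \<rho>m \<rho>p) \<rho>p}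
         * (g * T^2 / 2) < L"
    and "strict_subsolution_1d g L T \<rho>m \<rho>p d z q \<nu> \<or> nonstrict_subsolution_1d g L T \<rho>m \<rho>p d z q \<nu>"
    and "entropy_solution g T \<rho>m \<rho>p F \<rho>"
    and "density_from g L T d z \<rho>"
    and "nonstrict_subsolution_1d g L T \<rho>m \<rho>p d z3 q3 \<nu>3"
    and "entropy_solution g T \<rho>m \<rho>p (F_third \<rho>m \<rho>p) \<rho>3"
    and "density_from g L T d z3 \<rho>3"
  shows "\<forall>t\<in>{0..<T}. total_energy g L d z 0 - total_energy g L d z t
           \<le> total_energy g L d z3 0 - total_energy g L d z3 t"
proof -
  let ?F1 = "deriv_on \<rho>m \<rho>p F" and ?F2 = "deriv_on \<rho>m \<rho>p (deriv_on \<rho>m \<rho>p F)"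
  interpret D: densities \<rho>m \<rho>p using assms(4,5) by unfold_locales
  let ?T1 = "\<lambda>r. - (1 / 3) * D.inv_weight1 r" and ?T2 = "\<lambda>r. - (1 / 3) * D.inv_weight2 r"
  have flux: "convex_flux \<rho>m \<rho>p F ?F1 ?F2" by (rule convex_flux_deriv_on[OF assms(4,5,7,8,9)])
  have flux3: "convex_flux \<rho>m \<rho>p (F_third \<rho>m \<rho>p) ?T1 ?T2" by (rule D.convex_flux_F_third)
  have T1: "deriv_on \<rho>m \<rho>p (F_third \<rho>m \<rho>p) r = ?T1 r" if "r \<in> {\<rho>m..\<rho>p}" for r
    by (rule convex_flux.deriv_on_F[OF flux3 that])
  define M where "M = {- ?F1 \<rho>m, ?F1 \<rho>p, - deriv_on \<rho>m \<rho>p (F_third \<rho>m \<rho>p) \<rho>m, deriv_on \<rho>m \<rho>p (F_third \<rho>m \<rho>p) \<rho>p}"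
  have speed: "s * (g * T^2 / 2) < L" if "s \<in> M" for s
  proof -
    have "s \<le> Max M" using that by (intro Max_ge) (auto simp: M_def)
    then have "s * (g * T^2 / 2) \<le> Max M * (g * T^2 / 2)"
      using assms(2) by (intro mult_right_mono) (auto simp: less_imp_le)
    also have "\<dots> < L" using assms(10) by (simp only: M_def)
    finally show ?thesis .
  qed
  have speeds: "- ?F1 \<rho>m * (g * T^2 / 2) < L" "?F1 \<rho>p * (g * T^2 / 2) < L"
    "- deriv_on \<rho>m \<rho>p (F_third \<rho>m \<rho>p) \<rho>m * (g * T^2 / 2) < L" "deriv_on \<rho>m \<rho>p (F_third \<rho>m \<rho>p) \<rho>p * (g * T^2 / 2) < L"
    by (rule speed, simp add: M_def)+
  have ws: "weak_solution g L T \<rho>m \<rho>p d z q \<nu>" and od: "one_dimensional g L T \<rho>m \<rho>p d z q \<nu>"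
    using assms(11) by (auto simp: strict_subsolution_1d_def strict_subsolution_def nonstrict_subsolution_1d_def)
  have ws3: "weak_solution g L T \<rho>m \<rho>p d z3 q3 \<nu>3" and od3: "one_dimensional g L T \<rho>m \<rho>p d z3 q3 \<nu>3"
    using assms(14) by (auto simp: nonstrict_subsolution_1d_def)
  have en: "AE p in lborel. p \<in> dom g L T d \<longrightarrow>
     energy_1d \<rho>m \<rho>p (g * snd p) (z_mu (z p)) (z_m (z p) $ d) \<le> z_e (z p)"
    using assms(11)
  proof
    assume "nonstrict_subsolution_1d g L T \<rho>m \<rho>p d z q \<nu>"
    from nonstrict_subsolution_energy[OF assms(1) this] show ?thesis by eventually_elim auto
  qed (rule strict_subsolution_energy[OF assms(1)])
  have en3: "AE p in lborel. p \<in> dom g L T d \<longrightarrow>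
     z_e (z3 p) = energy_1d \<rho>m \<rho>p (g * snd p) (z_mu (z3 p)) (z_m (z3 p) $ d)"
    by (rule nonstrict_subsolution_energy[OF assms(1,14)])
  obtain mu mo en C where S: "fan_state d g L T \<rho>m \<rho>p z q \<nu> mu mo en C F ?F1 ?F2"
    "AE p in lborel. p \<in> strip L T \<longrightarrow> energy_1d \<rho>m \<rho>p (g * snd p) (mu p) (mo p) \<le> en p"
    by (rule subsolution_fan_state[OF flux assms(2,3,6) speeds(1,2) ws od en assms(12,13)])
  obtain mu3 mo3 en3 C3 where S3: "fan_state d g L T \<rho>m \<rho>p z3 q3 \<nu>3 mu3 mo3 en3 C3 (F_third \<rho>m \<rho>p) ?T1 ?T2"
    "AE p in lborel. p \<in> strip L T \<longrightarrow> en3 p = energy_1d \<rho>m \<rho>p (g * snd p) (mu3 p) (mo3 p)"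
  proof (rule subsolution_fan_state[OF flux3 assms(2,3,6) _ _ ws3 od3 _ assms(15,16), of "\<lambda>a b. b = a"])
    show "- ?T1 \<rho>m * (g * T^2 / 2) < L" "?T1 \<rho>p * (g * T^2 / 2) < L"
      using speeds(3,4) D.rho by (simp_all only: T1 atLeastAtMost_iff order_refl less_imp_le)
    show "AE p in lborel. p \<in> dom g L T d \<longrightarrow>
       z_e (z3 p) = energy_1d \<rho>m \<rho>p (g * snd p) (z_mu (z3 p)) (z_m (z3 p) $ d)" by (rule en3)
  qed
  show ?thesis
  proof
    fix t assume t: "t \<in> {0..<T}"
    have "g^3 * t^4 / 8 * convex_flux.energy_coeff \<rho>m \<rho>p (F_third \<rho>m \<rho>p) ?T1 ?T2 \<le> g^3 * t^4 / 8 * convex_flux.energy_coeff \<rho>m \<rho>p F ?F1 ?F2"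
      using convex_flux.energy_coeff_F_third_le[OF flux] assms(2) by (intro mult_left_mono) auto
    with fan_state.dissipation_le[OF S t] fan_state.dissipation_eq[OF S3 t]
    show "total_energy g L d z 0 - total_energy g L d z t \<le> total_energy g L d z3 0 - total_energy g L d z3 t"
      by linarith
  qed
qed

end
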